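(* Let $k,\ell,m,n$ be integers with $\ell,n\ge 1$, $2\le k\le n$ and $0\le m\le k-1$. Let $I\subseteq\mathbf{C}[x_1,\dots,x_n]$ be the ideal of all polynomials vanishing on $X_{k,\ell,n}\cup Y_{m+1,n}$. For $\mu\in\mathbf{Z}_{\ge0}^n$ let $f_\mu$ denote the non-symmetric Jack polynomial of type $G(\ell,1,n)$ with the parameter $c_0$ specialized to $1/k$. Then $I$ has the vector space basis $$I=\mathbf{C}\{f_\mu \mid \mu\in\mathbf{Z}_{\ge0}^n,\ \mu^-_{m+1}\ge 1 \text{ and } \mu \text{ is } (\ell,k)\text{-admissible}\}.$$
   Context: $X_{k,\ell,n}$ is the set of $(x_1,\dots,x_n)\in\mathbf{C}^n$ such that some $k$ of the coordinates have equal $\ell$th powers. $Y_{m+1,n}$ is the set of $(x_1,\dots,x_n)\in\mathbf{C}^n$ such that at least $m+1$ of the coordinates are $0$. Compositions. For $\mu\in\mathbf{Z}_{\ge0}^n$, $\mu^-$ is its non-decreasing rearrangement and $w_\mu\in S_n$ is the longest permutation with $w_\mu\cdot\mu=\mu^-$, where $(w\cdot\mu)_i=\mu_{w^{-1}(i)}$. For positive integers $j,k$, $\mu$ is $(j,k)$-admissible if for all $k\le i\le n$ we have $\mu^-_i\ge\mu^-_{i-(k-1)}+j$, with equality implying $w_\mu^{-1}(i)<w_\mu^{-1}(i-(k-1))$. Jack polynomials. Let $\zeta$ be a fixed primitive $\ell$th root of $1$. $G(\ell,1,n)$ is the group of $n\times n$ monomial matrices whose non-zero entries are $\ell$th roots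 of $1$; $\zeta_i$ is the diagonal matrix with $\zeta$ in position $i$ and $1$ in the other diagonal positions, and $s_{ij}$ is the transposition matrix. The group acts on polynomials by $(wf)(v)=f(w^{-1}v)$, so $\zeta_i x_i=\zeta^{-1}x_i$. With $c_0$ an indeterminate, define operators on $\mathbf{C}(c_0)[x_1,\dots,x_n]$ by $$y_i f=\frac{\partial f}{\partial x_i}-c_0\sum_{j\ne i}\sum_{r=0}^{\ell-1}\frac{f-\zeta_i^r s_{ij}\zeta_i^{-r}f}{x_i-\zeta^r x_j},\qquad z_i=y_ix_i+c_0\sum_{1\le j<i}\sum_{r=0}^{\ell-1}\zeta_i^rs_{ij}\zeta_i^{-r}.$$ The operators $z_1,\dots,z_n,\zeta_1,\dots,\zeta_n$ commute. The non-symmetric Jack polynomial $f_\mu\in\mathbf{C}(c_0)[x_1,\dots,x_n]$ is the unique polynomial in which $x^\mu=x_1^{\mu_1}\cdots x_n^{\mu_n}$ has coefficient $1$ and such that, for all $i$, $\zeta_if_\mu=\zeta^{-\mu_i}f_\mu$ and $z_if_\mu=\left(\mu_i+1-\ell c_0(w_\mu(i)-1)\right)f_\mu$. For the $\mu$ occurring in the claim, the coefficients of $f_\mu$ have no pole at $c_0=1/k$, so the specialization makes sense. *)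

theory Defs
  imports
    Complex_Main
    "HOL-Library.FuncSet"
    "HOL-Library.Poly_Mapping"
    "HOL-Computational_Algebra.Polynomial"
    "HOL-Computational_Algebra.Fraction_Field"
    "HOL-Combinatorics.Permutations"
begin

section \<open>Polynomials in several variables\<close>

text \<open>
  A polynomial maps exponent vectors to coefficients with finite support. Variables are
  indexed by natural numbers; the ring in the variables \<open>x\<^sub>1, \<dots>, x\<^sub>n\<close> is \<open>poly_ring n\<close>, and
  the exponent vectors in \<open>\<int>\<^sub>\<ge>\<^sub>0\<^sup>n\<close> are those supported on \<open>{1..n}\<close>.
\<close>

type_synonym 'a mpoly = "(nat \<Rightarrow>\<^sub>0 nat) \<Rightarrow>\<^sub>0 'a"

definition compositions :: "nat \<Rightarrow> (nat \<Rightarrow>\<^sub>0 nat) set" where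
  "compositions n = {\<mu>. Poly_Mapping.keys \<mu> \<subseteq> {1..n}}"

definition poly_ring :: "nat \<Rightarrow> 'a::zero mpoly set" where
  "poly_ring n = {f. Poly_Mapping.keys f \<subseteq> compositions n}"

definition const :: "'a::zero \<Rightarrow> 'a mpoly" where
  "const a = Poly_Mapping.single 0 a"

definition var :: "nat \<Rightarrow> 'a::zero_neq_one mpoly" where
  "var i = Poly_Mapping.single (Poly_Mapping.single i 1) 1"

definition eval :: "(nat \<Rightarrow> 'a) \<Rightarrow> 'a::comm_semiring_1 mpoly \<Rightarrow> 'a" where
  "eval v f = (\<Sum>\<alpha>\<in>Poly_Mapping.keys f.
     Poly_Mapping.lookup f \<alpha> * (\<Prod>i\<in>Poly_Mapping.keys \<alpha>. v i ^ Poly_Mapping.lookup \<alpha> i))"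

definition subst :: "(nat \<Rightarrow> 'a mpoly) \<Rightarrow> 'a::comm_semiring_1 mpoly \<Rightarrow> 'a mpoly" where
  "subst \<sigma> f = (\<Sum>\<alpha>\<in>Poly_Mapping.keys f.
     const (Poly_Mapping.lookup f \<alpha>)
       * (\<Prod>i\<in>Poly_Mapping.keys \<alpha>. \<sigma> i ^ Poly_Mapping.lookup \<alpha> i))"

definition partial_deriv :: "nat \<Rightarrow> 'a::comm_semiring_1 mpoly \<Rightarrow> 'a mpoly" where
  "partial_deriv i f = (\<Sum>\<alpha>\<in>Poly_Mapping.keys f.
     Poly_Mapping.single (\<alpha> - Poly_Mapping.single i 1)
       (of_nat (Poly_Mapping.lookup \<alpha> i) * Poly_Mapping.lookup f \<alpha>))"

text \<open>Only used when \<open>g\<close> is nonzero and divides \<open>f\<close>; the quotient is then unique.\<close>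

definition exact_quot :: "'a::comm_ring_1 mpoly \<Rightarrow> 'a mpoly \<Rightarrow> 'a mpoly" where
  "exact_quot f g = (THE q. q * g = f)"

global_interpretation mpoly: vector_space "\<lambda>(c :: 'a::field) (f :: 'a mpoly). const c * f"
  by unfold_locales
    (simp_all add: const_def algebra_simps single_add mult_single flip: mult.assoc)


section \<open>The varieties\<close>

definition affine_space :: "nat \<Rightarrow> (nat \<Rightarrow> complex) set" where
  "affine_space n = {1..n} \<rightarrow>\<^sub>E UNIV"

definition X_var :: "nat \<Rightarrow> nat \<Rightarrow> nat \<Rightarrow> (nat \<Rightarrow> complex) set" where
  "X_var k l n = {x \<in> affine_space n.
     \<exists>S\<subseteq>{1..n}. card S = k \<and> (\<forall>i\<in>S. \<forall>j\<in>S. x i ^ l = x j ^ l)}"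

text \<open>At least \<open>p\<close> coordinates vanish.\<close>

definition Y_var :: "nat \<Rightarrow> nat \<Rightarrow> (nat \<Rightarrow> complex) set" where
  "Y_var p n = {x \<in> affine_space n. card {i \<in> {1..n}. x i = 0} \<ge> p}"

definition vanishing_ideal :: "nat \<Rightarrow> (nat \<Rightarrow> complex) set \<Rightarrow> complex mpoly set" where
  "vanishing_ideal n V = {f \<in> poly_ring n. \<forall>x\<in>V. eval x f = 0}"


section \<open>Compositions\<close>

text \<open>\<open>nondec n \<mu> i\<close> is \<open>\<mu>\<^sup>-\<^sub>i\<close>, meaningful for \<open>1 \<le> i \<le> n\<close>.\<close>

definition nondec :: "nat \<Rightarrow> (nat \<Rightarrow>\<^sub>0 nat) \<Rightarrow> nat \<Rightarrow> nat" where
  "nondec n \<mu> i = sort (map (Poly_Mapping.lookup \<mu>) [1..<Suc n]) ! (i - 1)"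

definition perm_length :: "nat \<Rightarrow> (nat \<Rightarrow> nat) \<Rightarrow> nat" where
  "perm_length n w = card {(i, j). 1 \<le> i \<and> i < j \<and> j \<le> n \<and> w i > w j}"

definition sorting_perm :: "nat \<Rightarrow> (nat \<Rightarrow>\<^sub>0 nat) \<Rightarrow> nat \<Rightarrow> nat" where
  "sorting_perm n \<mu> = (ARG_MAX (perm_length n) w.
     w permutes {1..n} \<and> (\<forall>i\<in>{1..n}. Poly_Mapping.lookup \<mu> (inv w i) = nondec n \<mu> i))"

definition admissible :: "nat \<Rightarrow> nat \<Rightarrow> nat \<Rightarrow> (nat \<Rightarrow>\<^sub>0 nat) \<Rightarrow> bool" where
  "admissible n j k \<mu> \<longleftrightarrow> (\<forall>i\<in>{k..n}.
     nondec n \<mu> i \<ge> nondec n \<mu> (i - (k - 1)) + j \<and>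
     (nondec n \<mu> i = nondec n \<mu> (i - (k - 1)) + j \<longrightarrow>
        inv (sorting_perm n \<mu>) i < inv (sorting_perm n \<mu>) (i - (k - 1))))"


section \<open>Action of the reflection group and Dunkl operators\<close>

text \<open>
  The group acts by \<open>(w f)(v) = f (w\<^sup>-\<^sup>1 v)\<close>, so the diagonal matrix with entry \<open>a\<close> in position
  \<open>i\<close> (and \<open>1\<close> elsewhere) substitutes \<open>a\<^sup>-\<^sup>1 x\<^sub>i\<close> for \<open>x\<^sub>i\<close>. The operator \<open>\<zeta>\<^sub>i\<^sup>r\<close> is \<open>diag_act i (\<zeta> ^ r)\<close>.
\<close>

definition diag_act :: "nat \<Rightarrow> 'a::field \<Rightarrow> 'a mpoly \<Rightarrow> 'a mpoly" where
  "diag_act i a = subst (\<lambda>t. if t = i then const (inverse a) * var i else var t)"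

definition swap_act :: "nat \<Rightarrow> nat \<Rightarrow> 'a::field mpoly \<Rightarrow> 'a mpoly" where
  "swap_act i j = subst (\<lambda>t. var (transpose i j t))"

text \<open>The action of \<open>\<zeta>\<^sub>i\<^sup>r s\<^sub>i\<^sub>j \<zeta>\<^sub>i\<^sup>-\<^sup>r\<close>.\<close>

definition refl_act :: "'a::field \<Rightarrow> nat \<Rightarrow> nat \<Rightarrow> nat \<Rightarrow> 'a mpoly \<Rightarrow> 'a mpoly" where
  "refl_act \<zeta> i j r f =
     diag_act i (\<zeta> ^ r) (swap_act i j (diag_act i (inverse (\<zeta> ^ r)) f))"

context
  fixes n l :: nat and \<zeta> c\<^sub>0 :: "'a::field"
begin

definition dunkl_y :: "nat \<Rightarrow> 'a mpoly \<Rightarrow> 'a mpoly" where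
  "dunkl_y i f = partial_deriv i f - const c\<^sub>0 *
     (\<Sum>j\<in>{1..n} - {i}. \<Sum>r<l.
        exact_quot (f - refl_act \<zeta> i j r f) (var i - const (\<zeta> ^ r) * var j))"

definition dunkl_z :: "nat \<Rightarrow> 'a mpoly \<Rightarrow> 'a mpoly" where
  "dunkl_z i f = dunkl_y i (var i * f) +
     const c\<^sub>0 * (\<Sum>j\<in>{1..<i}. \<Sum>r<l. refl_act \<zeta> i j r f)"

definition is_jack :: "(nat \<Rightarrow>\<^sub>0 nat) \<Rightarrow> 'a mpoly \<Rightarrow> bool" where
  "is_jack \<mu> f \<longleftrightarrow> f \<in> poly_ring n \<and> Poly_Mapping.lookup f \<mu> = 1 \<and>
     (\<forall>i\<in>{1..n}.
        diag_act i \<zeta> f = const (inverse \<zeta> ^ Poly_Mapping.lookup \<mu> i) * f \<and>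
        dunkl_z i f =
          const (of_nat (Poly_Mapping.lookup \<mu> i) + 1
                  - of_nat l * c\<^sub>0 * (of_nat (sorting_perm n \<mu> i) - 1)) * f)"

end


section \<open>Non-symmetric Jack polynomials and their specialization\<close>

text \<open>The field \<open>\<complex>(c\<^sub>0)\<close> is \<open>complex poly fract\<close>, where \<open>c\<^sub>0\<close> is the polynomial indeterminate.\<close>

definition embed :: "complex poly \<Rightarrow> complex poly fract" where
  "embed p = Fract p 1"

definition generic_jack ::
    "nat \<Rightarrow> nat \<Rightarrow> complex \<Rightarrow> (nat \<Rightarrow>\<^sub>0 nat) \<Rightarrow> complex poly fract mpoly" where
  "generic_jack n l \<zeta> \<mu> = (THE f. is_jack n l (embed [:\<zeta>:]) (embed [:0, 1:]) \<mu> f)"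

text \<open>The value of a rational function at \<open>a\<close>; unspecified if it has a pole there.\<close>

definition specialize :: "complex \<Rightarrow> complex poly fract \<Rightarrow> complex" where
  "specialize a u =
     (THE y. \<exists>p q. u = Fract p q \<and> poly q a \<noteq> 0 \<and> y = poly p a / poly q a)"

definition jack :: "nat \<Rightarrow> nat \<Rightarrow> complex \<Rightarrow> complex \<Rightarrow> (nat \<Rightarrow>\<^sub>0 nat) \<Rightarrow> complex mpoly" where
  "jack n l \<zeta> a \<mu> = Poly_Mapping.map (specialize a) (generic_jack n l \<zeta> \<mu>)"

definition primitive_root_unity :: "nat \<Rightarrow> complex \<Rightarrow> bool" where
  "primitive_root_unity l \<zeta> \<longleftrightarrow> \<zeta> ^ l = 1 \<and> (\<forall>d. 0 < d \<and> d < l \<longrightarrow> \<zeta> ^ d \<noteq> 1)"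

end

theory Submission
  imports Defs
begin

text \<open>
  The operators \<open>z\<^sub>i\<close> are triangular on monomials for the order given by the convex function
  \<open>psi\<close>, the sum of the squares of the keys \<open>(n + 1) \<mu>\<^sub>i - i\<close>, and they preserve the ideal \<open>I\<close>
  at \<open>c\<^sub>0 = 1/k\<close>. Let \<open>M\<close> be the indexing set of the claimed basis.

  Every \<open>psi\<close>-maximal exponent of an element of \<open>I\<close> lies in \<open>M\<close>: if \<open>\<mu>\<close> is not admissible,
  restriction to a component of \<open>X\<close> gives a linear relation, valid on \<open>I\<close>, between the
  coefficient of \<open>x\<^sup>\<mu>\<close> and coefficients at exponents with larger \<open>psi\<close>. Conversely each \<open>\<mu> \<in> M\<close> is
  the leading exponent of a monomial times a product of \<open>k - 1\<close> Vandermonde determinants in the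
  \<open>x\<^sub>i\<^sup>l\<close>, which lies in \<open>I\<close>. So \<open>I\<close> has the expected size.

  For generic \<open>c\<^sub>0\<close> joint eigenvectors exist by the intertwiners of Knop and Sahi. For \<open>\<mu> \<in> M\<close> the
  joint eigenvalue remains simple at \<open>c\<^sub>0 = 1/k\<close>. Hence clearing denominators in \<open>f\<^sub>\<mu>\<close> and
  specializing yields an eigenvector with leading exponent \<open>\<mu>\<close>, which shows that there was no
  pole, and the normal form of \<open>f\<^sub>\<mu>\<close> modulo \<open>I\<close>, whose leading exponent would have the same
  eigenvalue but lie outside \<open>M\<close>, must vanish.
\<close>

text \<open>One inequality drives the argument: admissibility says that the keys at ranks
  \<open>r\<close> and \<open>r + (k - 1)\<close> differ by more than (n + 1) l. It makes the
  eigenvalue simple and the diagonal term of the Vandermonde product lead; its failure puts k keys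
  into a half-open window of length (n + 1) l, where every nonzero shift of the entries by multiples
  of l with total 0 raises the sum of squares. The obstacle is that specialization may merge
  eigenvalues that differ for generic c_0. The \<zeta>_i fix exponents modulo l, so only exponents
  congruent to \<mu> compete; for these, equal eigenvalues at 1/k couple a shift of an entry by l q
  with a shift of its rank by k q, which the inequality excludes. The value 1/k is also what
  preserves the ideal: where exactly k coordinates share their l-th power, z_i f becomes 1/k times
  the Euler derivative of f along the joint scaling of these coordinates. Since \<open>psi\<close>
  does not separate all exponents, a leading exponent is any maximizer.\<close>

abbreviation "lookup \<equiv> Poly_Mapping.lookup"
abbreviation "keys \<equiv> Poly_Mapping.keys"
abbreviation "single \<equiv> Poly_Mapping.single"

section \<open>Polynomials and substitutions\<close>

lemma sum_single_keys: "(\<Sum>\<alpha>\<in>keys f. single \<alpha> (lookup f \<alpha>)) = f"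
proof (rule poly_mapping_eqI)
  fix \<beta>
  show "lookup (\<Sum>\<alpha>\<in>keys f. single \<alpha> (lookup f \<alpha>)) \<beta> = lookup f \<beta>"
    by (simp add: lookup_sum lookup_single when_def sum.delta in_keys_iff)
qed

lemma mpoly_induct_single [case_names single add]:
  fixes f :: "'a \<Rightarrow>\<^sub>0 'b::comm_monoid_add"
  assumes "\<And>\<alpha> c. P (single \<alpha> c)" and "\<And>f g. P f \<Longrightarrow> P g \<Longrightarrow> P (f + g)"
  shows "P f"
proof -
  have "P (\<Sum>\<alpha>\<in>A. single \<alpha> (lookup f \<alpha>))" if "finite A" for A
    using that
  proof induction
    case empty
    show ?case using assms(1)[of undefined 0] by simp
  next
    case (insert x F)
    then show ?case using assms by simp
  qed
  from this[of "keys f"] show ?thesis by (simp add: sum_single_keys)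
qed

definition monom_val :: "(nat \<Rightarrow> 'b::comm_semiring_1) \<Rightarrow> (nat \<Rightarrow>\<^sub>0 nat) \<Rightarrow> 'b" where
  "monom_val v \<alpha> = (\<Prod>i\<in>keys \<alpha>. v i ^ lookup \<alpha> i)"

lemma monom_val_superset:
  assumes "finite A" "keys \<alpha> \<subseteq> A"
  shows "monom_val v \<alpha> = (\<Prod>i\<in>A. v i ^ lookup \<alpha> i)"
  unfolding monom_val_def
  by (rule prod.mono_neutral_left) (use assms in \<open>auto simp: in_keys_iff\<close>)

lemma monom_val_0 [simp]: "monom_val v 0 = 1"
  by (simp add: monom_val_def)

lemma monom_val_add: "monom_val v (\<alpha> + \<beta>) = monom_val v \<alpha> * monom_val v \<beta>"
proof -
  let ?A = "keys \<alpha> \<union> keys \<beta>"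
  have "keys (\<alpha> + \<beta>) \<subseteq> ?A" by (rule keys_add)
  then show ?thesis
    by (simp add: monom_val_superset[of ?A] lookup_add power_add prod.distrib)
qed

lemma monom_val_single [simp]: "monom_val v (single i a) = v i ^ a"
  by (simp add: monom_val_def)

text \<open>\<open>eval\<close> and \<open>subst\<close> are both such sums, with coefficient map
  \<open>h\<close> the identity or \<open>const\<close>, so additivity is proved for both at
  once.\<close>

lemma hom_superset:
  assumes "finite A" "keys f \<subseteq> A" "h 0 = 0"
  shows "(\<Sum>\<alpha>\<in>keys f. h (lookup f \<alpha>) * monom_val v \<alpha>) =
    (\<Sum>\<alpha>\<in>A. h (lookup f \<alpha>) * monom_val v \<alpha>)"
  by (rule sum.mono_neutral_left) (use assms in \<open>auto simp: in_keys_iff\<close>)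

lemma hom_add:
  assumes "h 0 = 0" "\<And>a b. h (a + b) = h a + h b"
  shows "(\<Sum>\<alpha>\<in>keys (f + g). h (lookup (f + g) \<alpha>) * monom_val v \<alpha>) =
    (\<Sum>\<alpha>\<in>keys f. h (lookup f \<alpha>) * monom_val v \<alpha>) +
    (\<Sum>\<alpha>\<in>keys g. h (lookup g \<alpha>) * monom_val v \<alpha>)"
proof -
  let ?A = "keys f \<union> keys g"
  have "keys (f + g) \<subseteq> ?A" by (rule keys_add)
  then show ?thesis
    by (subst hom_superset[of ?A f], simp_all add: assms(1), subst hom_superset[of ?A g],
        simp_all add: assms(1), subst hom_superset[of ?A "f + g"])
      (simp_all add: assms lookup_add distrib_right sum.distrib)
qed

lemma eval_eq: "eval v f = (\<Sum>\<alpha>\<in>keys f. lookup f \<alpha> * monom_val v \<alpha>)"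
  by (simp add: eval_def monom_val_def)

lemma subst_eq: "subst v f = (\<Sum>\<alpha>\<in>keys f. const (lookup f \<alpha>) * monom_val v \<alpha>)"
  by (simp add: subst_def monom_val_def)

lemma const_0 [simp]: "const 0 = 0"
  and const_1 [simp]: "const 1 = 1"
  and const_add: "const (a + b) = const a + const b"
  and const_mult: "const (c * d) = const c * const d"
  by (simp_all add: const_def single_add mult_single)

lemma const_uminus: "const (- a :: 'a::ab_group_add) = - const a"
  by (simp add: const_def single_uminus)

lemma const_diff: "const (a - b :: 'a::ab_group_add) = const a - const b"
  by (simp add: const_def single_diff)

lemma const_power: "const (a ^ m) = const a ^ m"
  by (induction m) (simp_all add: const_mult)

lemma const_sum: "const (sum h A) = (\<Sum>x\<in>A. const (h x))"
  by (induction A rule: infinite_finite_induct) (simp_all add: const_add)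

lemma const_inj [simp]: "const a = const b \<longleftrightarrow> a = b"
  by (simp add: const_def) (metis lookup_single_eq)

lemma const_mult_single: "const c * single \<alpha> d = single \<alpha> (c * d)"
  by (simp add: const_def mult_single)

lemma single_eq_const_mult: "single \<alpha> c = const c * single \<alpha> (1::'a::comm_semiring_1)"
  by (simp add: const_mult_single)

lemma lookup_const_mult [simp]: "lookup (const c * f) \<alpha> = c * lookup f \<alpha>"
  for f :: "'a::comm_semiring_1 mpoly"
proof (induction f rule: mpoly_induct_single)
  case (single \<beta> d)
  then show ?case by (simp add: const_mult_single lookup_single when_def)
next
  case (add f g)
  then show ?case by (simp add: distrib_left lookup_add)
qed

lemma var_power: "var i ^ a = single (single i a) (1::'a::comm_semiring_1)"
  by (induction a) (simp_all add: var_def mult_single single_add[symmetric])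

lemma monom_val_var: "monom_val var \<alpha> = single \<alpha> (1::'a::comm_semiring_1)"
proof -
  have *: "(\<Prod>i\<in>A. single (single i (lookup \<alpha> i)) (1::'a)) = single (\<Sum>i\<in>A. single i (lookup \<alpha> i)) 1"
    if "finite A" for A
    using that by induction (simp_all add: mult_single)
  show ?thesis
    by (simp add: monom_val_def var_power * sum_single_keys)
qed

lemma eval_add [simp]: "eval v (f + g) = eval v f + eval v g"
  unfolding eval_eq by (rule hom_add[where h = "\<lambda>x. x"]) auto

lemma subst_add [simp]: "subst v (f + g) = subst v f + subst v g"
  unfolding subst_eq by (rule hom_add) (auto simp: const_add)

lemma eval_single: "eval v (single \<alpha> c) = c * monom_val v \<alpha>"
  by (simp add: eval_eq)

lemma subst_single: "subst v (single \<alpha> c) = const c * monom_val v \<alpha>"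
  by (simp add: subst_eq)

lemma eval_0 [simp]: "eval v 0 = 0"
  by (simp add: eval_eq)

lemma subst_0 [simp]: "subst v 0 = 0"
  by (simp add: subst_eq)

lemma eval_mult [simp]: "eval v (f * g) = eval v f * eval v g"
proof (induction f rule: mpoly_induct_single)
  case (single \<alpha> c)
  show ?case
  proof (induction g rule: mpoly_induct_single)
    case (single \<beta> d)
    show ?case by (simp add: mult_single eval_single monom_val_add ac_simps)
  qed (simp add: distrib_left)
qed (simp add: distrib_right)

lemma subst_mult [simp]: "subst v (f * g) = subst v f * subst v g"
proof (induction f rule: mpoly_induct_single)
  case (single \<alpha> c)
  show ?case
  proof (induction g rule: mpoly_induct_single)
    case (single \<beta> d)
    show ?case by (simp add: mult_single subst_single monom_val_add const_mult ac_simps)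
  qed (simp add: distrib_left)
qed (simp add: distrib_right)

lemma eval_const [simp]: "eval v (const c) = c"
  by (simp add: const_def eval_single)

lemma subst_const [simp]: "subst v (const c) = const c"
  by (simp add: const_def subst_single)

lemma eval_var [simp]: "eval v (var i) = v i"
  by (simp add: var_def eval_single)

lemma subst_var [simp]: "subst v (var i) = v i"
  by (simp add: var_def subst_single)

lemma eval_uminus [simp]: "eval v (- f) = - eval v f"
  for f :: "'a::comm_ring_1 mpoly"
  by (metis add.right_inverse eval_0 eval_add minus_unique)

lemma subst_uminus [simp]: "subst v (- f) = - subst v f"
  for f :: "'a::comm_ring_1 mpoly"
  by (metis add.right_inverse subst_0 subst_add minus_unique)

lemma eval_diff [simp]: "eval v (f - g) = eval v f - eval v g"
  for f :: "'a::comm_ring_1 mpoly"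
  using eval_add[of v f "- g"] by simp

lemma subst_diff [simp]: "subst v (f - g) = subst v f - subst v g"
  for f :: "'a::comm_ring_1 mpoly"
  using subst_add[of v f "- g"] by simp

lemma eval_sum: "eval v (sum h A) = (\<Sum>x\<in>A. eval v (h x))"
  by (induction A rule: infinite_finite_induct) simp_all

lemma subst_sum: "subst v (sum h A) = (\<Sum>x\<in>A. subst v (h x))"
  by (induction A rule: infinite_finite_induct) simp_all

lemma subst_1 [simp]: "subst v 1 = 1"
  by (metis const_1 subst_const)

lemma eval_1 [simp]: "eval v 1 = 1"
  by (metis const_1 eval_const)

lemma subst_power [simp]: "subst v (f ^ m) = subst v f ^ m"
  by (induction m) simp_all

lemma mpoly_induct [case_names const var add mult]:
  fixes f :: "'a::comm_semiring_1 mpoly"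
  assumes "\<And>c. P (const c)" "\<And>i. P (var i)"
    and "\<And>f g. P f \<Longrightarrow> P g \<Longrightarrow> P (f + g)" "\<And>f g. P f \<Longrightarrow> P g \<Longrightarrow> P (f * g)"
  shows "P f"
proof (induction f rule: mpoly_induct_single)
  case (single \<alpha> c)
  have 1: "P 1" using assms(1)[of 1] by simp
  have pow: "P (var i ^ a)" for i a
    by (induction a) (use 1 assms in auto)
  have "P (\<Prod>i\<in>A. var i ^ lookup \<alpha> i)" if "finite A" for A
    using that by induction (use 1 pow assms in auto)
  then have "P (monom_val var \<alpha>)" by (simp add: monom_val_def)
  then show ?case
    using assms by (metis monom_val_var single_eq_const_mult)
qed (use assms in auto)

lemma subst_subst: "subst v (subst w f) = subst (\<lambda>t. subst v (w t)) f"
  by (induction f rule: mpoly_induct) simp_all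

lemma subst_var_id [simp]: "subst var f = f"
  by (induction f rule: mpoly_induct) simp_all

lemma eval_subst: "eval v (subst w f) = eval (\<lambda>t. eval v (w t)) f"
  by (induction f rule: mpoly_induct) simp_all

lemma poly_ring_iff: "f \<in> poly_ring n \<longleftrightarrow> (\<forall>\<alpha>. lookup f \<alpha> \<noteq> 0 \<longrightarrow> \<alpha> \<in> compositions n)"
  by (auto simp: poly_ring_def in_keys_iff)

lemma poly_ring_0 [simp]: "0 \<in> poly_ring n"
  by (simp add: poly_ring_def)

lemma poly_ring_add: "f \<in> poly_ring n \<Longrightarrow> g \<in> poly_ring n \<Longrightarrow> f + g \<in> poly_ring n"
  using keys_add[of f g] by (auto simp: poly_ring_def)

lemma poly_ring_diff: "f \<in> poly_ring n \<Longrightarrow> g \<in> poly_ring n \<Longrightarrow> f - g \<in> poly_ring n"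
  for f :: "'a::ab_group_add mpoly"
  unfolding poly_ring_iff lookup_minus by (metis diff_zero)

lemma poly_ring_const_mult: "f \<in> poly_ring n \<Longrightarrow> const c * f \<in> poly_ring n"
  for f :: "'a::comm_semiring_1 mpoly"
  unfolding poly_ring_iff lookup_const_mult by (metis mult_zero_right)

lemma compositions_add: "\<alpha> \<in> compositions n \<Longrightarrow> \<beta> \<in> compositions n \<Longrightarrow> \<alpha> + \<beta> \<in> compositions n"
  using keys_add[of \<alpha> \<beta>] by (auto simp: compositions_def)

lemma lookup_composition: "\<mu> \<in> compositions n \<Longrightarrow> i \<notin> {1..n} \<Longrightarrow> lookup \<mu> i = 0"
  by (auto simp: compositions_def in_keys_iff subset_eq)

lemma composition_eqI:
  assumes "\<mu> \<in> compositions n" "\<nu> \<in> compositions n" "\<And>i. i \<in> {1..n} \<Longrightarrow> lookup \<mu> i = lookup \<nu> i"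
  shows "\<mu> = \<nu>"
  by (rule poly_mapping_eqI) (metis assms lookup_composition)

definition upd2 :: "nat \<Rightarrow> nat \<Rightarrow> nat \<Rightarrow> nat \<Rightarrow> (nat \<Rightarrow>\<^sub>0 nat) \<Rightarrow> (nat \<Rightarrow>\<^sub>0 nat)" where
  "upd2 i j a b \<nu> = Poly_Mapping.update i a (Poly_Mapping.update j b \<nu>)"

lemma lookup_upd2: "lookup (upd2 i j a b \<nu>) t = (if t = i then a else if t = j then b else lookup \<nu> t)"
  by (simp add: upd2_def lookup_update)

lemma upd2_same: "upd2 i j (lookup \<nu> i) (lookup \<nu> j) \<nu> = \<nu>"
  by (rule poly_mapping_eqI) (simp add: lookup_upd2)

lemma upd2_composition:
  "\<nu> \<in> compositions n \<Longrightarrow> i \<in> {1..n} \<Longrightarrow> j \<in> {1..n} \<Longrightarrow> upd2 i j a b \<nu> \<in> compositions n"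
  by (auto simp: compositions_def in_keys_iff lookup_upd2 subset_eq split: if_splits)

lemma single_upd2:
  assumes "i \<noteq> j"
  shows "single (upd2 i j a b \<nu>) (1::'a::comm_semiring_1) =
    single (upd2 i j 0 0 \<nu>) 1 * var i ^ a * var j ^ b"
proof -
  have "upd2 i j a b \<nu> = upd2 i j 0 0 \<nu> + single i a + single j b"
    by (rule poly_mapping_eqI)
      (use assms in \<open>auto simp: lookup_upd2 lookup_add lookup_single when_def\<close>)
  then show ?thesis by (simp add: var_power mult_single)
qed

section \<open>Ranks of the entries of a composition\<close>

text \<open>
  The integer \<open>kap n \<mu> i\<close> orders positions first by the entry of \<open>\<mu>\<close>, and then by decreasing
  position; this is the order in which \<open>w\<^sub>\<mu>\<close> lists them. It turns the equality clause
  in admissibility into a single strict inequality.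
\<close>

definition kap :: "nat \<Rightarrow> (nat \<Rightarrow>\<^sub>0 nat) \<Rightarrow> nat \<Rightarrow> int" where
  "kap n \<mu> i = int (Suc n) * int (lookup \<mu> i) - int i"

definition rk :: "nat \<Rightarrow> (nat \<Rightarrow>\<^sub>0 nat) \<Rightarrow> nat \<Rightarrow> nat" where
  "rk n \<mu> i = card {j \<in> {1..n}. lookup \<mu> j < lookup \<mu> i \<or> lookup \<mu> j = lookup \<mu> i \<and> i < j}"

text \<open>Inverse of the rank. Ranks count from 0, so \<open>pos n \<mu> r\<close> is the position
  that w_\<mu> sends to r + 1.\<close>

definition pos :: "nat \<Rightarrow> (nat \<Rightarrow>\<^sub>0 nat) \<Rightarrow> nat \<Rightarrow> nat" where
  "pos n \<mu> = inv_into {1..n} (rk n \<mu>)"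

text \<open>Two positions in {1..n} differ by less than n + 1, so the difference of the entries
  decides and the positions matter only in a tie. The case s = 0 is the order of the keys, s = l is
  admissibility.\<close>

lemma kap_gap:
  assumes "i \<in> {1..n}" "j \<in> {1..n}"
  shows "kap n \<mu> j + int (Suc n) * int s < kap n \<mu> i \<longleftrightarrow>
    lookup \<mu> j + s < lookup \<mu> i \<or> lookup \<mu> j + s = lookup \<mu> i \<and> i < j"
proof -
  let ?a = "lookup \<mu> i" and ?b = "lookup \<mu> j"
  consider "?b + s < ?a" | "?b + s = ?a" | "?b + s > ?a" by linarith
  then show ?thesis
  proof cases
    case 1
    then have "int (Suc n) * (int ?b + int s + 1) \<le> int (Suc n) * int ?a"
      by (intro mult_left_mono) auto
    then show ?thesis using 1 assms by (auto simp: kap_def algebra_simps)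
  next
    case 2
    then have "int (Suc n) * int ?a = int (Suc n) * int ?b + int (Suc n) * int s"
      by (metis distrib_left of_nat_add)
    then show ?thesis using 2 assms by (auto simp: kap_def)
  next
    case 3
    then have "int (Suc n) * (int ?a + 1) \<le> int (Suc n) * (int ?b + int s)"
      by (intro mult_left_mono) auto
    then show ?thesis using 3 assms by (auto simp: kap_def algebra_simps)
  qed
qed

lemma kap_less:
  assumes "i \<in> {1..n}" "j \<in> {1..n}"
  shows "kap n \<mu> j < kap n \<mu> i \<longleftrightarrow> lookup \<mu> j < lookup \<mu> i \<or> lookup \<mu> j = lookup \<mu> i \<and> i < j"
  using kap_gap[OF assms, of \<mu> 0] by simp

text \<open>Equality would make n + 1 divide the difference of two distinct positions. Hence a
  failed strict inequality between such keys is a strict one in the other direction.\<close>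

lemma kap_gap_ne:
  assumes "i \<in> {1..n}" "j \<in> {1..n}" "i \<noteq> j"
  shows "kap n \<mu> j + int (Suc n) * int s \<noteq> kap n \<mu> i"
proof
  assume "kap n \<mu> j + int (Suc n) * int s = kap n \<mu> i"
  then have *: "int (Suc n) * (int (lookup \<mu> i) - int (lookup \<mu> j) - int s) = int i - int j"
    by (simp add: kap_def algebra_simps)
  then have "int (Suc n) dvd int i - int j" by (metis dvd_triv_left)
  moreover have "\<bar>int i - int j\<bar> < int (Suc n)" using assms by auto
  ultimately have "int i - int j = 0"
    using dvd_imp_le_int[of "int i - int j" "int (Suc n)"] by linarith
  then show False using assms by simp
qed

lemma kap_inj: "i \<in> {1..n} \<Longrightarrow> j \<in> {1..n} \<Longrightarrow> kap n \<mu> i = kap n \<mu> j \<Longrightarrow> i = j"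
  using kap_gap_ne[of i n j \<mu> 0] by auto

lemma rk_kap: "i \<in> {1..n} \<Longrightarrow> rk n \<mu> i = card {j \<in> {1..n}. kap n \<mu> j < kap n \<mu> i}"
  unfolding rk_def by (rule arg_cong[where f = card], rule Collect_cong, rule conj_cong, rule refl)
    (simp only: kap_less)

lemma rk_strict_mono:
  assumes "i \<in> {1..n}" "j \<in> {1..n}" "kap n \<mu> i < kap n \<mu> j"
  shows "rk n \<mu> i < rk n \<mu> j"
  unfolding rk_kap[OF assms(1)] rk_kap[OF assms(2)]
  by (rule psubset_card_mono) (use assms in auto)

lemma rk_less_iff:
  assumes "i \<in> {1..n}" "j \<in> {1..n}"
  shows "rk n \<mu> i < rk n \<mu> j \<longleftrightarrow> kap n \<mu> i < kap n \<mu> j"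
proof (cases "kap n \<mu> i" "kap n \<mu> j" rule: linorder_cases)
  case less
  then show ?thesis using rk_strict_mono[OF assms] by simp
next
  case equal
  then show ?thesis using kap_inj[OF assms] by auto
next
  case greater
  then show ?thesis using rk_strict_mono[OF assms(2,1)] by force
qed

lemma rk_inj: "inj_on (rk n \<mu>) {1..n}"
proof (rule inj_onI)
  fix i j assume h: "i \<in> {1..n}" "j \<in> {1..n}" "rk n \<mu> i = rk n \<mu> j"
  then show "i = j"
    using rk_strict_mono[of i n j \<mu>] rk_strict_mono[of j n i \<mu>] kap_inj[of i n j \<mu>]
    by (metis less_irrefl linorder_less_linear)
qed

lemma rk_less:
  assumes "i \<in> {1..n}"
  shows "rk n \<mu> i < n"
proof -
  have "{j \<in> {1..n}. kap n \<mu> j < kap n \<mu> i} \<subseteq> {1..n} - {i}" by auto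
  then have "rk n \<mu> i \<le> card ({1..n} - {i})"
    unfolding rk_kap[OF assms] by (intro card_mono) simp_all
  also have "\<dots> < n" using assms by auto
  finally show ?thesis .
qed

lemma rk_bij: "bij_betw (rk n \<mu>) {1..n} {..<n}"
  unfolding bij_betw_def
proof
  show "rk n \<mu> ` {1..n} = {..<n}"
    by (rule card_subset_eq) (use rk_less card_image[OF rk_inj, of n \<mu>] in auto)
qed (rule rk_inj)

lemma pos_in: "r < n \<Longrightarrow> pos n \<mu> r \<in> {1..n}"
  unfolding pos_def by (rule inv_into_into) (use rk_bij[of n \<mu>] in \<open>simp add: bij_betw_def\<close>)

lemma rk_pos [simp]: "r < n \<Longrightarrow> rk n \<mu> (pos n \<mu> r) = r"
  unfolding pos_def by (rule f_inv_into_f) (use rk_bij[of n \<mu>] in \<open>simp add: bij_betw_def\<close>)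

lemma pos_rk [simp]: "i \<in> {1..n} \<Longrightarrow> pos n \<mu> (rk n \<mu> i) = i"
  unfolding pos_def by (rule inv_into_f_f[OF rk_inj])

lemma pos_bij: "bij_betw (pos n \<mu>) {..<n} {1..n}"
  by (rule bij_betw_byWitness[where f' = "rk n \<mu>"]) (use pos_in rk_less in auto)

lemma kap_pos_less: "r < n \<Longrightarrow> s < n \<Longrightarrow> kap n \<mu> (pos n \<mu> r) < kap n \<mu> (pos n \<mu> s) \<longleftrightarrow> r < s"
  using rk_less_iff[of "pos n \<mu> r" n "pos n \<mu> s" \<mu>] pos_in[of r n \<mu>] pos_in[of s n \<mu>] by simp

lemma kap_pos_le: "r \<le> s \<Longrightarrow> s < n \<Longrightarrow> kap n \<mu> (pos n \<mu> r) \<le> kap n \<mu> (pos n \<mu> s)"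
  using kap_pos_less[of r n s \<mu>] by (cases "r = s") auto

lemma lookup_pos_le:
  assumes "r \<le> s" "s < n"
  shows "lookup \<mu> (pos n \<mu> r) \<le> lookup \<mu> (pos n \<mu> s)"
proof (rule ccontr)
  assume "\<not> ?thesis"
  then have "kap n \<mu> (pos n \<mu> s) < kap n \<mu> (pos n \<mu> r)"
    using assms by (subst kap_less) (use pos_in in auto)
  then show False using kap_pos_le[OF assms, of \<mu>] by simp
qed

lemma nondec_pos:
  assumes "i \<in> {1..n}"
  shows "nondec n \<mu> i = lookup \<mu> (pos n \<mu> (i - 1))"
proof -
  have "mset (map (pos n \<mu>) [0..<n]) = mset [1..<Suc n]"
  proof (subst set_eq_iff_mset_eq_distinct[symmetric])
    show "distinct (map (pos n \<mu>) [0..<n])"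
      using pos_bij[of n \<mu>] by (auto simp: distinct_map bij_betw_def atLeast0LessThan)
    show "set (map (pos n \<mu>) [0..<n]) = set [1..<Suc n]"
      using pos_bij[of n \<mu>] by (auto simp: bij_betw_def atLeast0LessThan)
  qed simp
  then have "mset (map (lookup \<mu>) (map (pos n \<mu>) [0..<n])) = mset (map (lookup \<mu>) [1..<Suc n])"
    by (metis mset_map)
  moreover have "sorted (map (lookup \<mu>) (map (pos n \<mu>) [0..<n]))"
    by (auto simp: sorted_iff_nth_mono intro: lookup_pos_le)
  ultimately have "sort (map (lookup \<mu>) [1..<Suc n]) = map (lookup \<mu>) (map (pos n \<mu>) [0..<n])"
    by (rule properties_for_sort)
  then have "nondec n \<mu> i = map (lookup \<mu>) (map (pos n \<mu>) [0..<n]) ! (i - 1)"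
    by (simp only: nondec_def)
  then show ?thesis using assms by auto
qed

lemma permutes_eq_card:
  assumes "p permutes {1..n}" "i \<in> {1..n}"
  shows "p i = card {j \<in> {1..n}. p j \<le> p i}"
proof -
  have "bij_betw p {j \<in> {1..n}. p j \<le> p i} {1..p i}"
  proof (rule bij_betw_imageI)
    show "inj_on p {j \<in> {1..n}. p j \<le> p i}"
      using assms(1) by (meson inj_on_subset permutes_inj subset_UNIV)
    show "p ` {j \<in> {1..n}. p j \<le> p i} = {1..p i}"
    proof (intro equalityI subsetI)
      fix x assume "x \<in> {1..p i}"
      moreover have "p i \<le> n" using assms permutes_in_image[OF assms(1)] by force
      ultimately have "x \<in> {1..n}" by auto
      then obtain j where "j \<in> {1..n}" "p j = x"
        using permutes_image[OF assms(1)] by (metis imageE)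
      then show "x \<in> p ` {j \<in> {1..n}. p j \<le> p i}" using \<open>x \<in> {1..p i}\<close> by auto
    next
      fix x assume "x \<in> p ` {j \<in> {1..n}. p j \<le> p i}"
      then show "x \<in> {1..p i}" using permutes_in_image[OF assms(1)] by auto
    qed
  qed
  then show ?thesis by (metis bij_betw_same_card card_atLeastAtMost diff_Suc_1)
qed

text \<open>A sorting permutation is forced on pairs with different entries, so it can invert only
  pairs that \<open>rk n \<mu>\<close> inverts too. The permutation \<open>rk n \<mu> i + 1\<close>
  inverts all of these, so the longest one has the same inversion set and equals it.\<close>

lemma sorting_perm_rk:
  assumes "i \<in> {1..n}"
  shows "sorting_perm n \<mu> i = rk n \<mu> i + 1"
    and "inv (sorting_perm n \<mu>) i = pos n \<mu> (i - 1)"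
proof -
  let ?P = "\<lambda>w. w permutes {1..n} \<and> (\<forall>i\<in>{1..n}. lookup \<mu> (inv w i) = nondec n \<mu> i)"
  let ?I = "\<lambda>w. {(i, j). 1 \<le> i \<and> i < j \<and> j \<le> n \<and> w i > (w j :: nat)}"
  define w0 where "w0 i = (if i \<in> {1..n} then rk n \<mu> i + 1 else i)" for i
  have fin: "finite (?I w)" for w
    by (rule finite_subset[of _ "{1..n} \<times> {1..n}"]) auto
  have "bij_betw w0 {1..n} {1..n}"
    by (rule bij_betw_byWitness[where f' = "\<lambda>i. pos n \<mu> (i - 1)"])
      (use rk_less pos_in in \<open>auto simp: w0_def Suc_le_eq\<close>)
  then have perm0: "w0 permutes {1..n}"
    by (rule bij_imp_permutes) (auto simp: w0_def)
  have inv0: "inv w0 i = pos n \<mu> (i - 1)" if "i \<in> {1..n}" for i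
  proof -
    have lt: "i - 1 < n" using that by auto
    have "w0 (pos n \<mu> (i - 1)) = i"
      using that pos_in[OF lt, of \<mu>] lt by (simp add: w0_def)
    then show ?thesis using permutes_inv_eq[OF perm0] by blast
  qed
  have P0: "?P w0"
    using perm0 by (auto simp: inv0 nondec_pos)
  have mono: "w i < w j" if "?P w" "i \<in> {1..n}" "j \<in> {1..n}" "lookup \<mu> i < lookup \<mu> j" for w i j
  proof (rule ccontr)
    assume "\<not> w i < w j"
    have *: "lookup \<mu> x = nondec n \<mu> (w x)" "w x \<in> {1..n}" if "x \<in> {1..n}" for x
      using \<open>?P w\<close> that permutes_in_image[of w "{1..n}" x] permutes_inverses(2)[of w "{1..n}" x]
      by (metis, blast)
    have "lookup \<mu> j \<le> lookup \<mu> i"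
      unfolding *(1)[OF that(2)] *(1)[OF that(3)]
      using \<open>\<not> w i < w j\<close> *(2)[OF that(2)] *(2)[OF that(3)]
      by (auto simp: nondec_pos intro!: lookup_pos_le)
    then show False using that by simp
  qed
  have sub: "?I w \<subseteq> ?I w0" if "?P w" for w
  proof clarify
    fix i j assume h: "1 \<le> i" "i < j" "j \<le> n" "w i > w j"
    then have in1: "i \<in> {1..n}" "j \<in> {1..n}" by auto
    have "\<not> lookup \<mu> i < lookup \<mu> j" using mono[OF that in1] h by auto
    then have "kap n \<mu> j < kap n \<mu> i" using kap_less[OF in1, of \<mu>] h by linarith
    then have "rk n \<mu> j < rk n \<mu> i" by (rule rk_strict_mono[OF in1(2,1)])
    then show "w0 i > w0 j" using in1 by (simp add: w0_def)
  qed
  have len: "perm_length n w = card (?I w)" for w by (simp add: perm_length_def)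
  have "is_arg_max (perm_length n) ?P w0"
    unfolding is_arg_max_def len using P0 sub fin by (meson card_mono linorder_not_less)
  then have am: "is_arg_max (perm_length n) ?P (sorting_perm n \<mu>)"
    unfolding sorting_perm_def arg_max_def
    by (rule someI[where P = "is_arg_max (perm_length n) ?P"])
  let ?w = "sorting_perm n \<mu>"
  have Pw: "?P ?w" using am by (simp add: is_arg_max_def)
  have "card (?I w0) \<le> card (?I ?w)" using am P0 by (auto simp: is_arg_max_def len)
  then have Ieq: "?I ?w = ?I w0" using card_seteq[OF fin sub[OF Pw]] by blast
  have "?w x < ?w y \<longleftrightarrow> w0 x < w0 y" if "x \<in> {1..n}" "y \<in> {1..n}" for x y
  proof (cases x y rule: linorder_cases)
    case less
    have "?w x \<noteq> ?w y" "w0 x \<noteq> w0 y"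
      using less Pw perm0 by (metis less_irrefl permutes_inj inj_eq)+
    moreover have "(x, y) \<in> ?I ?w \<longleftrightarrow> (x, y) \<in> ?I w0" using Ieq by simp
    ultimately show ?thesis using less that by auto
  next
    case greater
    have "(y, x) \<in> ?I ?w \<longleftrightarrow> (y, x) \<in> ?I w0" using Ieq by simp
    then show ?thesis using greater that by auto
  qed simp
  then have "?w x \<le> ?w y \<longleftrightarrow> w0 x \<le> w0 y" if "x \<in> {1..n}" "y \<in> {1..n}" for x y
    using that by (meson linorder_not_less)
  then have eq: "?w x = w0 x" if "x \<in> {1..n}" for x
    using permutes_eq_card[of ?w n x] permutes_eq_card[OF perm0, of x] Pw that
    by (metis (no_types, lifting) Collect_cong)
  have "?w = w0"
    by (rule ext) (metis Pw eq perm0 permutes_not_in)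
  then show "sorting_perm n \<mu> i = rk n \<mu> i + 1" "inv (sorting_perm n \<mu>) i = pos n \<mu> (i - 1)"
    using inv0 assms by (auto simp: w0_def)
qed

text \<open>The inequality and its clause for equality merge by \<open>kap_gap\<close> with s = l.
  The substitution i = r + k passes from indices counted from 1 to ranks counted from 0.\<close>

lemma admissible_kap:
  assumes "2 \<le> k" "k \<le> n"
  shows "admissible n l k \<mu> \<longleftrightarrow>
    (\<forall>r. r + (k - 1) < n \<longrightarrow>
      kap n \<mu> (pos n \<mu> r) + int (Suc n) * int l < kap n \<mu> (pos n \<mu> (r + (k - 1))))"
proof -
  have "admissible n l k \<mu> \<longleftrightarrow> (\<forall>i\<in>{k..n}.
      kap n \<mu> (pos n \<mu> (i - k)) + int (Suc n) * int l < kap n \<mu> (pos n \<mu> (i - 1)))"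
    unfolding admissible_def
  proof (rule ball_cong[OF refl])
    fix i assume "i \<in> {k..n}"
    then have i: "i \<in> {1..n}" "i - (k - 1) \<in> {1..n}" "i - (k - 1) - 1 = i - k"
        "i - k < n" "i - 1 < n"
      using assms by auto
    let ?a = "pos n \<mu> (i - 1)" and ?b = "pos n \<mu> (i - k)"
    show "(nondec n \<mu> (i - (k - 1)) + l \<le> nondec n \<mu> i \<and>
      (nondec n \<mu> i = nondec n \<mu> (i - (k - 1)) + l \<longrightarrow>
        inv (sorting_perm n \<mu>) i < inv (sorting_perm n \<mu>) (i - (k - 1)))) \<longleftrightarrow>
      kap n \<mu> ?b + int (Suc n) * int l < kap n \<mu> ?a"
      unfolding kap_gap[OF pos_in[OF i(5)] pos_in[OF i(4)]]
        nondec_pos[OF i(1)] nondec_pos[OF i(2)] sorting_perm_rk(2)[OF i(1)]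
        sorting_perm_rk(2)[OF i(2)] i(3) by auto
  qed
  also have "\<dots> \<longleftrightarrow> (\<forall>r. r + (k - 1) < n \<longrightarrow>
      kap n \<mu> (pos n \<mu> r) + int (Suc n) * int l < kap n \<mu> (pos n \<mu> (r + (k - 1))))"
  proof (intro iffI allI impI ballI)
    fix r assume *: "\<forall>i\<in>{k..n}.
      kap n \<mu> (pos n \<mu> (i - k)) + int (Suc n) * int l < kap n \<mu> (pos n \<mu> (i - 1))" "r + (k - 1) < n"
    have "r + k \<in> {k..n}" "r + k - k = r" "r + k - 1 = r + (k - 1)" using *(2) assms by auto
    then show "kap n \<mu> (pos n \<mu> r) + int (Suc n) * int l < kap n \<mu> (pos n \<mu> (r + (k - 1)))"
      using bspec[OF *(1), of "r + k"] by metis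
  next
    fix i assume *: "\<forall>r. r + (k - 1) < n \<longrightarrow>
      kap n \<mu> (pos n \<mu> r) + int (Suc n) * int l < kap n \<mu> (pos n \<mu> (r + (k - 1)))" "i \<in> {k..n}"
    have "i - k + (k - 1) = i - 1" "i - 1 < n" using *(2) assms by auto
    then show "kap n \<mu> (pos n \<mu> (i - k)) + int (Suc n) * int l < kap n \<mu> (pos n \<mu> (i - 1))"
      using *(1)[rule_format, of "i - k"] by metis
  qed
  finally show ?thesis .
qed

lemma admissible_steps:
  assumes k: "2 \<le> k" "k \<le> n" and adm: "admissible n l k \<mu>" and "r + a * (k - 1) < n"
  shows "kap n \<mu> (pos n \<mu> r) + int a * (int (Suc n) * int l) \<le> kap n \<mu> (pos n \<mu> (r + a * (k - 1))) \<and>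
    (a > 0 \<longrightarrow> kap n \<mu> (pos n \<mu> r) + int a * (int (Suc n) * int l) < kap n \<mu> (pos n \<mu> (r + a * (k - 1))))"
  using assms(4)
proof (induction a)
  case (Suc a)
  define M where "M = int (Suc n) * int l"
  have eq: "r + a * (k - 1) + (k - 1) = r + Suc a * (k - 1)" by simp
  then have lt: "r + a * (k - 1) + (k - 1) < n" using Suc.prems by (simp only:)
  have "kap n \<mu> (pos n \<mu> r) + int a * M \<le> kap n \<mu> (pos n \<mu> (r + a * (k - 1)))"
    using Suc.IH lt unfolding M_def by linarith
  moreover have "kap n \<mu> (pos n \<mu> (r + a * (k - 1))) + M < kap n \<mu> (pos n \<mu> (r + a * (k - 1) + (k - 1)))"
    using adm lt unfolding admissible_kap[OF k] M_def by blast
  ultimately have "kap n \<mu> (pos n \<mu> r) + int (Suc a) * M < kap n \<mu> (pos n \<mu> (r + a * (k - 1) + (k - 1)))"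
    by (simp add: algebra_simps)
  then show ?case unfolding eq M_def by simp
qed auto

text \<open>
  The next lemma is the reason why \<open>f\<^sub>\<mu>\<close> has no pole at \<open>c\<^sub>0 = 1/k\<close> for admissible \<open>\<mu>\<close>:
  its joint eigenvalue remains simple there. If \<open>s r\<close> denotes the shift of the entry whose
  \<open>\<nu>\<close>-rank is \<open>r\<close>, then \<open>s r > 0\<close> forces \<open>s (r + 1) > 0\<close>.
\<close>

lemma admissible_weight_simple:
  fixes q :: "nat \<Rightarrow> int"
  assumes k: "2 \<le> k" "k \<le> n" and "l \<ge> 1" and adm: "admissible n l k \<mu>"
    and q1: "\<And>i. i \<in> {1..n} \<Longrightarrow> int (lookup \<mu> i) = int (lookup \<nu> i) + int l * q i"
    and q2: "\<And>i. i \<in> {1..n} \<Longrightarrow> int (rk n \<mu> i) = int (rk n \<nu> i) + int k * q i"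
    and i: "i \<in> {1..n}"
  shows "lookup \<nu> i = lookup \<mu> i"
proof -
  define K where "K r = kap n \<mu> (pos n \<mu> r)" for r
  define M where "M = int (Suc n) * int l"
  have Kmono: "K r \<le> K t" if "r \<le> t" "t < n" for r t
    unfolding K_def using kap_pos_le that .
  have steps: "K r + int a * M \<le> K (r + a * (k - 1)) \<and> (a > 0 \<longrightarrow> K r + int a * M < K (r + a * (k - 1)))"
    if "r + a * (k - 1) < n" for r a
    unfolding K_def M_def by (rule admissible_steps[OF k adm that])
  define s where "s r = q (pos n \<nu> r)" for r
  define L where "L r = kap n \<nu> (pos n \<nu> r)" for r
  have rkmu: "int (rk n \<mu> (pos n \<nu> r)) = int r + int k * s r" if "r < n" for r
    using q2[OF pos_in[OF that]] that by (simp add: s_def)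
  have L: "L r = K (rk n \<mu> (pos n \<nu> r)) - M * s r" if "r < n" for r
  proof -
    have "kap n \<mu> (pos n \<nu> r) = kap n \<nu> (pos n \<nu> r) + M * s r"
      using q1[OF pos_in[OF that]] by (simp add: kap_def s_def M_def algebra_simps)
    then show ?thesis using pos_in[OF that] by (simp add: K_def L_def)
  qed
  \<comment> \<open>With s r = a > 0 the \<mu>-rank is r + k a = (r + a) + a (k - 1): a steps of
    length k - 1 outweigh the a M subtracted in \<open>L\<close>, and r + a is at least r +
    1.\<close>
  have up: "L r > K (r + 1)" if "r < n" "s r > 0" for r
  proof -
    define a where "a = nat (s r)"
    have a: "s r = int a" "a > 0" using that by (auto simp: a_def)
    let ?R = "rk n \<mu> (pos n \<nu> r)"
    have R: "?R = r + k * a" using rkmu[OF that(1)] unfolding a by (metis of_nat_add of_nat_eq_iff of_nat_mult)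
    have "?R < n" using rk_less[OF pos_in[OF that(1)]] .
    moreover have Req: "?R = (r + a) + a * (k - 1)"
      unfolding R using k by (cases k) (auto simp: algebra_simps)
    ultimately have "K (r + a) + int a * M < K ?R" using steps[of "r + a" a] a by simp
    moreover have "K (r + 1) \<le> K (r + a)"
      by (rule Kmono) (use a Req \<open>?R < n\<close> in linarith)+
    ultimately show ?thesis using L[OF that(1)] a by (simp add: mult.commute)
  qed
  \<comment> \<open>With s r = -a the \<mu>-rank lies k a below r; a steps of length k - 1 regain a
    M and end at rank r - a.\<close>
  have down: "L r \<le> K r" if "r < n" "s r \<le> 0" for r
  proof -
    define a where "a = nat (- s r)"
    have a: "s r = - int a" using that by (auto simp: a_def)
    let ?R = "rk n \<mu> (pos n \<nu> r)"
    have R: "?R + k * a = r" using rkmu[OF that(1)] unfolding a by (simp flip: of_nat_mult)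
    have Req: "?R + a * (k - 1) + a = r"
      using R k by (cases k) (auto simp: algebra_simps)
    then have "K ?R + int a * M \<le> K (?R + a * (k - 1))" using steps[of ?R a] that by simp
    also have "\<dots> \<le> K r" by (rule Kmono) (use Req that in linarith)+
    finally show ?thesis using L[OF that(1)] a by (simp add: mult.commute)
  qed
  \<comment> \<open>Otherwise \<open>down\<close> at r + 1 and \<open>up\<close> at r would reverse
    the strict order of the keys of \<nu>.\<close>
  have next_pos: "s (r + 1) > 0" if "r + 1 < n" "s r > 0" for r
  proof (rule ccontr)
    assume "\<not> ?thesis"
    then have "L (r + 1) \<le> K (r + 1)" using down[OF that(1)] by simp
    also have "\<dots> < L r" using up that by simp
    finally have "L (r + 1) < L r" .
    moreover have "L r < L (r + 1)" unfolding L_def by (subst kap_pos_less) (use that in auto)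
    ultimately show False by simp
  qed
  \<comment> \<open>A positive shift would propagate to the last rank n - 1, whose \<mu>-rank would
    then exceed n - 1.\<close>
  have nonpos: "s r \<le> 0" if "r < n" for r
  proof (rule ccontr)
    assume "\<not> ?thesis"
    then have "s r > 0" by simp
    have "s (r + t) > 0" if "r + t < n" for t
      using that
    proof (induction t)
      case 0
      then show ?case using \<open>s r > 0\<close> by simp
    next
      case (Suc t)
      then show ?case using next_pos[of "r + t"] by simp
    qed
    from this[of "n - 1 - r"] that have sp: "s (n - 1) > 0" by simp
    have "int (rk n \<mu> (pos n \<nu> (n - 1))) \<le> int (n - 1)"
      using rk_less[OF pos_in, of "n - 1" n \<mu> \<nu>] that by simp
    moreover have "int k * s (n - 1) > 0" using sp k by simp
    ultimately show False using rkmu[of "n - 1"] that by simp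
  qed
  have qle: "q j \<le> 0" if "j \<in> {1..n}" for j
    using nonpos[of "rk n \<nu> j"] that rk_less[OF that] by (simp add: s_def)
  \<comment> \<open>Both rank functions run through 0, ..., n - 1, so the shifts add up to 0; being
    nonpositive, they vanish.\<close>
  have sum_rk: "(\<Sum>j\<in>{1..n}. int (rk n \<alpha> j)) = (\<Sum>r<n. int r)" for \<alpha>
    using sum.reindex_bij_betw[OF rk_bij, of int n \<alpha>] by simp
  have "(\<Sum>j\<in>{1..n}. int (rk n \<mu> j)) = (\<Sum>j\<in>{1..n}. int (rk n \<nu> j)) + int k * (\<Sum>j\<in>{1..n}. q j)"
    using q2 by (simp add: sum.distrib sum_distrib_left)
  then have "int k * (\<Sum>j\<in>{1..n}. q j) = 0"
    unfolding sum_rk by simp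
  then have "(\<Sum>j\<in>{1..n}. - q j) = 0" using k by (simp add: sum_negf)
  then have "- q i = 0"
    using sum_nonneg_eq_0_iff[of "{1..n}" "\<lambda>j. - q j"] qle i by auto
  then show ?thesis using q1[OF i] by simp
qed

section \<open>Reflections and divided differences\<close>

text \<open>The field is arbitrary because the theory is used twice, over the complex numbers and
  over the rational functions in c_0.\<close>

locale root_of_unity =
  fixes l :: nat and \<zeta> :: "'a::field"
  assumes l_pos: "l \<ge> 1" and root: "\<zeta> ^ l = 1"
    and prim: "\<And>d. 0 < d \<Longrightarrow> d < l \<Longrightarrow> \<zeta> ^ d \<noteq> 1"
begin

lemma zeta_nz [simp]: "\<zeta> \<noteq> 0"
  using root l_pos by (metis One_nat_def Suc_le_eq zero_neq_one zero_power)

lemma zeta_power_eq_iff: "\<zeta> ^ a = \<zeta> ^ b \<longleftrightarrow> a mod l = b mod l"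
proof -
  have red: "\<zeta> ^ a = \<zeta> ^ (a mod l)" for a
    by (metis mult_div_mod_eq power_add power_mult power_one root mult_1)
  have lt: "\<zeta> ^ a \<noteq> \<zeta> ^ b" if "a < b" "b < l" for a b
  proof
    assume "\<zeta> ^ a = \<zeta> ^ b"
    also have "\<dots> = \<zeta> ^ a * \<zeta> ^ (b - a)" using that by (simp flip: power_add)
    finally have "\<zeta> ^ (b - a) = 1" by simp
    then show False using prim[of "b - a"] that by simp
  qed
  have "\<zeta> ^ (a mod l) = \<zeta> ^ (b mod l) \<longleftrightarrow> a mod l = b mod l"
    using lt[of "a mod l" "b mod l"] lt[of "b mod l" "a mod l"] l_pos
    by (cases "a mod l" "b mod l" rule: linorder_cases) auto
  then show ?thesis by (metis red)
qed

text \<open>Orthogonality of the characters of Z/l: a geometric sum in the l-th root of unity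
  \<open>w\<close>.\<close>

lemma root_sum:
  "(\<Sum>r<l. (\<zeta> ^ r) ^ b * inverse (\<zeta> ^ r) ^ q) = (if b mod l = q mod l then of_nat l else 0)"
proof -
  define w where "w = \<zeta> ^ b * inverse (\<zeta> ^ q)"
  have eq: "(\<Sum>r<l. (\<zeta> ^ r) ^ b * inverse (\<zeta> ^ r) ^ q) = (\<Sum>r<l. w ^ r)"
    by (intro sum.cong refl)
      (simp add: w_def power_mult_distrib power_inverse mult.commute flip: power_mult)
  have w1: "w = 1 \<longleftrightarrow> b mod l = q mod l"
    unfolding w_def zeta_power_eq_iff[symmetric] by (simp add: field_simps)
  have "w ^ l = 1"
    unfolding w_def power_mult_distrib power_inverse
    by (simp flip: power_mult add: mult.commute[of _ l]) (simp add: power_mult root)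
  show ?thesis
  proof (cases "w = 1")
    case False
    then show ?thesis using eq w1 \<open>w ^ l = 1\<close> geometric_sum[OF False, of l] by simp
  qed (use eq w1 in simp)
qed

definition refl_map :: "nat \<Rightarrow> nat \<Rightarrow> nat \<Rightarrow> nat \<Rightarrow> 'a mpoly" where
  "refl_map i j r t = (if t = i then const (\<zeta> ^ r) * var j
     else if t = j then const (inverse (\<zeta> ^ r)) * var i else var t)"

lemma refl_act_subst: "i \<noteq> j \<Longrightarrow> refl_act \<zeta> i j r f = subst (refl_map i j r) f"
  unfolding refl_act_def diag_act_def swap_act_def subst_subst
  by (rule arg_cong[where f = "\<lambda>v. subst v f"])
    (auto simp: fun_eq_iff refl_map_def transpose_def)

lemma monom_val_refl:
  assumes "lookup \<alpha> i = 0" "lookup \<alpha> j = 0"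
  shows "monom_val (refl_map i j r) \<alpha> = single \<alpha> 1"
proof -
  have "monom_val (refl_map i j r) \<alpha> = monom_val var \<alpha>"
    unfolding monom_val_def
    by (rule prod.cong) (use assms in \<open>auto simp: refl_map_def in_keys_iff\<close>)
  then show ?thesis by (simp add: monom_val_var)
qed

lemma subst_refl_monom:
  assumes "i \<noteq> j"
  shows "subst (refl_map i j r) (single (upd2 i j a b \<nu>) 1) =
    const ((\<zeta> ^ r) ^ a * inverse (\<zeta> ^ r) ^ b) * single (upd2 i j b a \<nu>) 1"
  unfolding single_upd2[OF assms, of a b] single_upd2[OF assms, of b a]
  using assms
  by (simp add: subst_single monom_val_refl lookup_upd2 refl_map_def power_mult_distrib const_mult
      const_power ac_simps)

definition lin :: "nat \<Rightarrow> nat \<Rightarrow> nat \<Rightarrow> 'a mpoly" where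
  "lin i j r = var i - const (\<zeta> ^ r) * var j"

lemma lin_nz:
  assumes "i \<noteq> j"
  shows "lin i j r \<noteq> 0"
proof -
  have "single j (1::nat) \<noteq> single i 1"
    using \<open>i \<noteq> j\<close> by (metis lookup_single_eq lookup_single_not_eq zero_neq_one)
  then have "lookup (lin i j r) (single i 1) = 1"
    by (simp add: lin_def lookup_minus var_def lookup_single)
  then show ?thesis by auto
qed

lemma exact_quot_eqI: "g \<noteq> 0 \<Longrightarrow> q * g = f \<Longrightarrow> exact_quot f g = q"
  for g :: "'a mpoly"
  unfolding exact_quot_def by (rule the_equality) auto

definition dd :: "nat \<Rightarrow> nat \<Rightarrow> nat \<Rightarrow> 'a mpoly \<Rightarrow> 'a mpoly" where
  "dd i j r f = exact_quot (f - refl_act \<zeta> i j r f) (lin i j r)"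

lemma dd_eqI: "i \<noteq> j \<Longrightarrow> q * lin i j r = f - refl_act \<zeta> i j r f \<Longrightarrow> dd i j r f = q"
  unfolding dd_def by (rule exact_quot_eqI[OF lin_nz])

text \<open>The twisted Leibniz rule f g - s(f g) = f (g - s g) + (f - s f) s g reduces divisibility
  to the variables, where it is immediate. This justifies the \<open>THE\<close> in
  \<open>exact_quot\<close>.\<close>

lemma lin_dvd:
  assumes "i \<noteq> j"
  shows "lin i j r dvd f - refl_act \<zeta> i j r f"
proof (induction f rule: mpoly_induct)
  case (const c)
  then show ?case by (simp add: refl_act_subst[OF assms])
next
  case (var t)
  have "var j - const (inverse (\<zeta> ^ r)) * var i = - const (inverse (\<zeta> ^ r)) * lin i j r"
    by (simp add: lin_def algebra_simps) (simp flip: mult.assoc const_mult)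
  then show ?case
    unfolding refl_act_subst[OF assms] subst_var refl_map_def
    by (auto simp: lin_def[symmetric] simp del: const_inj)
next
  case (add f g)
  then have "lin i j r dvd (f - refl_act \<zeta> i j r f) + (g - refl_act \<zeta> i j r g)"
    by (rule dvd_add)
  then show ?case by (simp add: refl_act_subst[OF assms] algebra_simps)
next
  case (mult f g)
  then have "lin i j r dvd f * (g - refl_act \<zeta> i j r g) + (f - refl_act \<zeta> i j r f) * refl_act \<zeta> i j r g"
    by (intro dvd_add dvd_mult dvd_mult2)
  then show ?case by (simp add: refl_act_subst[OF assms] algebra_simps)
qed

lemma dd_mult: "i \<noteq> j \<Longrightarrow> dd i j r f * lin i j r = f - refl_act \<zeta> i j r f"
  using lin_dvd[of i j r f] dd_eqI[of i j _ r f] by (metis dvd_def mult.commute)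

lemma dd_add: "i \<noteq> j \<Longrightarrow> dd i j r (f + g) = dd i j r f + dd i j r g"
  by (rule dd_eqI) (simp_all add: distrib_right dd_mult refl_act_subst)

lemma dd_const: "i \<noteq> j \<Longrightarrow> dd i j r (const c * f) = const c * dd i j r f"
  by (rule dd_eqI) (simp_all add: mult.assoc dd_mult refl_act_subst right_diff_distrib)

lemma telescope_le:
  fixes X Y :: "'b::comm_ring_1"
  assumes "q \<le> P"
  shows "(\<Sum>b\<in>{q..<P}. X ^ (P + q - 1 - b) * Y ^ b) * (X - Y) = X ^ P * Y ^ q - X ^ q * Y ^ P"
  using assms
proof (induction P rule: dec_induct)
  case (step P)
  have "(\<Sum>b\<in>{q..<Suc P}. X ^ (Suc P + q - 1 - b) * Y ^ b) =
    (\<Sum>b\<in>{q..<P}. X ^ (P + q - b) * Y ^ b) + X ^ q * Y ^ P"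
    using step.hyps by simp
  also have "(\<Sum>b\<in>{q..<P}. X ^ (P + q - b) * Y ^ b) = X * (\<Sum>b\<in>{q..<P}. X ^ (P + q - 1 - b) * Y ^ b)"
    unfolding sum_distrib_left
  proof (rule sum.cong[OF refl])
    fix b assume "b \<in> {q..<P}"
    then have "P + q - b = Suc (P + q - 1 - b)" by auto
    then show "X ^ (P + q - b) * Y ^ b = X * (X ^ (P + q - 1 - b) * Y ^ b)" by (simp add: mult.assoc)
  qed
  finally have "(\<Sum>b\<in>{q..<Suc P}. X ^ (Suc P + q - 1 - b) * Y ^ b) * (X - Y) =
      X * ((\<Sum>b\<in>{q..<P}. X ^ (P + q - 1 - b) * Y ^ b) * (X - Y)) + X ^ q * Y ^ P * (X - Y)"
    by (simp only: distrib_right mult.assoc)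
  then show ?case
    unfolding step.IH by (simp add: algebra_simps)
qed simp

text \<open>Signed form of the quotient (X^P Y^q - X^q Y^P) / (X - Y). One of the two sums is always
  empty, which spares later case distinctions on the order of P and q.\<close>

lemma telescope:
  fixes X Y :: "'b::comm_ring_1"
  shows "((\<Sum>b\<in>{q..<P}. X ^ (P + q - 1 - b) * Y ^ b) - (\<Sum>b\<in>{P..<q}. X ^ (P + q - 1 - b) * Y ^ b))
    * (X - Y) = X ^ P * Y ^ q - X ^ q * Y ^ P"
proof (cases "q \<le> P")
  case True
  then show ?thesis using telescope_le[OF True, of X Y] by simp
next
  case False
  then show ?thesis using telescope_le[of P q X Y] by (simp add: add.commute left_diff_distrib)
qed

text \<open>In terms of X = x_i and Y = \<zeta>^r x_j the reflection simply exchanges X and Y. Since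
  x_i x^\<nu> is a reflection-invariant factor times X^(p + 1) Y^q, the quotient is the telescoping
  sum.\<close>

lemma dd_monom:
  fixes \<nu> :: "nat \<Rightarrow>\<^sub>0 nat" and r :: nat
  assumes "i \<noteq> j"
  defines "p \<equiv> lookup \<nu> i" and "q \<equiv> lookup \<nu> j"
  defines "T b \<equiv> const ((\<zeta> ^ r) ^ b * inverse (\<zeta> ^ r) ^ q) * single (upd2 i j (p + q - b) b \<nu>) 1"
  shows "dd i j r (var i * single \<nu> 1) = (\<Sum>b\<in>{q..<Suc p}. T b) - (\<Sum>b\<in>{Suc p..<q}. T b)"
proof (rule dd_eqI[OF assms(1)])
  define X :: "'a mpoly" where "X = var i"
  define Y where "Y = const (\<zeta> ^ r) * var j"
  define B where "B = const (inverse (\<zeta> ^ r) ^ q) * single (upd2 i j 0 0 \<nu>) 1"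
  have T: "T b = B * (X ^ (Suc p + q - 1 - b) * Y ^ b)" for b
    unfolding T_def B_def X_def Y_def single_upd2[OF assms(1), of "p + q - b"]
    by (simp add: const_mult const_power power_mult_distrib ac_simps)
  have F: "var i * single \<nu> 1 = (single (upd2 i j (Suc p) q \<nu>) 1 :: 'a mpoly)"
    unfolding single_upd2[OF assms(1), of "Suc p"]
    using single_upd2[OF assms(1), of p q \<nu>, where 'a = 'a] upd2_same[of i j \<nu>]
    by (simp add: p_def q_def ac_simps)
  have c: "const (\<zeta> ^ r) ^ q * const (inverse (\<zeta> ^ r) ^ q) = (1 :: 'a mpoly)"
    unfolding const_power[symmetric] const_mult[symmetric] power_mult_distrib[symmetric] by simp
  have F1: "single (upd2 i j (Suc p) q \<nu>) 1 = B * (X ^ Suc p * Y ^ q)"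
  proof -
    have "B * (X ^ Suc p * Y ^ q) = (const (\<zeta> ^ r) ^ q * const (inverse (\<zeta> ^ r) ^ q)) *
        (single (upd2 i j 0 0 \<nu>) 1 * var i ^ Suc p * var j ^ q)"
      unfolding B_def X_def Y_def power_mult_distrib by (simp only: ac_simps)
    then show ?thesis unfolding c single_upd2[OF assms(1), of "Suc p"] by simp
  qed
  have F2: "refl_act \<zeta> i j r (single (upd2 i j (Suc p) q \<nu>) 1) = B * (X ^ q * Y ^ Suc p)"
    unfolding refl_act_subst[OF assms(1)] subst_refl_monom[OF assms(1)]
      single_upd2[OF assms(1), of q] B_def X_def Y_def const_mult power_mult_distrib const_power
    by (simp only: ac_simps)
  have "((\<Sum>b\<in>{q..<Suc p}. T b) - (\<Sum>b\<in>{Suc p..<q}. T b)) * lin i j r =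
    B * (((\<Sum>b\<in>{q..<Suc p}. X ^ (Suc p + q - 1 - b) * Y ^ b) -
        (\<Sum>b\<in>{Suc p..<q}. X ^ (Suc p + q - 1 - b) * Y ^ b)) * (X - Y))"
    unfolding T sum_distrib_left[symmetric] right_diff_distrib[symmetric] lin_def X_def[symmetric] Y_def[symmetric]
    by (simp only: mult.assoc)
  also have "\<dots> = B * (X ^ Suc p * Y ^ q) - B * (X ^ q * Y ^ Suc p)"
    unfolding telescope by (rule right_diff_distrib)
  finally show "((\<Sum>b\<in>{q..<Suc p}. T b) - (\<Sum>b\<in>{Suc p..<q}. T b)) * lin i j r =
    var i * single \<nu> 1 - refl_act \<zeta> i j r (var i * single \<nu> 1)"
    unfolding F F2 unfolding F1 .
qed

lemma refl_monom:
  assumes "i \<noteq> j"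
  shows "refl_act \<zeta> i j r (single \<nu> 1) =
    const ((\<zeta> ^ r) ^ lookup \<nu> i * inverse (\<zeta> ^ r) ^ lookup \<nu> j) *
      single (upd2 i j (lookup \<nu> j) (lookup \<nu> i) \<nu>) 1"
  using subst_refl_monom[OF assms, of r "lookup \<nu> i" "lookup \<nu> j" \<nu>]
  by (simp add: upd2_same refl_act_subst[OF assms])

text \<open>Summing over r keeps the b congruent to q modulo l, by \<open>root_sum\<close>. The
  reflections of x^\<nu> add up to the single term b = p, so for j < i subtracting them moves the
  end point from p + 1 to p, also when p < q.\<close>

lemma sum_dd_refl:
  fixes \<nu> :: "nat \<Rightarrow>\<^sub>0 nat"
  assumes "i \<noteq> j"
  defines "p \<equiv> lookup \<nu> i" and "q \<equiv> lookup \<nu> j"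
  defines "T b \<equiv> const (if b mod l = q mod l then of_nat l else 0) * single (upd2 i j (p + q - b) b \<nu>) (1::'a)"
  defines "P \<equiv> (if i < j then Suc p else p)"
  shows "(\<Sum>r<l. dd i j r (var i * single \<nu> 1)) - (if j < i then \<Sum>r<l. refl_act \<zeta> i j r (single \<nu> 1) else 0)
    = (\<Sum>b\<in>{q..<P}. T b) - (\<Sum>b\<in>{P..<q}. T b)"
proof -
  have Teq: "(\<Sum>r<l. const ((\<zeta> ^ r) ^ b * inverse (\<zeta> ^ r) ^ q) * single (upd2 i j (p + q - b) b \<nu>) 1) = T b" for b
    unfolding sum_distrib_right[symmetric] const_sum[symmetric] root_sum T_def ..
  have 1: "(\<Sum>r<l. dd i j r (var i * single \<nu> 1)) = (\<Sum>b\<in>{q..<Suc p}. T b) - (\<Sum>b\<in>{Suc p..<q}. T b)"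
    unfolding dd_monom[OF assms(1)] sum_subtractf p_def[symmetric] q_def[symmetric]
    by (subst (1 2) sum.swap) (simp only: Teq)
  have 2: "(\<Sum>r<l. refl_act \<zeta> i j r (single \<nu> 1)) = T p"
    unfolding refl_monom[OF assms(1)] p_def[symmetric] q_def[symmetric] Teq[symmetric] by simp
  show ?thesis
  proof (cases "i < j")
    case True
    then show ?thesis using 1 by (simp add: P_def)
  next
    case False
    then have "j < i" using assms(1) by simp
    have "{q..<Suc p} = insert p {q..<p}" if "q \<le> p" using that by auto
    moreover have "{p..<q} = insert p {Suc p..<q}" if "p < q" using that by auto
    ultimately have "(\<Sum>b\<in>{q..<Suc p}. T b) - (\<Sum>b\<in>{Suc p..<q}. T b) - T p
      = (\<Sum>b\<in>{q..<p}. T b) - (\<Sum>b\<in>{p..<q}. T b)"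
      by (cases "q \<le> p") auto
    then show ?thesis using False \<open>j < i\<close> 1 2 by (simp add: P_def)
  qed
qed

end

lemma partial_deriv_superset:
  assumes "finite A" "keys f \<subseteq> A"
  shows "partial_deriv i f = (\<Sum>\<alpha>\<in>A. single (\<alpha> - single i 1) (of_nat (lookup \<alpha> i) * lookup f \<alpha>))"
  unfolding partial_deriv_def
  by (rule sum.mono_neutral_left) (use assms in \<open>auto simp: in_keys_iff\<close>)

lemma partial_deriv_add: "partial_deriv i (f + g) = partial_deriv i f + partial_deriv i g"
proof -
  let ?A = "keys f \<union> keys g"
  have "keys (f + g) \<subseteq> ?A" by (rule keys_add)
  then show ?thesis
    by (subst (1 2 3) partial_deriv_superset[of ?A])
      (auto simp: lookup_add distrib_left single_add sum.distrib)
qed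

lemma partial_deriv_single:
  "partial_deriv i (single \<alpha> c) = single (\<alpha> - single i 1) (of_nat (lookup \<alpha> i) * c)"
  by (simp add: partial_deriv_def)

lemma lookup_euler:
  "lookup (partial_deriv i (var i * f)) \<alpha> = of_nat (Suc (lookup \<alpha> i)) * lookup f \<alpha>"
  for f :: "'a::comm_semiring_1 mpoly"
proof (induction f rule: mpoly_induct_single)
  case (single \<beta> c)
  then show ?case
    by (auto simp: var_def mult_single partial_deriv_single lookup_single when_def lookup_add)
next
  case (add f g)
  then show ?case by (simp add: distrib_left partial_deriv_add lookup_add)
qed

section \<open>The operators \<open>z\<^sub>i\<close> on monomials\<close>

text \<open>
  Summing the divided differences over \<open>r\<close> leaves the monomials with \<open>x\<^sub>j\<close>-exponent
  \<open>b \<equiv> \<nu>\<^sub>j (mod l)\<close>, with \<open>b\<close> between \<open>\<nu>\<^sub>j\<close> and \<open>\<nu>\<^sub>i + 1\<close>. For \<open>j < i\<close> the reflection terms in \<open>z\<^sub>i\<close>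
  cancel \<open>b = \<nu>\<^sub>i\<close>, which makes the operators triangular. The coefficient of \<open>c\<^sub>0 x\<^sup>\<alpha>\<close> in \<open>z\<^sub>i x\<^sup>\<nu>\<close> is
  the integer \<open>zc n l i \<nu> \<alpha>\<close>, independent of the field.
\<close>

definition zP :: "nat \<Rightarrow> nat \<Rightarrow> (nat \<Rightarrow>\<^sub>0 nat) \<Rightarrow> nat" where
  "zP i j \<nu> = (if i < j then Suc (lookup \<nu> i) else lookup \<nu> i)"

definition zt :: "nat \<Rightarrow> nat \<Rightarrow> nat \<Rightarrow> (nat \<Rightarrow>\<^sub>0 nat) \<Rightarrow> (nat \<Rightarrow>\<^sub>0 nat) \<Rightarrow> nat \<Rightarrow> int" where
  "zt l i j \<nu> \<alpha> b = (if b mod l = lookup \<nu> j mod l \<and>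
     upd2 i j (lookup \<nu> i + lookup \<nu> j - b) b \<nu> = \<alpha> then int l else 0)"

definition zc :: "nat \<Rightarrow> nat \<Rightarrow> nat \<Rightarrow> (nat \<Rightarrow>\<^sub>0 nat) \<Rightarrow> (nat \<Rightarrow>\<^sub>0 nat) \<Rightarrow> int" where
  "zc n l i \<nu> \<alpha> = - (\<Sum>j\<in>{1..n} - {i}.
     (\<Sum>b\<in>{lookup \<nu> j..<zP i j \<nu>}. zt l i j \<nu> \<alpha> b) - (\<Sum>b\<in>{zP i j \<nu>..<lookup \<nu> j}. zt l i j \<nu> \<alpha> b))"

context root_of_unity
begin

lemma dunkl_z_eq:
  assumes "i \<in> {1..n}"
  shows "dunkl_z n l \<zeta> c i f = partial_deriv i (var i * f) - const c * (\<Sum>j\<in>{1..n} - {i}.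
    (\<Sum>r<l. dd i j r (var i * f)) - (if j < i then \<Sum>r<l. refl_act \<zeta> i j r f else 0))"
proof -
  have "(\<Sum>j\<in>{1..<i}. \<Sum>r<l. refl_act \<zeta> i j r f) =
    (\<Sum>j\<in>{1..n} - {i}. if j < i then \<Sum>r<l. refl_act \<zeta> i j r f else 0)"
    by (rule sum.mono_neutral_cong_left) (use assms in auto)
  then show ?thesis
    by (simp add: dunkl_z_def dunkl_y_def dd_def lin_def sum_subtractf algebra_simps)
qed

lemma dunkl_z_add:
  assumes "i \<in> {1..n}"
  shows "dunkl_z n l \<zeta> c i (f + g) = dunkl_z n l \<zeta> c i f + dunkl_z n l \<zeta> c i g"
proof -
  have "(\<Sum>j\<in>{1..n} - {i}. (\<Sum>r<l. dd i j r (var i * (f + g))) - (if j < i then \<Sum>r<l. refl_act \<zeta> i j r (f + g) else 0))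
    = (\<Sum>j\<in>{1..n} - {i}. (\<Sum>r<l. dd i j r (var i * f)) - (if j < i then \<Sum>r<l. refl_act \<zeta> i j r f else 0))
    + (\<Sum>j\<in>{1..n} - {i}. (\<Sum>r<l. dd i j r (var i * g)) - (if j < i then \<Sum>r<l. refl_act \<zeta> i j r g else 0))"
    unfolding sum.distrib[symmetric]
    by (intro sum.cong refl) (auto simp: distrib_left dd_add refl_act_subst sum.distrib)
  then show ?thesis
    unfolding dunkl_z_eq[OF assms] by (simp only: distrib_left partial_deriv_add) simp
qed

lemma dunkl_z_const:
  assumes "i \<in> {1..n}"
  shows "dunkl_z n l \<zeta> c i (const d * f) = const d * dunkl_z n l \<zeta> c i f"
proof -
  have v: "var i * (const d * f) = const d * (var i * f)" by (simp only: ac_simps)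
  have "(\<Sum>j\<in>{1..n} - {i}. (\<Sum>r<l. dd i j r (var i * (const d * f))) - (if j < i then \<Sum>r<l. refl_act \<zeta> i j r (const d * f) else 0))
    = const d * (\<Sum>j\<in>{1..n} - {i}. (\<Sum>r<l. dd i j r (var i * f)) - (if j < i then \<Sum>r<l. refl_act \<zeta> i j r f else 0))"
    unfolding sum_distrib_left v
    by (intro sum.cong refl) (auto simp: right_diff_distrib dd_const refl_act_subst sum_distrib_left)
  moreover have "partial_deriv i (var i * (const d * f)) = const d * partial_deriv i (var i * f)"
    by (rule poly_mapping_eqI) (simp add: lookup_euler)
  ultimately show ?thesis
    unfolding dunkl_z_eq[OF assms] by (simp add: right_diff_distrib mult.left_commute)
qed

lemma lookup_dunkl_z_monom:
  assumes "i \<in> {1..n}"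
  shows "lookup (dunkl_z n l \<zeta> c i (single \<nu> 1)) \<alpha> =
    (if \<alpha> = \<nu> then of_nat (Suc (lookup \<nu> i)) else 0) + c * of_int (zc n l i \<nu> \<alpha>)"
proof -
  have t: "lookup (const (if b mod l = lookup \<nu> j mod l then of_nat l else 0) *
      single (upd2 i j (lookup \<nu> i + lookup \<nu> j - b) b \<nu>) (1::'a)) \<alpha> = of_int (zt l i j \<nu> \<alpha> b)" for j b
    by (simp add: zt_def lookup_single when_def)
  have "(\<Sum>j\<in>{1..n} - {i}. lookup ((\<Sum>r<l. dd i j r (var i * single \<nu> 1)) -
      (if j < i then \<Sum>r<l. refl_act \<zeta> i j r (single \<nu> 1) else 0)) \<alpha>) = - of_int (zc n l i \<nu> \<alpha>)"
    unfolding zc_def of_int_minus of_int_sum of_int_diff minus_minus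
    by (intro sum.cong refl, subst sum_dd_refl) (auto simp only: lookup_minus lookup_sum t zP_def)
  then have "lookup (dunkl_z n l \<zeta> c i (single \<nu> 1)) \<alpha> =
    lookup (partial_deriv i (var i * single \<nu> (1::'a))) \<alpha> - c * (- of_int (zc n l i \<nu> \<alpha>))"
    unfolding dunkl_z_eq[OF assms] lookup_minus lookup_const_mult lookup_sum by simp
  then show ?thesis by (simp add: lookup_euler lookup_single when_def)
qed

text \<open>The integers \<open>zc\<close> do not depend on the field, so this one formula serves
  for rational functions and for complex numbers. The free index set \<open>A\<close> lets a
  polynomial and its specialization be summed over the same exponents.\<close>

lemma lookup_dunkl_z:
  assumes "i \<in> {1..n}" and "finite A" "keys f \<subseteq> A"
  shows "lookup (dunkl_z n l \<zeta> c i f) \<alpha> = of_nat (Suc (lookup \<alpha> i)) * lookup f \<alpha> +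
    c * (\<Sum>\<nu>\<in>A. lookup f \<nu> * of_int (zc n l i \<nu> \<alpha>))"
proof -
  have "lookup (dunkl_z n l \<zeta> c i f) \<alpha> = of_nat (Suc (lookup \<alpha> i)) * lookup f \<alpha> +
    c * (\<Sum>\<nu>\<in>keys f. lookup f \<nu> * of_int (zc n l i \<nu> \<alpha>))"
  proof (induction f rule: mpoly_induct_single)
    case (single \<nu> d)
    have "dunkl_z n l \<zeta> c i (single \<nu> d) = const d * dunkl_z n l \<zeta> c i (single \<nu> 1)"
      by (metis dunkl_z_const[OF assms(1)] single_eq_const_mult)
    then show ?case
      by (simp add: lookup_dunkl_z_monom[OF assms(1)] lookup_single when_def algebra_simps)
  next
    case (add f g)
    let ?h = "\<lambda>\<nu>. of_int (zc n l i \<nu> \<alpha>) :: 'a"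
    have sup: "(\<Sum>\<nu>\<in>keys h. lookup h \<nu> * ?h \<nu>) = (\<Sum>\<nu>\<in>keys f \<union> keys g. lookup h \<nu> * ?h \<nu>)"
      if "keys h \<subseteq> keys f \<union> keys g" for h
      by (rule sum.mono_neutral_left) (use that in \<open>auto simp: in_keys_iff\<close>)
    have "(\<Sum>\<nu>\<in>keys (f + g). lookup (f + g) \<nu> * ?h \<nu>) =
      (\<Sum>\<nu>\<in>keys f. lookup f \<nu> * ?h \<nu>) + (\<Sum>\<nu>\<in>keys g. lookup g \<nu> * ?h \<nu>)"
      unfolding sup[OF keys_add] sup[OF Un_upper1] sup[OF Un_upper2]
      by (simp add: lookup_add distrib_right sum.distrib)
    then show ?case
      by (simp add: dunkl_z_add[OF assms(1)] lookup_add add algebra_simps)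
  qed
  also have "(\<Sum>\<nu>\<in>keys f. lookup f \<nu> * of_int (zc n l i \<nu> \<alpha>)) =
    (\<Sum>\<nu>\<in>A. lookup f \<nu> * (of_int (zc n l i \<nu> \<alpha>) :: 'a))"
    by (rule sum.mono_neutral_left) (use assms in \<open>auto simp: in_keys_iff\<close>)
  finally show ?thesis .
qed

end

section \<open>Triangularity\<close>

definition psi :: "nat \<Rightarrow> (nat \<Rightarrow>\<^sub>0 nat) \<Rightarrow> int" where
  "psi n \<mu> = (\<Sum>i\<in>{1..n}. (kap n \<mu> i)\<^sup>2)"

lemma psi_nonneg: "psi n \<mu> \<ge> 0"
  by (simp add: psi_def sum_nonneg)

lemma square_shift_less:
  fixes x y s :: int
  assumes "0 < s" "s < x - y"
  shows "(x - s)\<^sup>2 + (y + s)\<^sup>2 < x\<^sup>2 + y\<^sup>2"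
proof -
  have "0 < s * (x - y - s)" using assms by simp
  then show ?thesis by (simp add: power2_eq_square algebra_simps)
qed

text \<open>Moving s units from entry i to entry j moves both keys by (n + 1) s towards each other,
  by less than would exchange them, so the sum of squares drops.\<close>

lemma psi_shift:
  assumes "i \<in> {1..n}" "j \<in> {1..n}" "i \<noteq> j" "0 < s"
    and "kap n \<nu> j + int (Suc n) * int s < kap n \<nu> i"
    and "\<And>t. t \<notin> {i, j} \<Longrightarrow> lookup \<alpha> t = lookup \<nu> t"
    and "lookup \<alpha> i + s = lookup \<nu> i" "lookup \<alpha> j = lookup \<nu> j + s"
  shows "psi n \<alpha> < psi n \<nu>"
proof -
  have split: "psi n \<beta> = (\<Sum>t\<in>{1..n} - {i, j}. (kap n \<beta> t)\<^sup>2) + ((kap n \<beta> i)\<^sup>2 + (kap n \<beta> j)\<^sup>2)" for \<beta>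
  proof -
    have "psi n \<beta> = (\<Sum>t\<in>{1..n} - {i, j}. (kap n \<beta> t)\<^sup>2) + (\<Sum>t\<in>{i, j}. (kap n \<beta> t)\<^sup>2)"
      unfolding psi_def by (rule sum.subset_diff) (use assms in auto)
    then show ?thesis using assms(3) by simp
  qed
  have same: "(\<Sum>t\<in>{1..n} - {i, j}. (kap n \<alpha> t)\<^sup>2) = (\<Sum>t\<in>{1..n} - {i, j}. (kap n \<nu> t)\<^sup>2)"
    by (intro sum.cong refl) (use assms(6) in \<open>simp add: kap_def\<close>)
  have "kap n \<alpha> i = kap n \<nu> i - int (Suc n) * int s" "kap n \<alpha> j = kap n \<nu> j + int (Suc n) * int s"
    using assms(7,8) by (simp_all add: kap_def algebra_simps flip: assms(7))
  then show ?thesis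
    unfolding split[of \<alpha>] split[of \<nu>] same
    using square_shift_less[of "int (Suc n) * int s" "kap n \<nu> i" "kap n \<nu> j"] assms(4,5) by simp
qed

text \<open>A new exponent arises by moving units between the entries i and j. The extreme case b =
  \<nu>_i exchanges two different entries; \<open>zP\<close> admits it exactly when the tie-break by
  position in \<open>kap\<close> makes this lower \<open>psi\<close>.\<close>

lemma zc_nonzero:
  assumes "i \<in> {1..n}" "\<nu> \<in> compositions n" "zc n l i \<nu> \<alpha> \<noteq> 0" "\<alpha> \<noteq> \<nu>"
  shows "\<alpha> \<in> compositions n \<and> psi n \<alpha> < psi n \<nu>"
proof -
  obtain j where j: "j \<in> {1..n} - {i}" and
    "(\<Sum>b\<in>{lookup \<nu> j..<zP i j \<nu>}. zt l i j \<nu> \<alpha> b) - (\<Sum>b\<in>{zP i j \<nu>..<lookup \<nu> j}. zt l i j \<nu> \<alpha> b) \<noteq> 0"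
    using assms(3) unfolding zc_def by (metis (no_types, lifting) neg_equal_0_iff_equal sum.neutral)
  then obtain b where b: "b \<in> {lookup \<nu> j..<zP i j \<nu>} \<or> b \<in> {zP i j \<nu>..<lookup \<nu> j}" "zt l i j \<nu> \<alpha> b \<noteq> 0"
    by (metis (no_types, lifting) diff_self sum.neutral)
  let ?p = "lookup \<nu> i" and ?q = "lookup \<nu> j"
  have al: "\<alpha> = upd2 i j (?p + ?q - b) b \<nu>" using b(2) by (auto simp: zt_def split: if_splits)
  have bq: "b \<noteq> ?q"
  proof
    assume "b = ?q"
    then show False using al assms(4) by (simp add: upd2_same)
  qed
  have ij: "i \<in> {1..n}" "j \<in> {1..n}" "i \<noteq> j" using assms(1) j by auto
  have comp: "\<alpha> \<in> compositions n" unfolding al by (rule upd2_composition[OF assms(2) ij(1,2)])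
  from b(1) have "psi n \<alpha> < psi n \<nu>"
  proof
    assume "b \<in> {?q..<zP i j \<nu>}"
    then have r: "?q < b" "b < zP i j \<nu>" using bq by auto
    show ?thesis
    proof (rule psi_shift[OF ij, of "b - ?q"])
      show "kap n \<nu> j + int (Suc n) * int (b - ?q) < kap n \<nu> i"
        unfolding kap_gap[OF ij(1,2)] using r ij(3) by (auto simp: zP_def split: if_splits)
    qed (use r ij(3) in \<open>auto simp: al lookup_upd2 zP_def split: if_splits\<close>)
  next
    assume "b \<in> {zP i j \<nu>..<?q}"
    then have r: "zP i j \<nu> \<le> b" "b < ?q" by auto
    show ?thesis
    proof (rule psi_shift[OF ij(2,1) ij(3)[symmetric], of "?q - b"])
      show "kap n \<nu> i + int (Suc n) * int (?q - b) < kap n \<nu> j"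
        unfolding kap_gap[OF ij(2,1)] using r ij(3) by (auto simp: zP_def split: if_splits)
    qed (use r ij(3) in \<open>auto simp: al lookup_upd2 zP_def split: if_splits\<close>)
  qed
  then show ?thesis using comp by simp
qed

text \<open>Only b = \<nu>_j reproduces x^\<nu>, and it occurs only in the first sum, for exactly
  the positions j of smaller rank; each contributes l.\<close>

lemma zc_diag:
  assumes "i \<in> {1..n}"
  shows "zc n l i \<nu> \<nu> = - int l * int (rk n \<nu> i)"
proof -
  have eq: "upd2 i j (lookup \<nu> i + lookup \<nu> j - b) b \<nu> = \<nu> \<longleftrightarrow> b = lookup \<nu> j" if "i \<noteq> j" for j b
  proof
    assume "upd2 i j (lookup \<nu> i + lookup \<nu> j - b) b \<nu> = \<nu>"
    then have "lookup (upd2 i j (lookup \<nu> i + lookup \<nu> j - b) b \<nu>) j = lookup \<nu> j" by simp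
    then show "b = lookup \<nu> j" using that by (simp add: lookup_upd2)
  qed (simp add: upd2_same)
  have t: "zt l i j \<nu> \<nu> b = (if b = lookup \<nu> j then int l else 0)" if "i \<noteq> j" for j b
    using eq[OF that, of b] by (auto simp: zt_def)
  have "(\<Sum>b\<in>{lookup \<nu> j..<zP i j \<nu>}. zt l i j \<nu> \<nu> b) - (\<Sum>b\<in>{zP i j \<nu>..<lookup \<nu> j}. zt l i j \<nu> \<nu> b) =
      (if lookup \<nu> j < lookup \<nu> i \<or> lookup \<nu> j = lookup \<nu> i \<and> i < j then int l else 0)"
    if "j \<in> {1..n} - {i}" for j
    using that by (auto simp: t sum.delta zP_def)
  then have "zc n l i \<nu> \<nu> = - (\<Sum>j\<in>{1..n} - {i}.
      if lookup \<nu> j < lookup \<nu> i \<or> lookup \<nu> j = lookup \<nu> i \<and> i < j then int l else 0)"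
    unfolding zc_def by simp
  also have "(\<Sum>j\<in>{1..n} - {i}.
      if lookup \<nu> j < lookup \<nu> i \<or> lookup \<nu> j = lookup \<nu> i \<and> i < j then int l else 0) =
      (\<Sum>j\<in>{j \<in> {1..n}. lookup \<nu> j < lookup \<nu> i \<or> lookup \<nu> j = lookup \<nu> i \<and> i < j}. int l)"
    by (rule sum.mono_neutral_cong_right) auto
  finally show ?thesis by (simp add: rk_def)
qed

text \<open>Here \<open>rk n \<mu> i\<close> is \<open>w\<^sub>\<mu>(i) - 1\<close>.\<close>

definition wt :: "nat \<Rightarrow> nat \<Rightarrow> 'a::field \<Rightarrow> (nat \<Rightarrow>\<^sub>0 nat) \<Rightarrow> nat \<Rightarrow> 'a" where
  "wt n l c \<mu> i = of_nat (lookup \<mu> i) + 1 - of_nat l * c * of_nat (rk n \<mu> i)"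

lemma finite_arg_max_exists:
  fixes h :: "'b \<Rightarrow> int"
  assumes "finite A" "A \<noteq> {}"
  obtains x where "x \<in> A" "\<And>y. y \<in> A \<Longrightarrow> h y \<le> h x"
proof -
  obtain x where "x \<in> A" "h x = Max (h ` A)" using assms by (metis (no_types, lifting) Max_in finite_imageI image_iff image_is_empty)
  then show ?thesis using that assms(1) by (metis Max_ge finite_imageI imageI)
qed

lemma leading_exponent:
  assumes "f \<noteq> 0"
  obtains \<alpha> where "\<alpha> \<in> keys f" "\<And>\<nu>. \<nu> \<in> keys f \<Longrightarrow> psi n \<nu> \<le> psi n \<alpha>"
proof -
  have "keys f \<noteq> {}" using assms by (metis poly_mapping_eqI in_keys_iff empty_iff lookup_zero)
  then show ?thesis using finite_arg_max_exists[of "keys f" "psi n"] that by auto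
qed

context root_of_unity
begin

text \<open>Besides itself, a monomial of f produces only monomials strictly below it in
  \<open>psi\<close>. As no exponent of f lies above \<alpha>, x^\<alpha> can only come from itself,
  with the diagonal coefficient.\<close>

lemma dunkl_z_lead:
  assumes "i \<in> {1..n}" "f \<in> poly_ring n" "\<And>\<nu>. \<nu> \<in> keys f \<Longrightarrow> psi n \<nu> \<le> psi n \<alpha>"
  shows "lookup (dunkl_z n l \<zeta> c i f) \<alpha> = wt n l c \<alpha> i * lookup f \<alpha>"
proof -
  have "lookup f \<nu> * of_int (zc n l i \<nu> \<alpha>) = 0" if "\<nu> \<in> insert \<alpha> (keys f) - {\<alpha>}" for \<nu>
  proof -
    have "\<nu> \<in> keys f" "\<nu> \<noteq> \<alpha>" using that by auto
    then have "psi n \<nu> \<le> psi n \<alpha>" "\<nu> \<in> compositions n" using assms(2,3) by (auto simp: poly_ring_def)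
    then have "zc n l i \<nu> \<alpha> = 0" using zc_nonzero[OF assms(1), of \<nu> l \<alpha>] \<open>\<nu> \<noteq> \<alpha>\<close> by fastforce
    then show ?thesis by simp
  qed
  then have "(\<Sum>\<nu>\<in>insert \<alpha> (keys f). lookup f \<nu> * of_int (zc n l i \<nu> \<alpha>)) =
    lookup f \<alpha> * of_int (zc n l i \<alpha> \<alpha>)"
    by (subst sum.remove[of _ \<alpha>]) (simp_all add: sum.neutral)
  then have "lookup (dunkl_z n l \<zeta> c i f) \<alpha> = of_nat (Suc (lookup \<alpha> i)) * lookup f \<alpha> +
    c * (lookup f \<alpha> * of_int (zc n l i \<alpha> \<alpha>))"
    by (subst lookup_dunkl_z[OF assms(1), of "insert \<alpha> (keys f)"]) auto
  then show ?thesis by (simp add: zc_diag[OF assms(1)] wt_def algebra_simps)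
qed

lemma dunkl_z_keys:
  assumes "i \<in> {1..n}" "f \<in> poly_ring n" "\<alpha> \<in> keys (dunkl_z n l \<zeta> c i f)"
  shows "\<alpha> \<in> compositions n \<and> (\<exists>\<nu>\<in>keys f. psi n \<alpha> \<le> psi n \<nu>)"
proof (cases "\<alpha> \<in> keys f")
  case True
  then show ?thesis using assms(2) by (auto simp: poly_ring_def)
next
  case False
  then have "lookup f \<alpha> = 0" by (simp add: in_keys_iff)
  then have "(\<Sum>\<nu>\<in>keys f. lookup f \<nu> * of_int (zc n l i \<nu> \<alpha>)) \<noteq> 0"
    using assms(3) lookup_dunkl_z[OF assms(1), of "keys f" f c \<alpha>] by (auto simp: in_keys_iff)
  then obtain \<nu> where "\<nu> \<in> keys f" "lookup f \<nu> * of_int (zc n l i \<nu> \<alpha>) \<noteq> 0"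
    by (meson sum.neutral)
  then have \<nu>: "\<nu> \<in> keys f" "zc n l i \<nu> \<alpha> \<noteq> 0" "\<alpha> \<noteq> \<nu>" using False by auto
  moreover have "\<nu> \<in> compositions n" using assms(2) \<nu>(1) by (auto simp: poly_ring_def)
  ultimately show ?thesis using zc_nonzero[OF assms(1) _ \<nu>(2,3)] by (meson less_imp_le)
qed

lemma dunkl_z_poly_ring: "i \<in> {1..n} \<Longrightarrow> f \<in> poly_ring n \<Longrightarrow> dunkl_z n l \<zeta> c i f \<in> poly_ring n"
  using dunkl_z_keys[of i n f _ c] by (auto simp: poly_ring_def)

end

section \<open>Permuting the variables\<close>

definition pact :: "(nat \<Rightarrow> nat) \<Rightarrow> 'a::comm_semiring_1 mpoly \<Rightarrow> 'a mpoly" where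
  "pact \<pi> = subst (\<lambda>t. var (\<pi> t))"

definition permc :: "(nat \<Rightarrow> nat) \<Rightarrow> (nat \<Rightarrow>\<^sub>0 nat) \<Rightarrow> (nat \<Rightarrow>\<^sub>0 nat)" where
  "permc \<pi> = Poly_Mapping.map_key (inv \<pi>)"

lemma lookup_permc:
  assumes "bij \<pi>"
  shows "lookup (permc \<pi> \<alpha>) t = lookup \<alpha> (inv \<pi> t)"
  unfolding permc_def using bij_imp_bij_inv[OF assms] by (simp add: map_key.rep_eq bij_is_inj)

lemma lookup_permc_image [simp]: "bij \<pi> \<Longrightarrow> lookup (permc \<pi> \<alpha>) (\<pi> t) = lookup \<alpha> t"
  by (simp add: lookup_permc bij_is_inj)

lemma permc_inj:
  assumes "bij \<pi>" "permc \<pi> \<alpha> = permc \<pi> \<beta>"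
  shows "\<alpha> = \<beta>"
  by (rule poly_mapping_eqI) (metis assms lookup_permc_image)

lemma permc_composition:
  assumes "\<pi> permutes {1..n}" "\<mu> \<in> compositions n"
  shows "permc \<pi> \<mu> \<in> compositions n"
  unfolding compositions_def
proof (clarify)
  fix t assume "t \<in> keys (permc \<pi> \<mu>)"
  then have "lookup \<mu> (inv \<pi> t) \<noteq> 0"
    using lookup_permc[OF permutes_bij[OF assms(1)], of \<mu> t] by (simp add: in_keys_iff)
  then have "inv \<pi> t \<in> {1..n}" using lookup_composition[OF assms(2), of "inv \<pi> t"] by argo
  then show "t \<in> {1..n}" by (simp only: permutes_in_image[OF permutes_inv[OF assms(1)]])
qed

lemma pact_add [simp]: "pact \<pi> (f + g) = pact \<pi> f + pact \<pi> g"
  and pact_mult [simp]: "pact \<pi> (f * g) = pact \<pi> f * pact \<pi> g"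
  and pact_const [simp]: "pact \<pi> (const c) = const c"
  and pact_var [simp]: "pact \<pi> (var i) = var (\<pi> i)"
  and pact_0 [simp]: "pact \<pi> 0 = 0"
  by (simp_all add: pact_def)

lemma pact_diff [simp]: "pact \<pi> (f - g) = pact \<pi> f - pact \<pi> g"
  for f :: "'a::comm_ring_1 mpoly"
  by (simp add: pact_def)

lemma pact_sum: "pact \<pi> (sum h A) = (\<Sum>x\<in>A. pact \<pi> (h x))"
  by (simp add: pact_def subst_sum)

lemma pact_single:
  assumes "bij \<pi>"
  shows "pact \<pi> (single \<alpha> c) = single (permc \<pi> \<alpha>) c"
proof -
  have *: "(\<Prod>i\<in>A. single (single (\<pi> i) (lookup \<alpha> i)) (1::'a)) =
      single (\<Sum>i\<in>A. single (\<pi> i) (lookup \<alpha> i)) 1" if "finite A" for A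
    using that by induction (simp_all add: mult_single)
  have "(\<Sum>i\<in>keys \<alpha>. single (\<pi> i) (lookup \<alpha> i)) = permc \<pi> \<alpha>"
  proof (rule poly_mapping_eqI)
    fix t
    have "\<pi> i = t \<longleftrightarrow> i = inv \<pi> t" for i
      using assms by (metis bij_inv_eq_iff)
    then show "lookup (\<Sum>i\<in>keys \<alpha>. single (\<pi> i) (lookup \<alpha> i)) t = lookup (permc \<pi> \<alpha>) t"
      by (simp add: lookup_sum lookup_single lookup_permc[OF assms] when_def sum.delta in_keys_iff)
  qed
  then show ?thesis
    by (simp add: pact_def subst_single monom_val_def var_power * const_mult_single)
qed

lemma lookup_pact:
  assumes "bij \<pi>"
  shows "lookup (pact \<pi> f) (permc \<pi> \<alpha>) = lookup f \<alpha>"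
proof (induction f rule: mpoly_induct_single)
  case (single \<beta> c)
  have "permc \<pi> \<beta> = permc \<pi> \<alpha> \<longleftrightarrow> \<beta> = \<alpha>" using permc_inj[OF assms] by auto
  then show ?case by (simp add: pact_single[OF assms] lookup_single)
qed (simp add: lookup_add)

lemma permc_permc_inv:
  assumes "bij \<pi>"
  shows "permc \<pi> (permc (inv \<pi>) \<alpha>) = \<alpha>"
  by (rule poly_mapping_eqI)
    (simp add: lookup_permc[OF assms] lookup_permc[OF bij_imp_bij_inv[OF assms]] inv_inv_eq[OF assms]
      bij_is_surj[OF assms] surj_f_inv_f)

lemma keys_pact:
  assumes "bij \<pi>" "\<beta> \<in> keys (pact \<pi> f)"
  obtains \<alpha> where "\<alpha> \<in> keys f" "\<beta> = permc \<pi> \<alpha>"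
proof
  show "\<beta> = permc \<pi> (permc (inv \<pi>) \<beta>)" by (simp add: permc_permc_inv[OF assms(1)])
  then show "permc (inv \<pi>) \<beta> \<in> keys f"
    using assms(2) lookup_pact[OF assms(1), of f] by (metis in_keys_iff)
qed

lemma pact_euler:
  assumes "bij \<pi>"
  shows "pact \<pi> (partial_deriv i (var i * f)) = partial_deriv (\<pi> i) (var (\<pi> i) * pact \<pi> f)"
proof (rule poly_mapping_eqI)
  fix \<beta>
  obtain \<alpha> where "\<beta> = permc \<pi> \<alpha>" using permc_permc_inv[OF assms] by metis
  then show "lookup (pact \<pi> (partial_deriv i (var i * f))) \<beta> =
      lookup (partial_deriv (\<pi> i) (var (\<pi> i) * pact \<pi> f)) \<beta>"
    by (simp add: lookup_pact[OF assms] lookup_euler assms)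
qed

lemma pact_pact: "pact \<pi> (pact \<sigma> f) = pact (\<pi> \<circ> \<sigma>) f"
  by (simp add: pact_def subst_subst)

lemma pact_id [simp]: "pact (\<lambda>t. t) f = f"
  by (simp add: pact_def)

lemma euler_var:
  "partial_deriv i (var i * (var t * f)) = var t * partial_deriv i (var i * f) +
    (if t = i then var t * f else 0)"
  for f :: "'a::comm_semiring_1 mpoly"
proof (induction f rule: mpoly_induct_single)
  case (single \<alpha> c)
  have v: "var t * single \<alpha> c = single (single t 1 + \<alpha>) c" for t \<alpha> and c :: 'a
    by (simp add: var_def mult_single)
  show ?case
    by ((cases "t = i"; simp add: v partial_deriv_single lookup_add lookup_single when_def
        single_add[symmetric] distrib_right), simp add: ac_simps)
next
  case (add f g)
  then show ?case by (simp add: distrib_left partial_deriv_add ac_simps)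
qed

section \<open>Intertwining relations\<close>

context root_of_unity
begin

definition ss :: "nat \<Rightarrow> nat \<Rightarrow> 'a mpoly \<Rightarrow> 'a mpoly" where
  "ss i j f = (\<Sum>r<l. refl_act \<zeta> i j r f)"

text \<open>\<open>zz n c i f\<close> is \<open>y\<^sub>i x\<^sub>i f\<close>.\<close>

definition zz :: "nat \<Rightarrow> 'a \<Rightarrow> nat \<Rightarrow> 'a mpoly \<Rightarrow> 'a mpoly" where
  "zz n c i f = partial_deriv i (var i * f) -
     const c * (\<Sum>j\<in>{1..n} - {i}. \<Sum>r<l. dd i j r (var i * f))"

text \<open>The part \<open>zz\<close> is equivariant under all permutations of the variables,
  because its sum runs over every j other than i; only the remaining sum depends on the order of the
  positions.\<close>

lemma dunkl_z_zz: "dunkl_z n l \<zeta> c i f = zz n c i f + const c * (\<Sum>j\<in>{1..<i}. ss i j f)"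
  by (simp add: dunkl_z_def dunkl_y_def zz_def dd_def lin_def ss_def)

lemma pact_refl:
  assumes "bij \<pi>" "i \<noteq> j"
  shows "pact \<pi> (refl_act \<zeta> i j r f) = refl_act \<zeta> (\<pi> i) (\<pi> j) r (pact \<pi> f)"
proof -
  have inj: "\<pi> a = \<pi> b \<longleftrightarrow> a = b" for a b using assms(1) by (metis bij_pointE)
  have "pact \<pi> (refl_map i j r t) = refl_map (\<pi> i) (\<pi> j) r (\<pi> t)" for t
    by (simp add: refl_map_def inj)
  then show ?thesis
    using assms(2) inj by (simp add: refl_act_subst pact_def subst_subst)
qed

lemma pact_dd:
  assumes "bij \<pi>" "i \<noteq> j"
  shows "pact \<pi> (dd i j r f) = dd (\<pi> i) (\<pi> j) r (pact \<pi> f)"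
proof (rule sym, rule dd_eqI)
  show "\<pi> i \<noteq> \<pi> j" using assms by (metis bij_pointE)
  have "pact \<pi> (lin i j r) = lin (\<pi> i) (\<pi> j) r" by (simp add: lin_def)
  then show "pact \<pi> (dd i j r f) * lin (\<pi> i) (\<pi> j) r = pact \<pi> f - refl_act \<zeta> (\<pi> i) (\<pi> j) r (pact \<pi> f)"
    using arg_cong[OF dd_mult[OF assms(2), of r f], of "pact \<pi>"] by (simp add: pact_refl[OF assms])
qed

lemma pact_ss: "bij \<pi> \<Longrightarrow> i \<noteq> j \<Longrightarrow> pact \<pi> (ss i j f) = ss (\<pi> i) (\<pi> j) (pact \<pi> f)"
  by (simp add: ss_def pact_sum pact_refl)

lemma pact_zz:
  assumes "\<pi> permutes {1..n}"
  shows "pact \<pi> (zz n c i f) = zz n c (\<pi> i) (pact \<pi> f)"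
proof -
  have b: "bij \<pi>" by (rule permutes_bij[OF assms])
  have "(\<Sum>j\<in>{1..n} - {i}. \<Sum>r<l. dd (\<pi> i) (\<pi> j) r (var (\<pi> i) * pact \<pi> f)) =
      (\<Sum>j\<in>{1..n} - {\<pi> i}. \<Sum>r<l. dd (\<pi> i) j r (var (\<pi> i) * pact \<pi> f))"
  proof (rule sum.reindex_bij_betw)
    have "\<pi> ` ({1..n} - {i}) = {1..n} - {\<pi> i}"
      using permutes_image[OF assms] image_set_diff[OF bij_is_inj[OF b], of "{1..n}" "{i}"] by simp
    then show "bij_betw \<pi> ({1..n} - {i}) ({1..n} - {\<pi> i})"
      by (metis bij_betw_def bij_is_inj[OF b] inj_on_subset subset_UNIV)
  qed
  moreover have "pact \<pi> (\<Sum>j\<in>{1..n} - {i}. \<Sum>r<l. dd i j r (var i * f)) =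
      (\<Sum>j\<in>{1..n} - {i}. \<Sum>r<l. dd (\<pi> i) (\<pi> j) r (var (\<pi> i) * pact \<pi> f))"
    unfolding pact_sum by (intro sum.cong refl, subst pact_dd[OF b]) auto
  ultimately show ?thesis
    unfolding zz_def by (simp add: pact_euler[OF b])
qed

lemma ss_add: "i \<noteq> j \<Longrightarrow> ss i j (f + g) = ss i j f + ss i j g"
  by (simp add: ss_def refl_act_subst sum.distrib)

lemma ss_const: "i \<noteq> j \<Longrightarrow> ss i j (const d * f) = const d * ss i j f"
  by (simp add: ss_def refl_act_subst sum_distrib_left)

text \<open>Summation over r projects to the monomials whose exponents at i and j agree modulo l,
  and there acts as l times the exchange.\<close>

lemma ss_monom:
  assumes "i \<noteq> j"
  shows "ss i j (single \<nu> 1) = const (if lookup \<nu> i mod l = lookup \<nu> j mod l then of_nat l else 0) *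
    single (upd2 i j (lookup \<nu> j) (lookup \<nu> i) \<nu>) 1"
  unfolding ss_def refl_monom[OF assms] sum_distrib_right[symmetric] const_sum[symmetric] root_sum ..

lemma ss_single:
  assumes "i \<noteq> j"
  shows "ss i j (single \<nu> d) = const (if lookup \<nu> i mod l = lookup \<nu> j mod l then of_nat l else 0) *
    single (upd2 i j (lookup \<nu> j) (lookup \<nu> i) \<nu>) d"
  by (subst (1 2) single_eq_const_mult) (simp only: ss_const[OF assms] ss_monom[OF assms] ac_simps)

lemma ss_sym:
  assumes "i \<noteq> j"
  shows "ss i j f = ss j i f"
proof (induction f rule: mpoly_induct_single)
  case (single \<nu> d)
  have "upd2 i j (lookup \<nu> j) (lookup \<nu> i) \<nu> = upd2 j i (lookup \<nu> i) (lookup \<nu> j) \<nu>"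
    by (rule poly_mapping_eqI) (use assms in \<open>simp add: lookup_upd2\<close>)
  then show ?case using assms ss_single[of i j] ss_single[of j i] by (simp add: eq_commute)
qed (use assms in \<open>simp add: ss_add\<close>)

text \<open>When the exponents of f at i and j are always or never congruent modulo l, the
  reflection sum undoes the exchange up to the scalar l or 0. The error terms in
  \<open>swap_z\<close> thus become multiples of f.\<close>

lemma ss_swap:
  assumes "i \<noteq> j" "\<And>\<alpha>. \<alpha> \<in> keys f \<Longrightarrow> (lookup \<alpha> i mod l = lookup \<alpha> j mod l) = same"
  shows "ss i j (pact (transpose i j) f) = const (if same then of_nat l else 0) * f"
proof -
  let ?s = "transpose i j"
  have b: "bij ?s" by simp
  have one: "ss i j (pact ?s (single \<alpha> d)) = const (if same then of_nat l else 0) * single \<alpha> d"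
    if "(lookup \<alpha> i mod l = lookup \<alpha> j mod l) = same" for \<alpha> d
  proof -
    have i: "lookup (permc ?s \<alpha>) i = lookup \<alpha> j" "lookup (permc ?s \<alpha>) j = lookup \<alpha> i"
      by (simp_all add: lookup_permc[OF b])
    have "upd2 i j (lookup \<alpha> i) (lookup \<alpha> j) (permc ?s \<alpha>) = \<alpha>"
      by (rule poly_mapping_eqI) (simp add: lookup_upd2 lookup_permc[OF b])
    then show ?thesis
      using that unfolding pact_single[OF b] ss_single[OF assms(1)] i by (auto simp: eq_commute)
  qed
  have zero: "ss i j 0 = 0"
    using ss_const[OF assms(1), of 0 0] by simp
  have "ss i j (pact ?s (\<Sum>\<alpha>\<in>A. single \<alpha> (lookup f \<alpha>))) =
      const (if same then of_nat l else 0) * (\<Sum>\<alpha>\<in>A. single \<alpha> (lookup f \<alpha>))"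
    if "finite A" "A \<subseteq> keys f" for A
    using that
  proof induction
    case (insert \<alpha> A)
    then show ?case
      using one[of \<alpha>] assms(2)[of \<alpha>] by (simp add: ss_add[OF assms(1)] distrib_left)
  qed (simp add: zero)
  from this[of "keys f"] show ?thesis by (simp only: sum_single_keys finite_keys subset_refl)
qed

text \<open>Relations of a degenerate affine Hecke algebra: the exchange carries the order-dependent
  sums of z_i and z_(i+1) into each other up to the single term for the pair (i, i + 1).\<close>

lemma swap_z:
  assumes "1 \<le> i" "i < n"
  defines "s \<equiv> transpose i (Suc i)"
  shows "pact s (dunkl_z n l \<zeta> c i f) = dunkl_z n l \<zeta> c (Suc i) (pact s f) - const c * ss i (Suc i) (pact s f)"
    and "pact s (dunkl_z n l \<zeta> c (Suc i) f) = dunkl_z n l \<zeta> c i (pact s f) + const c * ss i (Suc i) (pact s f)"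
    and "a \<notin> {i, Suc i} \<Longrightarrow> pact s (dunkl_z n l \<zeta> c a f) = dunkl_z n l \<zeta> c a (pact s f)"
proof -
  have p: "s permutes {1..n}" unfolding s_def by (rule permutes_swap_id) (use assms in auto)
  then have b: "bij s" by (rule permutes_bij)
  have s: "s i = Suc i" "s (Suc i) = i" by (simp_all add: s_def)
  have push: "pact s (dunkl_z n l \<zeta> c a f) = zz n c (s a) (pact s f) + const c * (\<Sum>j\<in>{1..<a}. ss (s a) (s j) (pact s f))" for a
  proof -
    have "(\<Sum>j\<in>{1..<a}. pact s (ss a j f)) = (\<Sum>j\<in>{1..<a}. ss (s a) (s j) (pact s f))"
      by (rule sum.cong[OF refl], rule pact_ss[OF b]) auto
    then show ?thesis unfolding dunkl_z_zz by (simp add: pact_zz[OF p] pact_sum)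
  qed
  have fix_s: "s j = j" if "j \<notin> {i, Suc i}" for j using that by (simp add: s_def)
  have low: "(\<Sum>j\<in>{1..<i}. ss b (s j) g) = (\<Sum>j\<in>{1..<i}. ss b j g)" for b g
    by (rule sum.cong[OF refl]) (simp add: fix_s)
  have "{1..<Suc i} = insert i {1..<i}" using assms by auto
  then have split: "(\<Sum>j\<in>{1..<Suc i}. h j) = h i + (\<Sum>j\<in>{1..<i}. h j)" for h :: "nat \<Rightarrow> 'a mpoly"
    by simp
  show "pact s (dunkl_z n l \<zeta> c i f) = dunkl_z n l \<zeta> c (Suc i) (pact s f) - const c * ss i (Suc i) (pact s f)"
    unfolding push s low unfolding dunkl_z_zz split ss_sym[of i "Suc i", simplified] by (simp add: distrib_left)
  show "pact s (dunkl_z n l \<zeta> c (Suc i) f) = dunkl_z n l \<zeta> c i (pact s f) + const c * ss i (Suc i) (pact s f)"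
    unfolding push s split low unfolding dunkl_z_zz by (simp add: distrib_left)
  assume a: "a \<notin> {i, Suc i}"
  have "(\<Sum>j\<in>{1..<a}. ss a (s j) (pact s f)) = (\<Sum>j\<in>{1..<a}. ss a j (pact s f))"
  proof (cases "a < i")
    case True
    then show ?thesis by (intro sum.cong refl) (simp add: fix_s)
  next
    case False
    then have "s permutes {1..<a}"
      unfolding s_def using a assms by (intro permutes_swap_id) auto
    then show ?thesis using sum.permute[of s "{1..<a}" "\<lambda>j. ss a j (pact s f)"] by (simp add: comp_def)
  qed
  then show "pact s (dunkl_z n l \<zeta> c a f) = dunkl_z n l \<zeta> c a (pact s f)"
    unfolding push fix_s[OF a] unfolding dunkl_z_zz by simp
qed

section \<open>Multiplication by the last variable and the raising operator\<close>

lemma dd_var_other: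
  "i \<noteq> j \<Longrightarrow> t \<noteq> i \<Longrightarrow> t \<noteq> j \<Longrightarrow> dd i j r (var t * f) = var t * dd i j r f"
  by (rule dd_eqI) (simp_all add: mult.assoc dd_mult refl_act_subst refl_map_def right_diff_distrib)

lemma zeta_cancel: "const (\<zeta> ^ r) * const (inverse (\<zeta> ^ r)) = (1 :: 'a mpoly)"
  by (simp flip: const_mult)

text \<open>The reflection fixes x_i x_j, so moving x_j out of the quotient costs only one reflected
  copy of f.\<close>

lemma dd_var_right:
  assumes "i \<noteq> j"
  shows "dd i j r (var i * (var j * f)) = var j * dd i j r (var i * f) - var j * refl_act \<zeta> i j r f"
proof (rule dd_eqI[OF assms])
  let ?s = "refl_act \<zeta> i j r f"
  let ?z = "const (\<zeta> ^ r) :: 'a mpoly"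
  have R: "refl_act \<zeta> i j r (var i * f) = ?z * var j * ?s"
    "refl_act \<zeta> i j r (var i * (var j * f)) = (?z * const (inverse (\<zeta> ^ r))) * (var i * var j * ?s)"
    using assms by (simp_all add: refl_act_subst refl_map_def)
  have "(var j * dd i j r (var i * f) - var j * ?s) * lin i j r =
    var j * (dd i j r (var i * f) * lin i j r) - var j * ?s * lin i j r"
    by (simp only: left_diff_distrib mult.assoc)
  also have "\<dots> = var j * (var i * f - ?z * var j * ?s) - var j * ?s * lin i j r"
    unfolding dd_mult[OF assms] R ..
  finally show "(var j * dd i j r (var i * f) - var j * ?s) * lin i j r =
      var i * (var j * f) - refl_act \<zeta> i j r (var i * (var j * f))"
    unfolding R(2) zeta_cancel lin_def by (simp add: algebra_simps)
qed

lemma dd_var_left: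
  assumes "i \<noteq> j"
  shows "dd i j r (var i * (var i * f)) = var i * dd i j r (var i * f) + refl_act \<zeta> i j r (var i * f)"
proof (rule dd_eqI[OF assms])
  let ?s = "refl_act \<zeta> i j r f"
  let ?z = "const (\<zeta> ^ r) :: 'a mpoly"
  have R: "refl_act \<zeta> i j r (var i * f) = ?z * var j * ?s"
    "refl_act \<zeta> i j r (var i * (var i * f)) = ?z * var j * (?z * var j * ?s)"
    using assms by (simp_all add: refl_act_subst refl_map_def)
  have "(var i * dd i j r (var i * f) + refl_act \<zeta> i j r (var i * f)) * lin i j r =
    var i * (dd i j r (var i * f) * lin i j r) + refl_act \<zeta> i j r (var i * f) * lin i j r"
    by (simp only: distrib_right mult.assoc)
  also have "\<dots> = var i * (var i * f - ?z * var j * ?s) + ?z * var j * ?s * lin i j r"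
    unfolding dd_mult[OF assms] R ..
  finally show "(var i * dd i j r (var i * f) + refl_act \<zeta> i j r (var i * f)) * lin i j r =
      var i * (var i * f) - refl_act \<zeta> i j r (var i * (var i * f))"
    unfolding R(2) lin_def by (simp add: algebra_simps)
qed

lemma zz_var_n:
  assumes "1 \<le> i" "i < n"
  shows "zz n c i (var n * g) = var n * zz n c i g + const c * (var n * ss i n g)"
proof -
  have rem: "(\<Sum>j\<in>{1..n} - {i}. h j) = h n + (\<Sum>j\<in>{1..n} - {i} - {n}. h j)" for h :: "nat \<Rightarrow> 'a mpoly"
    by (rule sum.remove) (use assms in auto)
  have other: "(\<Sum>j\<in>{1..n} - {i} - {n}. \<Sum>r<l. dd i j r (var i * (var n * g))) =
      var n * (\<Sum>j\<in>{1..n} - {i} - {n}. \<Sum>r<l. dd i j r (var i * g))"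
    unfolding sum_distrib_left
  proof (intro sum.cong refl)
    fix j r assume "j \<in> {1..n} - {i} - {n}"
    then show "dd i j r (var i * (var n * g)) = var n * dd i j r (var i * g)"
      using dd_var_other[of i j n r "var i * g"] assms by (simp add: mult.left_commute)
  qed
  have "(\<Sum>r<l. dd i n r (var i * (var n * g))) = var n * (\<Sum>r<l. dd i n r (var i * g)) - var n * ss i n g"
    using assms by (simp add: dd_var_right sum_subtractf sum_distrib_left ss_def)
  then have "(\<Sum>j\<in>{1..n} - {i}. \<Sum>r<l. dd i j r (var i * (var n * g))) =
      var n * (\<Sum>j\<in>{1..n} - {i}. \<Sum>r<l. dd i j r (var i * g)) - var n * ss i n g"
    unfolding rem other by (simp add: distrib_left)
  moreover have "partial_deriv i (var i * (var n * g)) = var n * partial_deriv i (var i * g)"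
    using assms by (simp add: euler_var)
  ultimately show ?thesis
    unfolding zz_def by (simp only:) (simp only: right_diff_distrib distrib_left mult.left_commute, simp)
qed

lemma zz_var_self:
  "zz n c n (var n * g) = var n * zz n c n g + var n * g - const c * (\<Sum>j\<in>{1..<n}. ss n j (var n * g))"
proof -
  have "(\<Sum>j\<in>{1..n} - {n}. \<Sum>r<l. dd n j r (var n * (var n * g))) =
      (\<Sum>j\<in>{1..n} - {n}. var n * (\<Sum>r<l. dd n j r (var n * g)) + ss n j (var n * g))"
    by (intro sum.cong refl) (simp add: dd_var_left sum.distrib sum_distrib_left ss_def)
  also have "\<dots> = var n * (\<Sum>j\<in>{1..n} - {n}. \<Sum>r<l. dd n j r (var n * g)) + (\<Sum>j\<in>{1..n} - {n}. ss n j (var n * g))"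
    by (simp add: sum.distrib sum_distrib_left)
  also have "{1..n} - {n} = {1..<n}" by auto
  finally show ?thesis
    unfolding zz_def using \<open>{1..n} - {n} = {1..<n}\<close>
    by (simp only: euler_var if_True) (simp add: algebra_simps)
qed

text \<open>\<open>pact (cyc n)\<close> turns f(x_1, ..., x_n) into f(x_n, x_1, ..., x_(n-1)); the
  entry of an exponent at position 1 moves to position n.\<close>

definition cyc :: "nat \<Rightarrow> nat \<Rightarrow> nat" where
  "cyc n t = (if t = 1 then n else if t \<in> {2..n} then t - 1 else t)"

definition cyc_inv :: "nat \<Rightarrow> nat \<Rightarrow> nat" where
  "cyc_inv n t = (if t = n then 1 else if t \<in> {1..<n} then Suc t else t)"

lemma cyc_permutes: "n \<ge> 1 \<Longrightarrow> cyc n permutes {1..n}"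
proof (rule bij_imp_permutes)
  assume "n \<ge> 1"
  then show "bij_betw (cyc n) {1..n} {1..n}"
    by (intro bij_betw_byWitness[where f' = "cyc_inv n"]) (auto simp: cyc_def cyc_inv_def)
  show "cyc n x = x" if "x \<notin> {1..n}" for x
    using that \<open>n \<ge> 1\<close> by (auto simp: cyc_def)
qed

text \<open>The raising operator of Knop and Sahi.\<close>

definition phi :: "nat \<Rightarrow> 'a mpoly \<Rightarrow> 'a mpoly" where
  "phi n f = var n * pact (cyc n) f"

text \<open>The cycle sends the reflections for the pair (i + 1, 1) to those for (i, n), which are
  just the error term of \<open>zz_var_n\<close>; the other pairs are shifted by one.\<close>

lemma phi_z:
  assumes "1 \<le> i" "i < n"
  shows "dunkl_z n l \<zeta> c i (phi n f) = phi n (dunkl_z n l \<zeta> c (Suc i) f)"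
proof -
  have n: "n \<ge> 1" using assms by simp
  have p: "cyc n permutes {1..n}" by (rule cyc_permutes[OF n])
  have b: "bij (cyc n)" by (rule permutes_bij[OF p])
  let ?g = "pact (cyc n) f"
  have c: "cyc n (Suc i) = i" using assms by (simp add: cyc_def)
  have first: "(\<Sum>j\<in>{1..<Suc i}. h j) = h 1 + (\<Sum>j\<in>{1..<i}. h (Suc j))" for h :: "nat \<Rightarrow> 'a mpoly"
    using sum.atLeast_Suc_lessThan[of 1 "Suc i" h] assms(1) sum.shift_bounds_Suc_ivl[of h 1 i] by simp
  have "pact (cyc n) (\<Sum>j\<in>{1..<Suc i}. ss (Suc i) j f) = (\<Sum>j\<in>{1..<Suc i}. ss i (cyc n j) ?g)"
    unfolding pact_sum
  proof (rule sum.cong[OF refl])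
    fix j assume "j \<in> {1..<Suc i}"
    then show "pact (cyc n) (ss (Suc i) j f) = ss i (cyc n j) ?g"
      using pact_ss[OF b, of "Suc i" j f] c by simp
  qed
  also have "\<dots> = ss i n ?g + (\<Sum>j\<in>{1..<i}. ss i (cyc n (Suc j)) ?g)"
    unfolding first by (simp add: cyc_def)
  also have "(\<Sum>j\<in>{1..<i}. ss i (cyc n (Suc j)) ?g) = (\<Sum>j\<in>{1..<i}. ss i j ?g)"
    by (rule sum.cong[OF refl]) (use assms in \<open>auto simp: cyc_def\<close>)
  finally have R: "phi n (dunkl_z n l \<zeta> c (Suc i) f) =
      var n * zz n c i ?g + const c * (var n * (ss i n ?g + (\<Sum>j\<in>{1..<i}. ss i j ?g)))"
    unfolding phi_def dunkl_z_zz pact_add pact_mult pact_zz[OF p] c pact_const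
    by (simp only: distrib_left mult.left_commute)
  have "(\<Sum>j\<in>{1..<i}. ss i j (var n * ?g)) = var n * (\<Sum>j\<in>{1..<i}. ss i j ?g)"
    unfolding sum_distrib_left
  proof (rule sum.cong[OF refl])
    fix j assume "j \<in> {1..<i}"
    then show "ss i j (var n * ?g) = var n * ss i j ?g"
      using assms by (simp add: ss_def refl_act_subst refl_map_def sum_distrib_left)
  qed
  then show ?thesis
    unfolding R unfolding phi_def dunkl_z_zz zz_var_n[OF assms] by (simp only: distrib_left mult.left_commute add.assoc)
qed

text \<open>The reflections in z_n cancel the error term of \<open>zz_var_self\<close>. For z_1 the
  ordered sum is empty, and the derivative leaves the summand f.\<close>

lemma phi_z_last:
  assumes "n \<ge> 1"
  shows "dunkl_z n l \<zeta> c n (phi n f) = phi n (dunkl_z n l \<zeta> c 1 f + f)"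
proof -
  have p: "cyc n permutes {1..n}" by (rule cyc_permutes[OF assms])
  have "cyc n 1 = n" by (simp add: cyc_def)
  then show ?thesis
    unfolding phi_def dunkl_z_zz zz_var_self pact_add pact_zz[OF p] by (simp add: distrib_left)
qed

section \<open>Existence of joint eigenvectors for generic parameter\<close>

text \<open>The exponents on whose monomials each \<zeta>_i acts as on x^\<mu>: the eigenvalue
  conditions for the \<zeta>_i become a condition on the support.\<close>

definition resid :: "nat \<Rightarrow> (nat \<Rightarrow>\<^sub>0 nat) \<Rightarrow> (nat \<Rightarrow>\<^sub>0 nat) set" where
  "resid n \<mu> = {\<alpha> \<in> compositions n. \<forall>i\<in>{1..n}. lookup \<alpha> i mod l = lookup \<mu> i mod l}"

text \<open>No normalization is included and 0 qualifies, so existence is stated for nonzero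
  vectors, and the coefficient at \<mu> has to be shown nonzero separately.\<close>

definition eigenvec :: "nat \<Rightarrow> 'a \<Rightarrow> (nat \<Rightarrow>\<^sub>0 nat) \<Rightarrow> 'a mpoly \<Rightarrow> bool" where
  "eigenvec n c \<mu> f \<longleftrightarrow> keys f \<subseteq> resid n \<mu> \<and>
     (\<forall>i\<in>{1..n}. dunkl_z n l \<zeta> c i f = const (wt n l c \<mu> i) * f)"

lemma rk_permute:
  assumes p: "\<pi> permutes {1..n}"
    and below: "\<And>j. j \<in> {1..n} \<Longrightarrow>
      (lookup \<mu> (\<pi> j) < lookup \<mu> (\<pi> a) \<or> lookup \<mu> (\<pi> j) = lookup \<mu> (\<pi> a) \<and> \<pi> a < \<pi> j) \<longleftrightarrow>
      (lookup \<nu> j < lookup \<nu> a \<or> lookup \<nu> j = lookup \<nu> a \<and> a < j)"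
  shows "rk n \<mu> (\<pi> a) = rk n \<nu> a"
proof -
  let ?R = "{j \<in> {1..n}. lookup \<nu> j < lookup \<nu> a \<or> lookup \<nu> j = lookup \<nu> a \<and> a < j}"
  have b: "bij \<pi>" by (rule permutes_bij[OF p])
  have "{j \<in> {1..n}. lookup \<mu> j < lookup \<mu> (\<pi> a) \<or> lookup \<mu> j = lookup \<mu> (\<pi> a) \<and> \<pi> a < j} = \<pi> ` ?R"
    (is "?L = _")
  proof (intro equalityI subsetI)
    fix x assume x: "x \<in> ?L"
    then obtain j where j: "j \<in> {1..n}" "x = \<pi> j"
      using permutes_image[OF p] by blast
    then show "x \<in> \<pi> ` ?R" using x below[OF j(1)] by blast
  next
    fix x assume "x \<in> \<pi> ` ?R"
    then obtain j where j: "x = \<pi> j" "j \<in> ?R" by blast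
    then have "x \<in> {1..n}" using permutes_in_image[OF p, of j] by simp
    then show "x \<in> ?L" using j below[of j] by blast
  qed
  then show ?thesis
    unfolding rk_def using card_image[OF inj_on_subset[OF bij_is_inj[OF b] subset_UNIV], of ?R] by simp
qed

text \<open>Positions i and i + 1 carry different entries, so the exchange never changes the
  relative order of two equal entries.\<close>

lemma rk_swap:
  assumes "1 \<le> i" "i < n" "lookup \<nu> i \<noteq> lookup \<nu> (Suc i)"
  defines "s \<equiv> transpose i (Suc i)"
  shows "rk n (permc s \<nu>) (s a) = rk n \<nu> a"
proof (rule rk_permute)
  show p: "s permutes {1..n}" unfolding s_def by (rule permutes_swap_id) (use assms in auto)
  have tie: "lookup \<nu> j = lookup \<nu> a \<Longrightarrow> s a < s j \<longleftrightarrow> a < j" for j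
    using assms(3) by (auto simp: s_def transpose_def)
  show "(lookup (permc s \<nu>) (s j) < lookup (permc s \<nu>) (s a) \<or>
      lookup (permc s \<nu>) (s j) = lookup (permc s \<nu>) (s a) \<and> s a < s j) \<longleftrightarrow>
      (lookup \<nu> j < lookup \<nu> a \<or> lookup \<nu> j = lookup \<nu> a \<and> a < j)" for j
    using tie[of j] by (auto simp: permutes_bij[OF p])
qed

text \<open>The intertwiner is s + a with a scalar a. The hypothesis on \<open>c\<close> makes 1 and
  \<open>c\<close> linearly independent over the integers; with distinct entries at i and i + 1 it
  keeps the denominator \<alpha> - \<beta> nonzero and a different from 1 and -1.\<close>

lemma eigenvec_swap:
  assumes gen: "\<And>a b :: int. of_int a + c * of_int b = 0 \<Longrightarrow> a = 0 \<and> b = 0"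
    and i: "1 \<le> i" "i < n" and lt: "lookup \<nu> i < lookup \<nu> (Suc i)"
    and f: "eigenvec n c \<nu> f" "f \<noteq> 0"
  shows "\<exists>g. g \<noteq> 0 \<and> eigenvec n c (permc (transpose i (Suc i)) \<nu>) g"
proof -
  define s where "s = transpose i (Suc i)"
  have p: "s permutes {1..n}" unfolding s_def by (rule permutes_swap_id) (use i in auto)
  then have b: "bij s" by (rule permutes_bij)
  have ss: "s i = Suc i" "s (Suc i) = i" "\<And>t. s (s t) = t" "\<And>t. t \<notin> {i, Suc i} \<Longrightarrow> s t = t"
    by (auto simp: s_def)
  have wt: "wt n l c (permc s \<nu>) (s a) = wt n l c \<nu> a" for a
    using rk_swap[OF i, of \<nu> a] lt b by (simp add: wt_def s_def)
  define same where "same \<longleftrightarrow> lookup \<nu> i mod l = lookup \<nu> (Suc i) mod l"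
  define \<alpha> where "\<alpha> = wt n l c \<nu> i"
  define \<beta> where "\<beta> = wt n l c \<nu> (Suc i)"
  define d where "d = (if same then of_nat l else (0::'a))"
  \<comment> \<open>Chosen so that in z_i g and z_(i+1) g the reflection term c d corrects the
    eigenvalue on the summand a f to the one on s f.\<close>
  define a where "a = c * d / (\<alpha> - \<beta>)"
  define g where "g = pact s f + const a * f"
  let ?D = "int (lookup \<nu> i) - int (lookup \<nu> (Suc i))"
  let ?R = "int (rk n \<nu> i) - int (rk n \<nu> (Suc i))"
  have ab: "\<alpha> - \<beta> = of_int ?D + c * of_int (- int l * ?R)"
    by (simp add: \<alpha>_def \<beta>_def wt_def algebra_simps)
  have ne: "of_int ?D + c * of_int e \<noteq> 0" for e
    using gen[of ?D e] lt by auto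
  have nz: "\<alpha> - \<beta> \<noteq> 0" unfolding ab by (rule ne)
  have key: "a * \<alpha> - c * d = a * \<beta>" using nz by (simp add: a_def field_simps)
  have a2: "a * a \<noteq> 1"
  proof
    assume "a * a = 1"
    then have "a = 1 \<or> a = -1" by (simp add: square_eq_1_iff)
    then have "c * d = \<alpha> - \<beta> \<or> c * d = - (\<alpha> - \<beta>)" using nz by (auto simp: a_def field_simps)
    moreover have "d = of_int (if same then int l else 0)" by (simp add: d_def)
    ultimately have "of_int ?D + c * of_int (- int l * ?R - (if same then int l else 0)) = 0 \<or>
       of_int ?D + c * of_int (- int l * ?R + (if same then int l else 0)) = 0"
      unfolding ab by (auto simp: algebra_simps)
    then show False using ne by blast
  qed
  have feig: "dunkl_z n l \<zeta> c t f = const (wt n l c \<nu> t) * f" if "t \<in> {1..n}" for t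
    using f(1) that by (simp add: eigenvec_def)
  have fres: "\<gamma> \<in> resid n \<nu>" if "\<gamma> \<in> keys f" for \<gamma> using f(1) that by (auto simp: eigenvec_def)
  have ssf: "ss i (Suc i) (pact s f) = const d * f"
    unfolding s_def d_def
  proof (rule ss_swap)
    fix \<gamma> assume "\<gamma> \<in> keys f"
    from fres[OF this] show "(lookup \<gamma> i mod l = lookup \<gamma> (Suc i) mod l) = same"
      using i by (simp add: resid_def same_def)
  qed simp
  have zg: "dunkl_z n l \<zeta> c t g = dunkl_z n l \<zeta> c t (pact s f) + const a * (const (wt n l c \<nu> t) * f)"
    if "t \<in> {1..n}" for t
    unfolding g_def dunkl_z_add[OF that] dunkl_z_const[OF that] feig[OF that] ..
  have eig: "dunkl_z n l \<zeta> c t g = const (wt n l c (permc s \<nu>) t) * g" if t: "t \<in> {1..n}" for t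
  proof -
    consider "t = i" | "t = Suc i" | "t \<notin> {i, Suc i}" by blast
    then show ?thesis
    proof cases
      case 1
      have "dunkl_z n l \<zeta> c i (pact s f) = pact s (dunkl_z n l \<zeta> c (Suc i) f) - const c * (const d * f)"
        using swap_z(2)[OF i, of c f] ssf unfolding s_def by simp
      also have "\<dots> = const \<beta> * pact s f - const (c * d) * f"
        using feig[of "Suc i"] i by (simp add: \<beta>_def const_mult)
      finally have "dunkl_z n l \<zeta> c t g = const \<beta> * pact s f + const (a * \<alpha> - c * d) * f"
        unfolding zg[OF t] unfolding 1 \<alpha>_def[symmetric]
        by (simp add: const_mult const_diff algebra_simps)
      then show ?thesis unfolding key using wt[of "Suc i"] 1 ss
        by (simp add: g_def \<beta>_def const_mult algebra_simps)
    next
      case 2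
      have "dunkl_z n l \<zeta> c (Suc i) (pact s f) = pact s (dunkl_z n l \<zeta> c i f) + const c * (const d * f)"
        using swap_z(1)[OF i, of c f] ssf unfolding s_def by simp
      also have "\<dots> = const \<alpha> * pact s f + const (c * d) * f"
        using feig[of i] i by (simp add: \<alpha>_def const_mult)
      finally have "dunkl_z n l \<zeta> c t g = const \<alpha> * pact s f + const (a * \<beta> + c * d) * f"
        unfolding zg[OF t] unfolding 2 \<beta>_def[symmetric]
        by (simp add: const_mult const_add algebra_simps)
      moreover have "a * \<beta> + c * d = a * \<alpha>" using key by (simp add: algebra_simps)
      ultimately show ?thesis using wt[of i] 2 ss
        by (simp add: g_def \<alpha>_def const_mult algebra_simps)
    next
      case 3
      have "dunkl_z n l \<zeta> c t (pact s f) = const (wt n l c \<nu> t) * pact s f"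
        using swap_z(3)[OF i 3, of c f] feig[OF t] unfolding s_def by simp
      then show ?thesis using zg[OF t] wt[of t] ss(4)[OF 3]
        by (simp add: g_def algebra_simps)
    qed
  qed
  \<comment> \<open>If g = 0, then f is an eigenvector of the involution s with eigenvalue -a,
    forcing a^2 = 1.\<close>
  have "g \<noteq> 0"
  proof
    assume "g = 0"
    then have 1: "pact s f = const (- a) * f" by (simp add: g_def const_uminus eq_neg_iff_add_eq_0)
    have e1: "pact s (pact s f) = f" unfolding pact_pact by (simp add: comp_def ss)
    have e2: "pact s (pact s f) = const (- a) * (const (- a) * f)" unfolding 1 pact_mult pact_const 1 ..
    have "const (a * a) = const (- a) * (const (- a) :: 'a mpoly)" unfolding const_mult[symmetric] by simp
    then have "const (a * a) * f = f" using e1 e2 by (simp only: mult.assoc)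
    then have e: "const (a * a) * f - f = 0" by (simp only: diff_self)
    have "const (a * a - 1) * f = const (a * a) * f - f" by (simp add: const_diff left_diff_distrib)
    also note e
    finally have "const (a * a - 1) * f = 0" .
    then have "const (a * a - 1) = (const 0 :: 'a mpoly)" using f(2) by simp
    then show False using a2 unfolding const_inj by simp
  qed
  moreover have ls: "lookup (permc s \<gamma>) t = lookup \<gamma> (s t)" for \<gamma> t
    using lookup_permc_image[OF b, of \<gamma> "s t"] ss(3) by simp
  moreover have "keys g \<subseteq> resid n (permc s \<nu>)"
  proof
    fix \<gamma> assume "\<gamma> \<in> keys g"
    then consider "\<gamma> \<in> keys (pact s f)" | "a \<noteq> 0" "\<gamma> \<in> keys f"
      unfolding g_def in_keys_iff lookup_add lookup_const_mult by fastforce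
    then show "\<gamma> \<in> resid n (permc s \<nu>)"
    proof cases
      case 1
      then obtain \<delta> where d: "\<delta> \<in> keys f" "\<gamma> = permc s \<delta>" by (rule keys_pact[OF b])
      have "lookup (permc s \<delta>) t mod l = lookup (permc s \<nu>) t mod l" if "t \<in> {1..n}" for t
        using fres[OF d(1)] that permutes_in_image[OF p, of t] by (simp add: resid_def ls)
      then show ?thesis using fres[OF d(1)] permc_composition[OF p] d(2) by (simp add: resid_def)
    next
      case 2
      \<comment> \<open>A nonzero \<open>a\<close> means that \<nu>_i and \<nu>_(i+1) are congruent
        modulo l, so the exponents of f itself also have the exchanged residues.\<close>
      then have same by (cases same) (auto simp: a_def d_def)
      have "lookup \<gamma> t mod l = lookup (permc s \<nu>) t mod l" if t: "t \<in> {1..n}" for t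
      proof -
        have "lookup \<nu> (s t) mod l = lookup \<nu> t mod l"
          using \<open>same\<close> ss by (cases "t = i"; cases "t = Suc i") (auto simp: same_def)
        then show ?thesis using fres[OF 2(2)] t by (simp add: resid_def ls)
      qed
      then show ?thesis using fres[OF 2(2)] by (simp add: resid_def)
    qed
  qed
  ultimately show ?thesis using eig unfolding eigenvec_def s_def by blast
qed

text \<open>Moving the first entry to the end and adding 1 keeps every rank: among equal entries the
  first position ranks highest, and after the move it ranks lowest among the entries one
  larger.\<close>

lemma eigenvec_phi:
  assumes n: "n \<ge> 1" and f: "eigenvec n c \<nu> f" "f \<noteq> 0"
  shows "\<exists>g. g \<noteq> 0 \<and> eigenvec n c (single n 1 + permc (cyc n) \<nu>) g"
proof -
  define \<mu> where "\<mu> = single n 1 + permc (cyc n) \<nu>"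
  have p: "cyc n permutes {1..n}" by (rule cyc_permutes[OF n])
  have b: "bij (cyc n)" by (rule permutes_bij[OF p])
  have cn: "cyc n j = n \<longleftrightarrow> j = 1" if "j \<in> {1..n}" for j using that by (auto simp: cyc_def)
  have lk: "lookup (single n 1 + permc (cyc n) \<gamma>) (cyc n j) = (if j = 1 then 1 else 0) + lookup \<gamma> j"
    if "j \<in> {1..n}" for j \<gamma>
    using cn[OF that] by (simp add: lookup_add lookup_single when_def b eq_commute)
  have rk: "rk n \<mu> (cyc n a) = rk n \<nu> a" if a: "a \<in> {1..n}" for a
  proof (rule rk_permute[OF p])
    fix j assume j: "j \<in> {1..n}"
    have "cyc n a < cyc n j \<longleftrightarrow> (if a = 1 then False else if j = 1 then True else a < j)"
      using a j by (auto simp: cyc_def)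
    then show "(lookup \<mu> (cyc n j) < lookup \<mu> (cyc n a) \<or>
        lookup \<mu> (cyc n j) = lookup \<mu> (cyc n a) \<and> cyc n a < cyc n j) \<longleftrightarrow>
        (lookup \<nu> j < lookup \<nu> a \<or> lookup \<nu> j = lookup \<nu> a \<and> a < j)"
      using a j unfolding \<mu>_def lk[OF a] lk[OF j] by auto
  qed
  have feig: "dunkl_z n l \<zeta> c t f = const (wt n l c \<nu> t) * f" if "t \<in> {1..n}" for t
    using f(1) that by (simp add: eigenvec_def)
  have "dunkl_z n l \<zeta> c i (phi n f) = const (wt n l c \<mu> i) * phi n f" if i: "i \<in> {1..n}" for i
  proof (cases "i = n")
    case True
    have 1: "1 \<in> {1..n}" "cyc n 1 = n" using n by (auto simp: cyc_def)
    have "wt n l c \<mu> n = wt n l c \<nu> 1 + 1"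
      using rk[OF 1(1)] lk[OF 1(1), of \<nu>] unfolding 1(2) by (simp add: wt_def \<mu>_def)
    moreover have "dunkl_z n l \<zeta> c n (phi n f) = phi n (const (wt n l c \<nu> 1) * f + f)"
      unfolding phi_z_last[OF n] feig[OF 1(1)] ..
    ultimately show ?thesis using True
      by (simp add: phi_def const_add algebra_simps)
  next
    case False
    then have i': "1 \<le> i" "i < n" "Suc i \<in> {1..n}" "cyc n (Suc i) = i" using i by (auto simp: cyc_def)
    have "wt n l c \<mu> i = wt n l c \<nu> (Suc i)"
      using rk[OF i'(3)] lk[OF i'(3), of \<nu>] i'(1) unfolding i'(4) by (simp add: wt_def \<mu>_def)
    then show ?thesis
      unfolding phi_z[OF i'(1,2)] feig[OF i'(3)] by (simp add: phi_def mult.left_commute)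
  qed
  moreover have "keys (phi n f) \<subseteq> resid n \<mu>"
  proof
    fix \<gamma> assume "\<gamma> \<in> keys (phi n f)"
    then obtain \<delta> where d: "\<gamma> = single n 1 + \<delta>" "\<delta> \<in> keys (pact (cyc n) f)"
      using keys_mult[of "var n" "pact (cyc n) f"] by (auto simp: phi_def var_def split: if_splits)
    obtain \<alpha> where al: "\<alpha> \<in> keys f" "\<delta> = permc (cyc n) \<alpha>" by (rule keys_pact[OF b d(2)])
    have ar: "\<alpha> \<in> resid n \<nu>" using f(1) al(1) by (auto simp: eigenvec_def)
    then have "\<gamma> \<in> compositions n"
      unfolding d(1) al(2) using n
      by (intro compositions_add permc_composition[OF p]) (auto simp: resid_def compositions_def)
    moreover have "lookup \<gamma> i mod l = lookup \<mu> i mod l" if "i \<in> {1..n}" for i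
    proof -
      have "i \<in> cyc n ` {1..n}" using that permutes_image[OF p] by simp
      then obtain j where j: "j \<in> {1..n}" "i = cyc n j" by blast
      have "lookup \<alpha> j mod l = lookup \<nu> j mod l" using ar j(1) by (simp add: resid_def)
      then have "(e + lookup \<alpha> j) mod l = (e + lookup \<nu> j) mod l" for e by (metis mod_add_right_eq)
      then show ?thesis unfolding j(2) d(1) al(2) \<mu>_def lk[OF j(1)] .
    qed
    ultimately show "\<gamma> \<in> resid n \<mu>" by (simp add: resid_def)
  qed
  moreover have "phi n f \<noteq> 0"
  proof
    assume "phi n f = 0"
    moreover have "(var n :: 'a mpoly) \<noteq> 0"
      by (metis var_def keys_single keys_zero insert_not_empty zero_neq_one)
    ultimately have "pact (cyc n) f = 0" by (simp add: phi_def)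
    then have "pact (inv (cyc n)) (pact (cyc n) f) = 0" by simp
    then have "f = 0" unfolding pact_pact inv_o_cancel[OF bij_is_inj[OF b]] by (simp add: id_def)
    then show False using f(2) by simp
  qed
  ultimately show ?thesis unfolding eigenvec_def \<mu>_def by blast
qed

text \<open>Every divided difference of x_i is 1 and the reflections fix 1, so the two cancel for j
  < i, and each j > i leaves a term l. This agrees with the rank n - i in the zero
  composition.\<close>

lemma eigenvec_one: "eigenvec n c 0 1"
  unfolding eigenvec_def
proof (intro conjI ballI)
  show "keys (1 :: 'a mpoly) \<subseteq> resid n 0" by (simp add: resid_def compositions_def)
  fix i assume i: "i \<in> {1..n}"
  have dd: "dd i j r (var i * 1) = 1" if "i \<noteq> j" for j r
    using that by (intro dd_eqI) (simp_all add: refl_act_subst refl_map_def lin_def)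
  have rf: "refl_act \<zeta> i j r 1 = 1" if "i \<noteq> j" for j r
    using that by (simp add: refl_act_subst)
  have e: "partial_deriv i (var i * 1) = (1 :: 'a mpoly)"
    by (rule poly_mapping_eqI) (simp only: lookup_euler, simp add: lookup_one when_def)
  have rk: "rk n 0 i = card {i<..n}"
    unfolding rk_def by (rule arg_cong[where f = card]) auto
  have "(\<Sum>j\<in>{1..n} - {i}. (\<Sum>r<l. dd i j r (var i * 1)) - (if j < i then \<Sum>r<l. refl_act \<zeta> i j r 1 else 0))
    = (\<Sum>j\<in>{1..n} - {i}. if i < j then of_nat l else 0)"
  proof (intro sum.cong refl)
    fix j assume "j \<in> {1..n} - {i}"
    then have "i \<noteq> j" by auto
    then show "(\<Sum>r<l. dd i j r (var i * 1)) - (if j < i then \<Sum>r<l. refl_act \<zeta> i j r 1 else 0)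
      = (if i < j then of_nat l else (0 :: 'a mpoly))"
      by (auto simp: dd[unfolded mult_1_right] rf)
  qed
  also have "\<dots> = (\<Sum>j\<in>{i<..n}. of_nat l)"
    by (rule sum.mono_neutral_cong_right) (use i in auto)
  finally have 1: "dunkl_z n l \<zeta> c i 1 = 1 - const c * (of_nat (card {i<..n}) * of_nat l)"
    unfolding dunkl_z_eq[OF i] e by simp
  have 2: "(of_nat (card {i<..n}) * of_nat l :: 'a mpoly) = const (of_nat (card {i<..n}) * of_nat l)"
    by (simp add: const_def flip: of_nat_mult)
  have "wt n l c 0 i = 1 - c * (of_nat (card {i<..n}) * of_nat l)"
    by (simp add: wt_def rk)
  then show "dunkl_z n l \<zeta> c i 1 = const (wt n l c 0 i) * 1"
    unfolding 1 2 by (simp only: const_diff const_mult const_1 mult_1_right)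
qed

text \<open>Every nonzero composition is reached from one of smaller degree: a positive entry is
  carried to the last position by adjacent exchanges with zeros, and there it is lowered by undoing
  the raising operator.\<close>

lemma eigenvec_exists:
  assumes gen: "\<And>a b :: int. of_int a + c * of_int b = 0 \<Longrightarrow> a = 0 \<and> b = 0"
    and "\<mu> \<in> compositions n"
  shows "\<exists>f. f \<noteq> 0 \<and> eigenvec n c \<mu> f"
  using assms(2)
proof (induction "\<Sum>j\<in>{1..n}. lookup \<mu> j" arbitrary: \<mu> rule: less_induct)
  case less
  have *: "\<exists>f. f \<noteq> 0 \<and> eigenvec n c \<nu> f"
    if "i + d = n" "1 \<le> i" "lookup \<nu> i > 0" "\<nu> \<in> compositions n"
      "(\<Sum>j\<in>{1..n}. lookup \<nu> j) = (\<Sum>j\<in>{1..n}. lookup \<mu> j)" for i d \<nu>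
    using that
  proof (induction d arbitrary: i \<nu>)
    case 0
    have "i = n" using 0(1) by simp
    then have n: "n \<ge> 1" and pos: "lookup \<nu> n > 0" using 0(2,3) by simp_all
    have p: "cyc n permutes {1..n}" by (rule cyc_permutes[OF n])
    have b: "bij (cyc n)" by (rule permutes_bij[OF p])
    define \<gamma> where "\<gamma> = permc (inv (cyc n)) (\<nu> - single n 1)"
    have eq: "\<nu> = single n 1 + permc (cyc n) \<gamma>"
      unfolding \<gamma>_def permc_permc_inv[OF b]
      by (rule poly_mapping_eqI) (use pos in \<open>auto simp: lookup_add lookup_minus lookup_single when_def\<close>)
    have "\<nu> - single n 1 \<in> compositions n"
      using 0(4) by (auto simp: compositions_def in_keys_iff lookup_minus subset_eq)
    then have comp: "\<gamma> \<in> compositions n"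
      unfolding \<gamma>_def by (rule permc_composition[OF permutes_inv[OF p]])
    have "(\<Sum>j\<in>{1..n}. lookup \<nu> j) = (\<Sum>j\<in>{1..n}. lookup (single n (1::nat)) j) + (\<Sum>j\<in>{1..n}. lookup (permc (cyc n) \<gamma>) j)"
      by (subst eq) (simp add: lookup_add sum.distrib)
    also have "(\<Sum>j\<in>{1..n}. lookup (single n (1::nat)) j) = 1"
      using n by (simp add: lookup_single when_def)
    also have "(\<Sum>j\<in>{1..n}. lookup (permc (cyc n) \<gamma>) j) = (\<Sum>j\<in>{1..n}. lookup \<gamma> j)"
      using sum.permute[OF p, of "lookup (permc (cyc n) \<gamma>)"] by (simp add: comp_def b)
    finally have "(\<Sum>j\<in>{1..n}. lookup \<gamma> j) < (\<Sum>j\<in>{1..n}. lookup \<mu> j)" using 0(5) by simp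
    from less.hyps[OF this comp] obtain f where "f \<noteq> 0" "eigenvec n c \<gamma> f" by blast
    then show ?case using eigenvec_phi[OF n, of c \<gamma> f] eq by metis
  next
    case (Suc d)
    have i: "1 \<le> i" "i < n" using Suc.prems by auto
    show ?case
    proof (cases "lookup \<nu> (Suc i) > 0")
      case True
      then show ?thesis using Suc.IH[of "Suc i" \<nu>] Suc.prems by auto
    next
      case False
      let ?s = "transpose i (Suc i)"
      have p: "?s permutes {1..n}" by (rule permutes_swap_id) (use i in auto)
      have b: "bij ?s" by simp
      define \<gamma> where "\<gamma> = permc ?s \<nu>"
      have lk: "lookup \<gamma> i = lookup \<nu> (Suc i)" "lookup \<gamma> (Suc i) = lookup \<nu> i"
        unfolding \<gamma>_def lookup_permc[OF b] by simp_all
      have eq: "permc ?s \<gamma> = \<nu>"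
        using permc_permc_inv[OF b, of \<nu>] by (simp add: \<gamma>_def)
      have "(\<Sum>j\<in>{1..n}. lookup \<gamma> j) = (\<Sum>j\<in>{1..n}. lookup \<nu> j)"
        using sum.permute[OF p, of "lookup \<gamma>"] lookup_permc_image[OF b, of \<nu>]
        by (simp add: comp_def \<gamma>_def)
      then have "\<exists>f. f \<noteq> 0 \<and> eigenvec n c \<gamma> f"
        using Suc.IH[of "Suc i" \<gamma>] Suc.prems lk permc_composition[OF p, of \<nu>] by (simp add: \<gamma>_def)
      then obtain f where f: "f \<noteq> 0" "eigenvec n c \<gamma> f" by blast
      have "lookup \<gamma> i < lookup \<gamma> (Suc i)" using lk False Suc.prems(3) by simp
      from eigenvec_swap[OF gen i this f(2,1)] show ?thesis unfolding eq .
    qed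
  qed
  show ?case
  proof (cases "\<mu> = 0")
    case True
    then show ?thesis using eigenvec_one[of n c] zero_neq_one by metis
  next
    case False
    then obtain i where "lookup \<mu> i \<noteq> 0" by (metis poly_mapping_eqI lookup_zero)
    then have "i \<in> {1..n}" "lookup \<mu> i > 0" using lookup_composition[OF less.prems, of i] by auto
    then show ?thesis using *[of i "n - i" \<mu>] less.prems by auto
  qed
qed

section \<open>Uniqueness of the joint eigenvector\<close>

lemma eigenvec_poly_ring: "eigenvec n c \<mu> f \<Longrightarrow> f \<in> poly_ring n"
  by (auto simp: eigenvec_def poly_ring_def resid_def)

lemma eigenvec_lead:
  assumes "eigenvec n c \<mu> f" "\<alpha> \<in> keys f" "\<And>\<nu>. \<nu> \<in> keys f \<Longrightarrow> psi n \<nu> \<le> psi n \<alpha>" "i \<in> {1..n}"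
  shows "wt n l c \<alpha> i = wt n l c \<mu> i"
proof -
  have "lookup (dunkl_z n l \<zeta> c i f) \<alpha> = wt n l c \<alpha> i * lookup f \<alpha>"
    by (rule dunkl_z_lead[OF assms(4) eigenvec_poly_ring[OF assms(1)] assms(3)])
  moreover have "lookup (dunkl_z n l \<zeta> c i f) \<alpha> = wt n l c \<mu> i * lookup f \<alpha>"
    using assms(1,4) by (simp add: eigenvec_def)
  ultimately have "wt n l c \<alpha> i * lookup f \<alpha> = wt n l c \<mu> i * lookup f \<alpha>"
    by (rule trans[OF sym])
  then show ?thesis using assms(2) by (simp add: in_keys_iff)
qed

lemma wt_generic_inj:
  assumes gen: "\<And>a b :: int. of_int a + c * of_int b = 0 \<Longrightarrow> a = 0 \<and> b = 0"
    and "wt n l c \<mu> i = wt n l c \<nu> i"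
  shows "lookup \<mu> i = lookup \<nu> i"
proof -
  have "of_int (int (lookup \<mu> i) - int (lookup \<nu> i)) +
      c * of_int (int l * (int (rk n \<nu> i) - int (rk n \<mu> i))) = 0"
    using assms(2) by (simp add: wt_def algebra_simps)
  then show ?thesis using gen by fastforce
qed

lemma diag_act_lookup: "lookup (diag_act i a f) \<alpha> = inverse a ^ lookup \<alpha> i * lookup f \<alpha>"
proof (induction f rule: mpoly_induct_single)
  case (single \<beta> d)
  let ?v = "\<lambda>t. if t = i then const (inverse a) * var i else (var t :: 'b::field mpoly)"
  have "monom_val ?v \<beta> = (\<Prod>t\<in>keys \<beta>. const (if t = i then inverse a ^ lookup \<beta> i else 1) * var t ^ lookup \<beta> t)"
    unfolding monom_val_def by (rule prod.cong) (auto simp: power_mult_distrib const_power)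
  also have "\<dots> = (\<Prod>t\<in>keys \<beta>. const (if t = i then inverse a ^ lookup \<beta> i else 1)) * monom_val var \<beta>"
    by (simp add: prod.distrib monom_val_def)
  also have "(\<Prod>t\<in>keys \<beta>. const (if t = i then inverse a ^ lookup \<beta> i else 1)) =
      (\<Prod>t\<in>keys \<beta>. if t = i then const (inverse a ^ lookup \<beta> i) else 1)"
    by (rule prod.cong) auto
  also have "\<dots> = const (inverse a ^ lookup \<beta> i)"
    by (simp add: prod.delta in_keys_iff)
  finally have "diag_act i a (single \<beta> d) = single \<beta> (d * inverse a ^ lookup \<beta> i)"
    unfolding diag_act_def subst_single monom_val_var
    by (simp add: const_mult_single)
  then show ?case by (simp add: lookup_single when_def)
qed (simp add: diag_act_def lookup_add distrib_left)

lemma is_jack_iff: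
  "is_jack n l \<zeta> c \<mu> f \<longleftrightarrow> eigenvec n c \<mu> f \<and> lookup f \<mu> = 1"
proof -
  have w: "of_nat (lookup \<mu> i) + 1 - of_nat l * c * (of_nat (sorting_perm n \<mu> i) - 1) = wt n l c \<mu> i"
    if "i \<in> {1..n}" for i
    using sorting_perm_rk(1)[OF that, of \<mu>] by (simp add: wt_def)
  have "diag_act i \<zeta> f = const (inverse \<zeta> ^ lookup \<mu> i) * f \<longleftrightarrow>
      (\<forall>\<alpha>\<in>keys f. lookup \<alpha> i mod l = lookup \<mu> i mod l)" for i
  proof -
    have "diag_act i \<zeta> f = const (inverse \<zeta> ^ lookup \<mu> i) * f \<longleftrightarrow>
        (\<forall>\<alpha>. lookup f \<alpha> \<noteq> 0 \<longrightarrow> inverse \<zeta> ^ lookup \<alpha> i = inverse \<zeta> ^ lookup \<mu> i)"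
      unfolding poly_mapping_eq_iff fun_eq_iff diag_act_lookup lookup_const_mult by auto
    then show ?thesis
      by (auto simp: in_keys_iff power_inverse simp flip: zeta_power_eq_iff)
  qed
  then show ?thesis
    unfolding is_jack_def eigenvec_def by (auto simp: w poly_ring_def resid_def)
qed

text \<open>The leading exponent of a nonzero eigenvector has the weight of \<mu>, which for generic
  \<open>c\<close> determines its entries, so the coefficient at \<mu> cannot vanish. The difference
  of two normalized eigenvectors has coefficient 0 there, hence is 0.\<close>

lemma generic_jack_unique:
  assumes gen: "\<And>a b :: int. of_int a + c * of_int b = 0 \<Longrightarrow> a = 0 \<and> b = 0"
    and \<mu>: "\<mu> \<in> compositions n"
  shows "\<exists>!f. is_jack n l \<zeta> c \<mu> f"
proof -
  have lead: "lookup f \<mu> \<noteq> 0" if f: "eigenvec n c \<mu> f" "f \<noteq> 0" for f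
  proof -
    obtain \<alpha> where a: "\<alpha> \<in> keys f" "\<And>\<nu>. \<nu> \<in> keys f \<Longrightarrow> psi n \<nu> \<le> psi n \<alpha>"
      using leading_exponent[OF f(2)] by blast
    have "\<alpha> \<in> compositions n" using a(1) eigenvec_poly_ring[OF f(1)] by (auto simp: poly_ring_def)
    then have "\<alpha> = \<mu>"
      by (rule composition_eqI[OF _ \<mu>]) (rule wt_generic_inj[OF gen eigenvec_lead[OF f(1) a]])
    then show ?thesis using a(1) by (simp add: in_keys_iff)
  qed
  obtain f where f: "f \<noteq> 0" "eigenvec n c \<mu> f" using eigenvec_exists[OF gen \<mu>] by blast
  have scale: "eigenvec n c \<mu> (const d * h)" if "eigenvec n c \<mu> h" for d h
    using that by (auto simp: eigenvec_def dunkl_z_const mult.left_commute in_keys_iff)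
  show ?thesis
  proof (rule ex1I)
    show "is_jack n l \<zeta> c \<mu> (const (inverse (lookup f \<mu>)) * f)"
      unfolding is_jack_iff using scale[OF f(2)] lead[OF f(2,1)] by simp
  next
    fix g assume g: "is_jack n l \<zeta> c \<mu> g"
    define h where "h = const (inverse (lookup f \<mu>)) * f"
    have h: "eigenvec n c \<mu> h" "lookup h \<mu> = 1"
      using scale[OF f(2)] lead[OF f(2,1)] by (auto simp: h_def)
    have g': "eigenvec n c \<mu> g" "lookup g \<mu> = 1" using g by (auto simp: is_jack_iff)
    define e where "e = g + const (- 1) * h"
    have "keys e \<subseteq> keys g \<union> keys h"
      unfolding e_def in_keys_iff subset_iff lookup_add lookup_const_mult Un_iff by fastforce
    moreover have "dunkl_z n l \<zeta> c i e = const (wt n l c \<mu> i) * e" if i: "i \<in> {1..n}" for i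
    proof -
      have "dunkl_z n l \<zeta> c i g = const (wt n l c \<mu> i) * g" "dunkl_z n l \<zeta> c i h = const (wt n l c \<mu> i) * h"
        using g'(1) h(1) i by (auto simp: eigenvec_def)
      then show ?thesis
        unfolding e_def dunkl_z_add[OF i] dunkl_z_const[OF i] by (simp only: distrib_left mult.left_commute)
    qed
    ultimately have "eigenvec n c \<mu> e"
      using g'(1) h(1) unfolding eigenvec_def by blast
    moreover have "lookup e \<mu> = 0" using g' h by (simp add: e_def lookup_add lookup_minus)
    ultimately have "e = 0" using lead by blast
    then show "g = const (inverse (lookup f \<mu>)) * f"
      unfolding e_def h_def[symmetric] by (simp add: const_uminus)
  qed
qed

end

section \<open>Specialization of the parameter\<close>

lemma embed_add: "embed (p + q) = embed p + embed q"
  and embed_mult: "embed (p * q) = embed p * embed q"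
  and embed_diff: "embed (p - q) = embed p - embed q"
  and embed_0 [simp]: "embed 0 = 0" and embed_1 [simp]: "embed 1 = 1"
  and embed_inj [simp]: "embed p = embed q \<longleftrightarrow> p = q"
  by (simp_all add: embed_def eq_fract Zero_fract_def One_fract_def)

lemma embed_power: "embed (p ^ m) = embed p ^ m"
  by (induction m) (simp_all add: embed_mult)

lemma embed_of_nat: "embed (of_nat m) = of_nat m"
  by (induction m) (simp_all add: embed_add)

lemma embed_of_int: "embed (of_int m) = of_int m"
  by (cases m rule: int_diff_cases) (simp add: embed_diff embed_of_nat)

lemma embed_sum: "embed (sum h A) = (\<Sum>x\<in>A. embed (h x))"
  by (induction A rule: infinite_finite_induct) (simp_all add: embed_add)

lemma embed_Fract: "q \<noteq> 0 \<Longrightarrow> embed q * u = embed p \<longleftrightarrow> u = Fract p q"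
  by (cases u rule: Fract_cases) (auto simp: embed_def eq_fract mult.commute)

lemma specialize_Fract:
  assumes "poly q a \<noteq> 0"
  shows "specialize a (Fract p q) = poly p a / poly q a"
  unfolding specialize_def
proof (rule the_equality)
  show "\<exists>p' q'. Fract p q = Fract p' q' \<and> poly q' a \<noteq> 0 \<and> poly p a / poly q a = poly p' a / poly q' a"
    using assms by blast
next
  fix y assume "\<exists>p' q'. Fract p q = Fract p' q' \<and> poly q' a \<noteq> 0 \<and> y = poly p' a / poly q' a"
  then obtain p' q' where h: "Fract p q = Fract p' q'" "poly q' a \<noteq> 0" "y = poly p' a / poly q' a" by blast
  have "q \<noteq> 0" "q' \<noteq> 0" using assms h(2) by auto
  then have "p * q' = p' * q" using h(1) by (simp add: eq_fract)
  then have "poly p a * poly q' a = poly p' a * poly q a" by (metis poly_mult)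
  then show "y = poly p a / poly q a" using assms h(2,3) by (simp add: frac_eq_eq)
qed

lemma common_denominator:
  fixes h :: "'b \<Rightarrow> complex poly fract"
  assumes "finite A"
  shows "\<exists>D. D \<noteq> 0 \<and> (\<forall>x\<in>A. \<exists>p. embed D * h x = embed p)"
  using assms
proof induction
  case empty
  show ?case by (rule exI[of _ 1]) simp
next
  case (insert x A)
  then obtain D where D: "D \<noteq> 0" "\<And>x. x \<in> A \<Longrightarrow> \<exists>p. embed D * h x = embed p" by blast
  obtain p q where "h x = Fract p q" "q \<noteq> 0" by (cases "h x" rule: Fract_cases) blast
  then have q: "q \<noteq> 0" "embed q * h x = embed p" by (simp_all add: embed_Fract)
  have "\<exists>r. embed (D * q) * h y = embed r" if "y \<in> insert x A" for y
  proof (cases "y = x")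
    case True
    then have "embed (D * q) * h y = embed (D * p)"
      using q(2) by (simp add: embed_mult mult.assoc)
    then show ?thesis by blast
  next
    case False
    then obtain r where "embed D * h y = embed r" using D(2) \<open>y \<in> insert x A\<close> by blast
    then have "embed (D * q) * h y = embed (q * r)" by (simp add: embed_mult mult.commute mult.left_commute)
    then show ?thesis by blast
  qed
  then show ?case using D(1) q(1) by (intro exI[of _ "D * q"]) simp
qed

lemma root_of_unity_embed:
  assumes "root_of_unity l \<zeta>"
  shows "root_of_unity l (embed [:\<zeta>:])"
proof -
  interpret root_of_unity l \<zeta> by (rule assms)
  have p: "embed [:\<zeta>:] ^ d = embed [:\<zeta> ^ d:]" for d
  proof -
    have "[:\<zeta>:] ^ d = [:\<zeta> ^ d:]" by (induction d) (simp_all add: one_pCons)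
    then show ?thesis by (simp flip: embed_power)
  qed
  have "embed [:1:] = 1" by (metis embed_1 one_pCons)
  then have one: "embed [:\<zeta>:] ^ d = 1 \<longleftrightarrow> \<zeta> ^ d = 1" for d
    unfolding p by (metis embed_inj pCons_eq_iff)
  show ?thesis
    by unfold_locales (use l_pos root prim in \<open>simp_all add: one\<close>)
qed

lemma indeterminate_generic:
  assumes "of_int a + embed [:0, 1:] * of_int b = 0"
  shows "a = 0 \<and> b = 0"
proof -
  have "embed (of_int a + [:0, 1:] * of_int b) = embed 0"
    using assms unfolding embed_add embed_mult embed_of_int embed_0 .
  then have "of_int a + [:0, 1:] * of_int b = (0 :: complex poly)" by (simp only: embed_inj)
  moreover have "of_int m = [:of_int m :: complex:]" for m by (simp add: of_int_poly)
  ultimately have "[:of_int a, of_int b :: complex:] = 0" by simp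
  then show ?thesis by simp
qed

text \<open>Simplicity of the weight is assumed only among exponents congruent to \<mu> modulo l,
  the only ones that occur in f_\<mu>. A pole at \<open>a\<close> would produce a nonzero
  eigenvector whose leading exponent is \<mu> but whose coefficient there is 0.\<close>

lemma jack_eigenvec:
  fixes \<zeta> a :: complex
  assumes root: "root_of_unity l \<zeta>" and \<mu>: "\<mu> \<in> compositions n"
    and simple: "\<And>\<nu>. \<nu> \<in> root_of_unity.resid l n \<mu> \<Longrightarrow>
      (\<And>i. i \<in> {1..n} \<Longrightarrow> wt n l a \<nu> i = wt n l a \<mu> i) \<Longrightarrow> \<nu> = \<mu>"
  shows "root_of_unity.eigenvec l \<zeta> n a \<mu> (jack n l \<zeta> a \<mu>) \<and> lookup (jack n l \<zeta> a \<mu>) \<mu> = 1"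
proof -
  interpret C: root_of_unity l \<zeta> by (rule root)
  interpret G: root_of_unity l "embed [:\<zeta>:]" by (rule root_of_unity_embed[OF root])
  let ?x = "embed [:0, 1:]"
  define f where "f = generic_jack n l \<zeta> \<mu>"
  have "is_jack n l (embed [:\<zeta>:]) ?x \<mu> f"
    unfolding f_def generic_jack_def
    by (rule theI'[OF G.generic_jack_unique[OF indeterminate_generic \<mu>]])
  then have f: "G.eigenvec n ?x \<mu> f" "lookup f \<mu> = 1" by (simp_all add: G.is_jack_iff)
  have keys_f: "keys f \<subseteq> C.resid n \<mu>" using f(1) by (simp add: G.eigenvec_def)
  define good where "good D \<longleftrightarrow> D \<noteq> 0 \<and> (\<forall>\<nu>. \<exists>p. embed D * lookup f \<nu> = embed p)" for D
  have "\<exists>D. good D"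
  proof -
    obtain D where D: "D \<noteq> 0" "\<And>\<nu>. \<nu> \<in> keys f \<Longrightarrow> \<exists>p. embed D * lookup f \<nu> = embed p"
      using common_denominator[of "keys f" "lookup f"] by auto
    have "\<exists>p. embed D * lookup f \<nu> = embed p" for \<nu>
    proof (cases "\<nu> \<in> keys f")
      case False
      then have "embed D * lookup f \<nu> = embed 0" by (simp add: in_keys_iff)
      then show ?thesis by blast
    qed (rule D(2))
    then show ?thesis using D(1) unfolding good_def by blast
  qed
  \<comment> \<open>Minimality of the degree ensures that the cleared coefficients do not all vanish
    at \<open>a\<close>: a common factor x - a could be cancelled.\<close>
  then obtain D where D: "good D" and min: "\<And>E. good E \<Longrightarrow> degree D \<le> degree E"
    using ex_has_least_nat[of good _ degree] by blast
  have D0: "D \<noteq> 0" using D by (simp add: good_def)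
  have "\<exists>F. \<forall>\<nu>. embed D * lookup f \<nu> = embed (F \<nu>)"
    using D unfolding good_def by (intro choice) blast
  then obtain F where F: "\<And>\<nu>. embed D * lookup f \<nu> = embed (F \<nu>)" by blast
  have F0: "F \<nu> = 0" if "\<nu> \<notin> keys f" for \<nu>
  proof -
    have "embed (F \<nu>) = embed 0" using F[of \<nu>] that by (simp add: in_keys_iff)
    then show ?thesis by (simp only: embed_inj)
  qed
  \<comment> \<open>By the normalization of f the denominator is itself the cleared coefficient at
    \<mu>.\<close>
  have F\<mu>: "F \<mu> = D" using F[of \<mu>] f(2) by simp
  define g where "g = (\<Sum>\<nu>\<in>keys f. single \<nu> (poly (F \<nu>) a))"
  have lookup_g: "lookup g \<nu> = poly (F \<nu>) a" for \<nu>
    unfolding g_def using F0[of \<nu>]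
    by (simp add: lookup_sum lookup_single when_def sum.delta)
  have keys_g: "keys g \<subseteq> keys f"
    using F0 by (auto simp: in_keys_iff lookup_g)
  have eig: "C.eigenvec n a \<mu> g"
    unfolding C.eigenvec_def
  proof (intro conjI ballI)
    show "keys g \<subseteq> C.resid n \<mu>" using keys_g keys_f by blast
    fix i assume i: "i \<in> {1..n}"
    show "dunkl_z n l \<zeta> a i g = const (wt n l a \<mu> i) * g"
    proof (rule poly_mapping_eqI)
      fix \<alpha>
      define W :: "complex poly" where "W = of_nat (lookup \<mu> i) + 1 - of_nat l * [:0, 1:] * of_nat (rk n \<mu> i)"
      have W: "embed W = wt n l ?x \<mu> i"
        unfolding W_def wt_def embed_add embed_diff embed_mult embed_of_nat embed_1 ..
      have "lookup (dunkl_z n l (embed [:\<zeta>:]) ?x i f) \<alpha> = embed W * lookup f \<alpha>"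
        using f(1) i by (simp add: G.eigenvec_def W)
      then have e: "of_nat (Suc (lookup \<alpha> i)) * lookup f \<alpha> +
          ?x * (\<Sum>\<nu>\<in>keys f. lookup f \<nu> * of_int (zc n l i \<nu> \<alpha>)) = embed W * lookup f \<alpha>"
        by (simp only: G.lookup_dunkl_z[OF i finite_keys subset_refl])
      have sumD: "(\<Sum>\<nu>\<in>keys f. (embed D * lookup f \<nu>) * of_int (zc n l i \<nu> \<alpha>)) =
          embed D * (\<Sum>\<nu>\<in>keys f. lookup f \<nu> * of_int (zc n l i \<nu> \<alpha>))"
        by (simp only: sum_distrib_left mult.assoc)
      have "A * (d * u) + x * (d * S) = w * (d * u)" if "A * u + x * S = w * u"
        for A d u x S w :: "complex poly fract"
        using arg_cong[OF that, of "\<lambda>t. d * t"] by (simp only: distrib_left mult.left_commute)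
      from this[OF e, of "embed D"]
      have "of_nat (Suc (lookup \<alpha> i)) * (embed D * lookup f \<alpha>) +
          ?x * (\<Sum>\<nu>\<in>keys f. (embed D * lookup f \<nu>) * of_int (zc n l i \<nu> \<alpha>)) = embed W * (embed D * lookup f \<alpha>)"
        unfolding sumD .
      then have "embed (of_nat (Suc (lookup \<alpha> i)) * F \<alpha> + [:0, 1:] * (\<Sum>\<nu>\<in>keys f. F \<nu> * of_int (zc n l i \<nu> \<alpha>)))
          = embed (W * F \<alpha>)"
        unfolding F embed_add embed_mult embed_sum embed_of_nat embed_of_int .
      then have "of_nat (Suc (lookup \<alpha> i)) * F \<alpha> + [:0, 1:] * (\<Sum>\<nu>\<in>keys f. F \<nu> * of_int (zc n l i \<nu> \<alpha>)) = W * F \<alpha>"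
        by (simp only: embed_inj)
      then have "poly (of_nat (Suc (lookup \<alpha> i)) * F \<alpha> + [:0, 1:] * (\<Sum>\<nu>\<in>keys f. F \<nu> * of_int (zc n l i \<nu> \<alpha>))) a
          = poly (W * F \<alpha>) a" by (rule arg_cong)
      then have "of_nat (Suc (lookup \<alpha> i)) * lookup g \<alpha> +
          a * (\<Sum>\<nu>\<in>keys f. lookup g \<nu> * of_int (zc n l i \<nu> \<alpha>)) = wt n l a \<mu> i * lookup g \<alpha>"
        by (simp add: lookup_g poly_sum W_def wt_def)
      then show "lookup (dunkl_z n l \<zeta> a i g) \<alpha> = lookup (const (wt n l a \<mu> i) * g) \<alpha>"
        unfolding C.lookup_dunkl_z[OF i finite_keys keys_g] lookup_const_mult .
    qed
  qed
  have Da: "poly D a \<noteq> 0"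
  proof
    assume Da: "poly D a = 0"
    show False
    proof (cases "g = 0")
      case True
      have dvd: "[:- a, 1:] dvd F \<nu>" for \<nu>
        using lookup_g[of \<nu>] True by (simp add: poly_eq_0_iff_dvd)
      obtain E where E: "D = [:- a, 1:] * E" using Da by (auto simp: poly_eq_0_iff_dvd)
      have E0: "E \<noteq> 0" using D0 E by auto
      have "\<exists>p. embed E * lookup f \<nu> = embed p" for \<nu>
      proof -
        obtain H where H: "F \<nu> = [:- a, 1:] * H" using dvd[of \<nu>] by (elim dvdE)
        have "embed [:- a, 1:] * (embed E * lookup f \<nu>) = embed [:- a, 1:] * embed H"
          using F[of \<nu>] unfolding E H by (simp only: embed_mult mult.assoc)
        moreover have "embed [:- a, 1:] \<noteq> 0" by (simp only: embed_inj flip: embed_0) simp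
        ultimately have "embed E * lookup f \<nu> = embed H" by simp
        then show ?thesis by blast
      qed
      then have "good E" using E0 by (simp add: good_def)
      then have "degree D \<le> degree E" by (rule min)
      moreover have "degree D = Suc (degree E)"
        unfolding E by (subst degree_mult_eq) (use E0 in auto)
      ultimately show False by simp
    next
      case False
      then obtain \<alpha> where al: "\<alpha> \<in> keys g" "\<And>\<nu>. \<nu> \<in> keys g \<Longrightarrow> psi n \<nu> \<le> psi n \<alpha>"
        using leading_exponent by blast
      have "\<alpha> = \<mu>"
      proof (rule simple)
        show "\<alpha> \<in> C.resid n \<mu>" using al(1) keys_g keys_f by blast
      qed (rule C.eigenvec_lead[OF eig al])
      then show False using al(1) Da by (simp add: in_keys_iff lookup_g F\<mu>)
    qed
  qed
  have jack: "lookup (jack n l \<zeta> a \<mu>) \<nu> = inverse (poly D a) * lookup g \<nu>" for \<nu>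
  proof (cases "lookup f \<nu> = 0")
    case True
    then have "F \<nu> = 0" by (intro F0) (simp add: in_keys_iff)
    then show ?thesis using True by (simp add: jack_def f_def[symmetric] map.rep_eq lookup_g)
  next
    case False
    have "lookup f \<nu> = Fract (F \<nu>) D" using F[of \<nu>] D0 by (simp add: embed_Fract)
    then have "specialize a (lookup f \<nu>) = poly (F \<nu>) a / poly D a"
      using specialize_Fract[OF Da, of "F \<nu>"] by (simp only:)
    then show ?thesis using False
      by (simp add: jack_def f_def[symmetric] map.rep_eq lookup_g field_simps)
  qed
  then have jg: "jack n l \<zeta> a \<mu> = const (inverse (poly D a)) * g"
    by (intro poly_mapping_eqI) simp
  have "keys (jack n l \<zeta> a \<mu>) \<subseteq> keys g" by (auto simp: in_keys_iff jack)
  then have "C.eigenvec n a \<mu> (jack n l \<zeta> a \<mu>)"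
    using eig unfolding C.eigenvec_def jg
    by (auto simp: C.dunkl_z_const mult.left_commute)
  then show ?thesis using Da jack[of \<mu>] by (simp add: lookup_g F\<mu>)
qed

text \<open>Congruent entries differ by l q_i. Clearing the denominator k in the equality of weights
  turns this into a difference k q_i of the ranks, the situation of
  \<open>admissible_weight_simple\<close>.\<close>

lemma admissible_simple:
  assumes k: "2 \<le> k" "k \<le> n" and root: "root_of_unity l (\<zeta> :: complex)"
    and \<mu>: "\<mu> \<in> compositions n" "admissible n l k \<mu>"
    and \<nu>: "\<nu> \<in> root_of_unity.resid l n \<mu>"
      "\<And>i. i \<in> {1..n} \<Longrightarrow> wt n l (1 / of_nat k :: complex) \<nu> i = wt n l (1 / of_nat k) \<mu> i"
  shows "\<nu> = \<mu>"
proof -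
  interpret root_of_unity l \<zeta> by (rule root)
  have res: "\<nu> \<in> compositions n" "\<And>i. i \<in> {1..n} \<Longrightarrow> lookup \<nu> i mod l = lookup \<mu> i mod l"
    using \<nu>(1) by (auto simp: resid_def)
  define q where "q i = (int (lookup \<mu> i) - int (lookup \<nu> i)) div int l" for i
  have q1: "int (lookup \<mu> i) = int (lookup \<nu> i) + int l * q i" if "i \<in> {1..n}" for i
  proof -
    have "int (lookup \<mu> i) mod int l = int (lookup \<nu> i) mod int l"
      using res(2)[OF that] by (metis of_nat_mod)
    then have "int l dvd int (lookup \<mu> i) - int (lookup \<nu> i)" by (simp add: mod_eq_dvd_iff)
    then show ?thesis by (simp add: q_def)
  qed
  have q2: "int (rk n \<mu> i) = int (rk n \<nu> i) + int k * q i" if i: "i \<in> {1..n}" for i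
  proof -
    define K where "K = (of_nat k :: complex)"
    have "K * (of_nat l * (1 / K) * x) = of_nat l * x" for x using k by (simp add: K_def)
    then have K: "K * (x + 1 - of_nat l * (1 / K) * y) = K * x + K - of_nat l * y" for x y
      by (simp only: right_diff_distrib distrib_left mult_1_right)
    have "K * (of_nat (lookup \<nu> i) + 1 - of_nat l * (1 / K) * of_nat (rk n \<nu> i)) =
        K * (of_nat (lookup \<mu> i) + 1 - of_nat l * (1 / K) * of_nat (rk n \<mu> i))"
      using \<nu>(2)[OF i] by (simp add: wt_def K_def)
    then have "of_int (int k * int (lookup \<nu> i) - int l * int (rk n \<nu> i)) =
        (of_int (int k * int (lookup \<mu> i) - int l * int (rk n \<mu> i)) :: complex)"
      unfolding K by (simp add: K_def algebra_simps)
    then have "int k * int (lookup \<nu> i) - int l * int (rk n \<nu> i) =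
        int k * int (lookup \<mu> i) - int l * int (rk n \<mu> i)" by (simp only: of_int_eq_iff)
    then have "int l * int (rk n \<mu> i) = int l * (int (rk n \<nu> i) + int k * q i)"
      unfolding q1[OF i] by (simp add: algebra_simps)
    then show ?thesis using l_pos by simp
  qed
  show ?thesis
    by (rule composition_eqI[OF res(1) \<mu>(1)])
      (rule admissible_weight_simple[OF k l_pos \<mu>(2) q1 q2])
qed

section \<open>The ideal is stable under the operators \<open>z\<^sub>i\<close>\<close>

lemma partial_deriv_const [simp]: "partial_deriv i (const c) = 0"
  by (simp add: const_def partial_deriv_single)

lemma partial_deriv_var: "partial_deriv i (var j) = (if i = j then 1 else 0)"
  by (auto simp: var_def partial_deriv_single lookup_single when_def)

lemma partial_deriv_mult:
  "partial_deriv i (f * g) = partial_deriv i f * g + f * partial_deriv i g"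
proof (induction f rule: mpoly_induct_single)
  case (single \<alpha> c)
  show ?case
  proof (induction g rule: mpoly_induct_single)
    case (single \<beta> d)
    \<comment> \<open>Subtraction of exponents is truncated; when \<alpha>_i = 0 the coefficient
      vanishes and both sides are 0.\<close>
    have a: "single (\<alpha> + \<beta> - single i 1) (of_nat (lookup \<alpha> i) * e) =
        single (\<alpha> - single i 1 + \<beta>) (of_nat (lookup \<alpha> i) * e)" for \<alpha> \<beta> :: "nat \<Rightarrow>\<^sub>0 nat" and e :: 'a
    proof (cases "lookup \<alpha> i = 0")
      case False
      have "\<alpha> + \<beta> - single i 1 = \<alpha> - single i 1 + \<beta>"
        by (rule poly_mapping_eqI)
          (use False in \<open>auto simp: lookup_add lookup_minus lookup_single when_def\<close>)
      then show ?thesis by simp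
    qed simp
    have "partial_deriv i (single \<alpha> c * single \<beta> d) =
        single (\<alpha> + \<beta> - single i 1) (of_nat (lookup \<alpha> i) * (c * d)) +
        single (\<beta> + \<alpha> - single i 1) (of_nat (lookup \<beta> i) * (c * d))"
      by (simp add: mult_single partial_deriv_single lookup_add distrib_right single_add add.commute)
    also have "\<dots> = partial_deriv i (single \<alpha> c) * single \<beta> d + single \<alpha> c * partial_deriv i (single \<beta> d)"
      unfolding a[of \<alpha> \<beta>] a[of \<beta> \<alpha>] by (simp add: mult_single partial_deriv_single ac_simps)
    finally show ?case .
  next
    case (add f g)
    then show ?case by (simp add: partial_deriv_add algebra_simps)
  qed
next
  case (add f g)
  then show ?case by (simp add: partial_deriv_add algebra_simps)
qed

lemma eval_line_derivative:
  fixes f :: "complex mpoly"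
  assumes "finite A" "\<And>j. j \<notin> A \<Longrightarrow> w j = 0"
  shows "((\<lambda>t. eval (\<lambda>j. v j + t * w j) f) has_field_derivative
    (\<Sum>j\<in>A. w j * eval v (partial_deriv j f))) (at 0)"
proof (induction f rule: mpoly_induct)
  case (const c)
  show ?case by simp
next
  case (var i)
  have "(\<Sum>j\<in>A. w j * eval v (partial_deriv j (var i))) = (\<Sum>j\<in>A. if j = i then w i else 0)"
    by (rule sum.cong) (auto simp: partial_deriv_var)
  also have "\<dots> = w i" using assms by simp
  finally show ?case by (auto intro!: derivative_eq_intros)
next
  case (add f g)
  then show ?case
    by (auto intro!: derivative_eq_intros simp: partial_deriv_add distrib_left sum.distrib)
next
  case (mult f g)
  have "(\<Sum>j\<in>A. w j * eval v (partial_deriv j (f * g))) =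
      (\<Sum>j\<in>A. w j * eval v (partial_deriv j f)) * eval v g +
      (\<Sum>j\<in>A. w j * eval v (partial_deriv j g)) * eval v f"
    unfolding sum_distrib_right sum.distrib[symmetric]
    by (rule sum.cong) (auto simp: partial_deriv_mult algebra_simps)
  moreover have "((\<lambda>t. eval (\<lambda>j. v j + t * w j) f * eval (\<lambda>j. v j + t * w j) g) has_field_derivative
      (\<Sum>j\<in>A. w j * eval v (partial_deriv j f)) * eval (\<lambda>j. v j + 0 * w j) g +
      (\<Sum>j\<in>A. w j * eval v (partial_deriv j g)) * eval (\<lambda>j. v j + 0 * w j) f) (at 0)"
    by (rule DERIV_mult[OF mult])
  ultimately show ?case by simp
qed

lemma eval_cong:
  assumes "f \<in> poly_ring n" "\<And>i. i \<in> {1..n} \<Longrightarrow> v i = w i"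
  shows "eval v f = eval w f"
  unfolding eval_eq
proof (rule sum.cong[OF refl])
  fix \<alpha> assume "\<alpha> \<in> keys f"
  then have "keys \<alpha> \<subseteq> {1..n}" using assms(1) by (auto simp: poly_ring_def compositions_def)
  then have "monom_val v \<alpha> = monom_val w \<alpha>"
    unfolding monom_val_def by (intro prod.cong) (use assms(2) in auto)
  then show "lookup f \<alpha> * monom_val v \<alpha> = lookup f \<alpha> * monom_val w \<alpha>" by simp
qed

section \<open>The arrangement and its vanishing ideal\<close>

locale arrangement = root_of_unity l \<zeta> for l and \<zeta> :: complex +
  fixes k m n :: nat
  assumes k2: "2 \<le> k" and kn: "k \<le> n" and mk: "m \<le> k - 1"
begin

text \<open>Membership in \<open>X \<union> Y\<close> without the extensionality convention of \<open>affine_space\<close>.\<close>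

definition on_arr :: "(nat \<Rightarrow> complex) \<Rightarrow> bool" where
  "on_arr v \<longleftrightarrow> (\<exists>S\<subseteq>{1..n}. card S = k \<and> (\<forall>i\<in>S. \<forall>j\<in>S. v i ^ l = v j ^ l)) \<or>
     m + 1 \<le> card {i \<in> {1..n}. v i = 0}"

definition ideal :: "complex mpoly set" where
  "ideal = {f \<in> poly_ring n. \<forall>v. on_arr v \<longrightarrow> eval v f = 0}"

lemma ideal_eq: "vanishing_ideal n (X_var k l n \<union> Y_var (m + 1) n) = ideal"
proof (intro equalityI subsetI)
  fix f assume "f \<in> vanishing_ideal n (X_var k l n \<union> Y_var (m + 1) n)"
  then have f: "f \<in> poly_ring n" "\<And>x. x \<in> X_var k l n \<union> Y_var (m + 1) n \<Longrightarrow> eval x f = 0"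
    by (auto simp: vanishing_ideal_def)
  have "eval v f = 0" if v: "on_arr v" for v
  proof -
    let ?x = "restrict v {1..n}"
    have a: "?x \<in> affine_space n" by (simp add: affine_space_def)
    have z: "{i \<in> {1..n}. ?x i = 0} = {i \<in> {1..n}. v i = 0}" by auto
    have "?x \<in> X_var k l n \<union> Y_var (m + 1) n"
      using v unfolding on_arr_def
    proof
      assume "\<exists>S\<subseteq>{1..n}. card S = k \<and> (\<forall>i\<in>S. \<forall>j\<in>S. v i ^ l = v j ^ l)"
      then obtain S where S: "S \<subseteq> {1..n}" "card S = k" "\<forall>i\<in>S. \<forall>j\<in>S. v i ^ l = v j ^ l" by blast
      have r: "?x i = v i" if "i \<in> S" for i using that S(1) by auto
      have "\<forall>i\<in>S. \<forall>j\<in>S. ?x i ^ l = ?x j ^ l"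
      proof (intro ballI)
        fix i j assume ij: "i \<in> S" "j \<in> S"
        show "?x i ^ l = ?x j ^ l" unfolding r[OF ij(1)] r[OF ij(2)] by (rule S(3)[rule_format, OF ij])
      qed
      then have "?x \<in> X_var k l n"
        unfolding X_var_def mem_Collect_eq by (intro conjI[OF a] exI[of _ S] conjI S(1,2))
      then show ?thesis by (rule UnI1)
    next
      assume "m + 1 \<le> card {i \<in> {1..n}. v i = 0}"
      then have "?x \<in> Y_var (m + 1) n" using a unfolding Y_var_def z[symmetric] by simp
      then show ?thesis by (rule UnI2)
    qed
    then have "eval ?x f = 0" by (rule f(2))
    moreover have "eval ?x f = eval v f" by (rule eval_cong[OF f(1)]) simp
    ultimately show ?thesis by simp
  qed
  then show "f \<in> ideal" using f(1) by (simp add: ideal_def)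
next
  fix f assume f: "f \<in> ideal"
  have "on_arr x" if "x \<in> X_var k l n \<union> Y_var (m + 1) n" for x
    using that unfolding on_arr_def X_var_def Y_var_def Un_iff mem_Collect_eq by argo
  then show "f \<in> vanishing_ideal n (X_var k l n \<union> Y_var (m + 1) n)"
    using f by (auto simp: vanishing_ideal_def ideal_def)
qed

text \<open>Both conditions depend only on the l-th powers of the coordinates, up to order, so X
  \<union> Y is stable under the reflection group.\<close>

lemma on_arr_permute:
  assumes p: "\<pi> permutes {1..n}" and w: "\<And>t. t \<in> {1..n} \<Longrightarrow> w t ^ l = v (\<pi> t) ^ l" and v: "on_arr v"
  shows "on_arr w"
  using v unfolding on_arr_def
proof (elim disjE exE conjE)
  fix S assume S: "S \<subseteq> {1..n}" "card S = k" "\<forall>i\<in>S. \<forall>j\<in>S. v i ^ l = v j ^ l"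
  have b: "bij \<pi>" by (rule permutes_bij[OF p])
  define R where "R = inv \<pi> ` S"
  have "card R = k" unfolding R_def
    using S(2) card_image[OF inj_on_subset[OF bij_is_inj[OF bij_imp_bij_inv[OF b]] subset_UNIV], of S] by simp
  moreover have R: "R \<subseteq> {1..n}"
    unfolding R_def using S(1) permutes_image[OF permutes_inv[OF p]] by blast
  moreover have "w i ^ l = w j ^ l" if "i \<in> R" "j \<in> R" for i j
  proof -
    have "\<pi> i \<in> S" "\<pi> j \<in> S" using that b by (auto simp: R_def bij_is_surj surj_f_inv_f)
    then show ?thesis using w that R S(3) by (metis subsetD)
  qed
  ultimately show "(\<exists>S\<subseteq>{1..n}. card S = k \<and> (\<forall>i\<in>S. \<forall>j\<in>S. w i ^ l = w j ^ l)) \<or>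
     m + 1 \<le> card {i \<in> {1..n}. w i = 0}" by blast
next
  assume c: "m + 1 \<le> card {i \<in> {1..n}. v i = 0}"
  have b: "bij \<pi>" by (rule permutes_bij[OF p])
  have zero: "w t = 0 \<longleftrightarrow> v (\<pi> t) = 0" if "t \<in> {1..n}" for t
    using w[OF that] l_pos by (metis One_nat_def Suc_le_eq power_eq_0_iff)
  have "{i \<in> {1..n}. v i = 0} \<subseteq> \<pi> ` {i \<in> {1..n}. w i = 0}"
  proof
    fix i assume i: "i \<in> {i \<in> {1..n}. v i = 0}"
    then have "i \<in> \<pi> ` {1..n}" using permutes_image[OF p] by simp
    then obtain j where "j \<in> {1..n}" "i = \<pi> j" by blast
    then show "i \<in> \<pi> ` {i \<in> {1..n}. w i = 0}" using zero[of j] i by simp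
  qed
  then have "card {i \<in> {1..n}. v i = 0} \<le> card (\<pi> ` {i \<in> {1..n}. w i = 0})"
    by (intro card_mono) auto
  also have "\<dots> \<le> card {i \<in> {1..n}. w i = 0}" by (rule card_image_le) simp
  finally show "(\<exists>S\<subseteq>{1..n}. card S = k \<and> (\<forall>i\<in>S. \<forall>j\<in>S. w i ^ l = w j ^ l)) \<or>
     m + 1 \<le> card {i \<in> {1..n}. w i = 0}" using c by linarith
qed

lemma zeta_l: "(\<zeta> ^ r) ^ l = 1"
  by (metis power_mult mult.commute root power_one)

lemma eval_refl:
  assumes "i \<noteq> j"
  shows "eval v (refl_act \<zeta> i j r f) =
    eval (v(i := \<zeta> ^ r * v j, j := inverse (\<zeta> ^ r) * v i)) f"
  unfolding refl_act_subst[OF assms] eval_subst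
  by (rule arg_cong[where f = "\<lambda>u. eval u f"]) (use assms in \<open>auto simp: refl_map_def fun_eq_iff\<close>)

lemma on_arr_refl:
  assumes "i \<in> {1..n}" "j \<in> {1..n}" "i \<noteq> j" "on_arr v"
  shows "on_arr (v(i := \<zeta> ^ r * v j, j := inverse (\<zeta> ^ r) * v i))"
proof (rule on_arr_permute[OF _ _ assms(4)])
  show "transpose i j permutes {1..n}" by (rule permutes_swap_id[OF assms(1,2)])
  fix t assume "t \<in> {1..n}"
  show "(v(i := \<zeta> ^ r * v j, j := inverse (\<zeta> ^ r) * v i)) t ^ l = v (transpose i j t) ^ l"
    using assms(3) by (auto simp: transpose_def power_mult_distrib power_inverse zeta_l)
qed

text \<open>f vanishes along the line that scales the coordinates in \<open>T\<close>, and its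
  derivative at t = 0 is the Euler sum.\<close>

lemma euler_sum_zero:
  assumes f: "f \<in> ideal" and T: "T \<subseteq> {1..n}"
    and "\<And>t. on_arr (\<lambda>j. v j + t * (if j \<in> T then v j else 0))"
  shows "(\<Sum>j\<in>T. v j * eval v (partial_deriv j f)) = 0"
proof -
  let ?w = "\<lambda>j. if j \<in> T then v j else 0"
  have "finite T" using T finite_subset by blast
  then have "((\<lambda>t. eval (\<lambda>j. v j + t * ?w j) f) has_field_derivative
      (\<Sum>j\<in>T. ?w j * eval v (partial_deriv j f))) (at 0)"
    by (rule eval_line_derivative) simp
  moreover have "(\<lambda>t. eval (\<lambda>j. v j + t * ?w j) f) = (\<lambda>t. 0)"
    using f assms(3) by (auto simp: ideal_def)
  ultimately have "((\<lambda>t. 0) has_field_derivative (\<Sum>j\<in>T. ?w j * eval v (partial_deriv j f))) (at (0::complex))"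
    by simp
  then have "(\<Sum>j\<in>T. ?w j * eval v (partial_deriv j f)) = 0"
    by (rule DERIV_unique) simp
  then show ?thesis by simp
qed

text \<open>Off the hyperplane both terms of the numerator vanish at v. On it, v_i is moved to v_i +
  t: the denominator becomes t, and the value of the quotient is the derivative of the numerator at
  t = 0.\<close>

lemma eval_dd:
  assumes ij: "i \<in> {1..n}" "j \<in> {1..n}" "i \<noteq> j" and f: "f \<in> ideal" and v: "on_arr v"
  shows "eval v (dd i j r (var i * f)) = (if v i = \<zeta> ^ r * v j
    then v i * eval v (partial_deriv i f) - v j * eval v (partial_deriv j f) else 0)"
proof -
  let ?Q = "dd i j r (var i * f)"
  have zero: "eval u f = 0" if "on_arr u" for u using f that by (simp add: ideal_def)
  have Q: "eval u ?Q * (u i - \<zeta> ^ r * u j) =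
      u i * eval u f - \<zeta> ^ r * u j * eval (u(i := \<zeta> ^ r * u j, j := inverse (\<zeta> ^ r) * u i)) f" for u
  proof -
    have "eval u (?Q * lin i j r) = eval u (var i * f - refl_act \<zeta> i j r (var i * f))"
      by (simp only: dd_mult[OF ij(3)])
    then show ?thesis using ij(3) by (simp add: lin_def eval_refl)
  qed
  show ?thesis
  proof (cases "v i = \<zeta> ^ r * v j")
    case False
    have "eval v ?Q * (v i - \<zeta> ^ r * v j) = 0"
      unfolding Q using zero[OF v] zero[OF on_arr_refl[OF ij v, of r]] by simp
    then show ?thesis using False by simp
  next
    case True
    then have vj: "inverse (\<zeta> ^ r) * v i = v j" by simp
    let ?e = "\<lambda>t. if t = i then (1::complex) else 0"
    let ?d = "\<lambda>t. if t = j then inverse (\<zeta> ^ r) else 0"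
    have line_i: "((\<lambda>t. eval (\<lambda>s. v s + t * ?e s) h) has_field_derivative eval v (partial_deriv i h)) (at 0)" for h
      using eval_line_derivative[of "{i}" ?e v h] by simp
    have line_j: "((\<lambda>t. eval (\<lambda>s. v s + t * ?d s) h) has_field_derivative
        inverse (\<zeta> ^ r) * eval v (partial_deriv j h)) (at 0)" for h
      using eval_line_derivative[of "{j}" ?d v h] by simp
    \<comment> \<open>The reflection of the moved point differs from v only in coordinate j, by
      \<zeta>^(-r) t.\<close>
    have eq: "eval (\<lambda>s. v s + t * ?e s) ?Q * t =
        (v i + t) * eval (\<lambda>s. v s + t * ?e s) f - v i * eval (\<lambda>s. v s + t * ?d s) f" for t
    proof -
      let ?u = "\<lambda>s. v s + t * ?e s"
      have u: "?u(i := \<zeta> ^ r * ?u j, j := inverse (\<zeta> ^ r) * ?u i) = (\<lambda>s. v s + t * ?d s)"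
        using ij(3) True vj by (auto simp: fun_eq_iff algebra_simps)
      have "?u i - \<zeta> ^ r * ?u j = t" "\<zeta> ^ r * ?u j = v i" "?u i = v i + t" using ij(3) True by auto
      then show ?thesis using Q[of ?u] unfolding u by simp
    qed
    have "((\<lambda>t. eval (\<lambda>s. v s + t * ?e s) ?Q * t) has_field_derivative
        eval v (partial_deriv i ?Q) * 0 + 1 * eval (\<lambda>s. v s + 0 * ?e s) ?Q) (at 0)"
      by (rule DERIV_mult[OF line_i DERIV_ident])
    then have d1: "((\<lambda>t. (v i + t) * eval (\<lambda>s. v s + t * ?e s) f - v i * eval (\<lambda>s. v s + t * ?d s) f)
        has_field_derivative eval v ?Q) (at 0)"
      unfolding eq by simp
    have "((\<lambda>t. (v i + t) * eval (\<lambda>s. v s + t * ?e s) f) has_field_derivative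
        (0 + 1) * eval (\<lambda>s. v s + 0 * ?e s) f + eval v (partial_deriv i f) * (v i + 0)) (at 0)"
      by (rule DERIV_mult[OF DERIV_add[OF DERIV_const DERIV_ident] line_i])
    moreover have "((\<lambda>t. v i * eval (\<lambda>s. v s + t * ?d s) f) has_field_derivative
        v i * (inverse (\<zeta> ^ r) * eval v (partial_deriv j f))) (at 0)"
      by (rule DERIV_cmult[OF line_j])
    ultimately have d2: "((\<lambda>t. (v i + t) * eval (\<lambda>s. v s + t * ?e s) f - v i * eval (\<lambda>s. v s + t * ?d s) f)
        has_field_derivative ((0 + 1) * eval (\<lambda>s. v s + 0 * ?e s) f + eval v (partial_deriv i f) * (v i + 0))
          - v i * (inverse (\<zeta> ^ r) * eval v (partial_deriv j f))) (at 0)"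
      by (rule DERIV_diff)
    have "eval v ?Q = ((0 + 1) * eval (\<lambda>s. v s + 0 * ?e s) f + eval v (partial_deriv i f) * (v i + 0))
          - v i * (inverse (\<zeta> ^ r) * eval v (partial_deriv j f))"
      by (rule DERIV_unique[OF d1 d2])
    also have "\<dots> = v i * eval v (partial_deriv i f) - (inverse (\<zeta> ^ r) * v i) * eval v (partial_deriv j f)"
      using zero[OF v] by (simp add: algebra_simps)
    finally show ?thesis using True unfolding vj by simp
  qed
qed

lemma root_exponent:
  fixes x :: complex
  assumes "x ^ l = 1"
  shows "\<exists>!r. r < l \<and> x = \<zeta> ^ r"
proof -
  have inj: "inj_on (\<lambda>r. \<zeta> ^ r) {..<l}"
    by (rule inj_onI) (simp add: zeta_power_eq_iff)
  have "card ((\<lambda>r. \<zeta> ^ r) ` {..<l}) = card {z::complex. z ^ l = 1}"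
    using card_image[OF inj] card_roots_unity_eq[of l] l_pos by simp
  then have "(\<lambda>r. \<zeta> ^ r) ` {..<l} = {z. z ^ l = 1}"
    using l_pos by (intro card_subset_eq finite_roots_unity) (auto simp: zeta_l)
  then have "x \<in> (\<lambda>r. \<zeta> ^ r) ` {..<l}" using assms by simp
  then obtain r where "r < l" "x = \<zeta> ^ r" by auto
  then show ?thesis using inj by (auto simp: inj_on_def)
qed

text \<open>For nonzero x and y with equal l-th powers exactly one r matches. If both are 0, every r
  matches, which is why e must vanish then.\<close>

lemma sum_coincident:
  fixes x y :: complex
  assumes "x = 0 \<and> y = 0 \<Longrightarrow> e = 0"
  shows "(\<Sum>r<l. if x = \<zeta> ^ r * y then e else 0) = (if y ^ l = x ^ l then e else 0)"
proof (cases "y = 0")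
  case True
  then show ?thesis using assms l_pos by (cases "x = 0") (auto simp: power_0_left)
next
  case False
  have eq: "x = \<zeta> ^ r * y \<longleftrightarrow> x / y = \<zeta> ^ r" for r using False by (auto simp: field_simps)
  show ?thesis
  proof (cases "y ^ l = x ^ l")
    case True
    have "y ^ l \<noteq> 0" using False by simp
    then have "(x / y) ^ l = 1" using True unfolding power_divide by (metis divide_self)
    then obtain r where r: "r < l" "x / y = \<zeta> ^ r" "\<And>s. s < l \<Longrightarrow> x / y = \<zeta> ^ s \<Longrightarrow> s = r"
      using root_exponent by metis
    have "(\<Sum>s<l. if x = \<zeta> ^ s * y then e else 0) = (\<Sum>s<l. if s = r then e else 0)"
      by (rule sum.cong[OF refl]) (use r eq in auto)
    then show ?thesis using True r(1) by simp
  next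
    case ne: False
    have "x \<noteq> \<zeta> ^ r * y" for r
    proof
      assume "x = \<zeta> ^ r * y"
      then have "x ^ l = y ^ l" by (simp add: power_mult_distrib zeta_l)
      then show False using ne by simp
    qed
    then show ?thesis using ne by simp
  qed
qed

text \<open>Let E_j be v_j times the j-th partial derivative of f at v, and let T be the coordinates
  sharing the l-th power of v_i. The value is E_i - (1/k) (|T| E_i - sum of E_j over T). Either each
  coordinate of T can be scaled alone inside X \<union> Y and all these E_j vanish, or |T| = k and
  their sum vanishes; then the factor 1/k cancels E_i.\<close>

lemma ideal_z:
  assumes f: "f \<in> ideal" and i: "i \<in> {1..n}"
  shows "dunkl_z n l \<zeta> (1 / of_nat k) i f \<in> ideal"
proof -
  have "eval v (dunkl_z n l \<zeta> (1 / of_nat k) i f) = 0" if v: "on_arr v" for v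
  proof -
    define E where "E j = v j * eval v (partial_deriv j f)" for j
    define T where "T = {j \<in> {1..n}. v j ^ l = v i ^ l}"
    have fv: "eval u f = 0" if "on_arr u" for u using f that by (simp add: ideal_def)
    have iT: "i \<in> T" and Tn: "T \<subseteq> {1..n}" and finT: "finite T" using i by (auto simp: T_def)
    have "(\<Sum>j\<in>{1..n} - {i}. eval v ((\<Sum>r<l. dd i j r (var i * f)) -
        (if j < i then \<Sum>r<l. refl_act \<zeta> i j r f else 0))) =
        (\<Sum>j\<in>{1..n} - {i}. if v j ^ l = v i ^ l then E i - E j else 0)"
    proof (rule sum.cong[OF refl])
      fix j assume "j \<in> {1..n} - {i}"
      then have ij: "i \<in> {1..n}" "j \<in> {1..n}" "i \<noteq> j" using i by auto
      have "eval v (\<Sum>r<l. dd i j r (var i * f)) = (\<Sum>r<l. if v i = \<zeta> ^ r * v j then E i - E j else 0)"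
        unfolding eval_sum eval_dd[OF ij f v] E_def ..
      also have "\<dots> = (if v j ^ l = v i ^ l then E i - E j else 0)"
        by (rule sum_coincident) (simp add: E_def)
      finally have 1: "eval v (\<Sum>r<l. dd i j r (var i * f)) = (if v j ^ l = v i ^ l then E i - E j else 0)" .
      have "eval v (\<Sum>r<l. refl_act \<zeta> i j r f) = 0"
        unfolding eval_sum eval_refl[OF ij(3)] using fv[OF on_arr_refl[OF ij v]] by simp
      then have 2: "eval v (if j < i then \<Sum>r<l. refl_act \<zeta> i j r f else 0) = 0"
        by (cases "j < i") simp_all
      show "eval v ((\<Sum>r<l. dd i j r (var i * f)) - (if j < i then \<Sum>r<l. refl_act \<zeta> i j r f else 0)) =
          (if v j ^ l = v i ^ l then E i - E j else 0)"
        unfolding eval_diff 1 2 by simp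
    qed
    also have "\<dots> = (\<Sum>j\<in>T - {i}. E i - E j)"
      by (rule sum.mono_neutral_cong_right) (auto simp: T_def)
    also have "\<dots> = of_nat (card T) * E i - (\<Sum>j\<in>T. E j)"
      using sum.remove[OF finT iT, of "\<lambda>j. E i - E j"] by (simp add: sum_subtractf)
    moreover have "eval v (partial_deriv i (var i * f)) = E i"
      by (simp add: partial_deriv_mult partial_deriv_var fv[OF v] E_def)
    ultimately have z: "eval v (dunkl_z n l \<zeta> (1 / of_nat k) i f) =
        E i - 1 / of_nat k * (of_nat (card T) * E i - (\<Sum>j\<in>T. E j))"
      unfolding dunkl_z_eq[OF i] eval_diff eval_mult eval_const eval_sum[of v _ "{1..n} - {i}"] by simp
    have single: "E j = 0" if "j \<in> {1..n}" "\<And>t. on_arr (\<lambda>s. v s + t * (if s \<in> {j} then v s else 0))" for j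
      using euler_sum_zero[OF f, of "{j}" v] that by (simp add: E_def)
    have "(\<forall>j\<in>T. E j = 0) \<or> (card T = k \<and> (\<Sum>j\<in>T. E j) = 0)"
    proof (cases "m + 1 \<le> card {i \<in> {1..n}. v i = 0}")
      case True
      \<comment> \<open>Scaling one coordinate keeps every zero, so the point stays in Y.\<close>
      have "E j = 0" if j: "j \<in> T" for j
      proof (rule single)
        show "j \<in> {1..n}" using j Tn by blast
        fix t
        let ?w = "\<lambda>s. v s + t * (if s \<in> {j} then v s else 0)"
        have "card {i \<in> {1..n}. v i = 0} \<le> card {i \<in> {1..n}. ?w i = 0}"
          by (rule card_mono) auto
        then show "on_arr ?w" using True unfolding on_arr_def by linarith
      qed
      then show ?thesis by blast
    next
      case False
      then obtain S where S: "S \<subseteq> {1..n}" "card S = k" "\<And>i j. i \<in> S \<Longrightarrow> j \<in> S \<Longrightarrow> v i ^ l = v j ^ l"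
        using v unfolding on_arr_def by blast
      have finS: "finite S" using S(1) finite_subset by blast
      have keep: "on_arr w" if "R \<subseteq> {1..n}" "card R = k" "\<And>i j. i \<in> R \<Longrightarrow> j \<in> R \<Longrightarrow> w i ^ l = w j ^ l" for R w
        using that unfolding on_arr_def by blast
      show ?thesis
      proof (cases "S \<inter> T = {}")
        case True
        have "E j = 0" if j: "j \<in> T" for j
        proof (rule single)
          show "j \<in> {1..n}" using j Tn by blast
          have "j \<notin> S" using True j by blast
          show "on_arr (\<lambda>s. v s + t * (if s \<in> {j} then v s else 0))" for t
          proof (rule keep[OF S(1,2)])
            fix a b assume ab: "a \<in> S" "b \<in> S"
            then have "a \<noteq> j" "b \<noteq> j" using \<open>j \<notin> S\<close> by auto
            then show "(v a + t * (if a \<in> {j} then v a else 0)) ^ l = (v b + t * (if b \<in> {j} then v b else 0)) ^ l"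
              using S(3)[OF ab] by simp
          qed
        qed
        then show ?thesis by blast
      next
        case False
        then obtain s where s: "s \<in> S" "s \<in> T" by blast
        have ST: "S \<subseteq> T"
        proof
          fix j assume j: "j \<in> S"
          then have "v j ^ l = v s ^ l" by (rule S(3)[OF _ s(1)])
          then show "j \<in> T" using j S(1) s(2) by (auto simp: T_def)
        qed
        have Teq: "v a ^ l = v b ^ l" if "a \<in> T" "b \<in> T" for a b using that by (simp add: T_def)
        show ?thesis
        proof (cases "card T = k")
          case True
          have "(\<Sum>j\<in>T. E j) = 0"
            unfolding E_def
          proof (rule euler_sum_zero[OF f Tn])
            show "on_arr (\<lambda>j. v j + t * (if j \<in> T then v j else 0))" for t
            proof (rule keep[OF Tn True])
              fix a b assume ab: "a \<in> T" "b \<in> T"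
              have "v c + t * (if c \<in> T then v c else 0) = (1 + t) * v c" if "c \<in> T" for c
                using that by (simp add: algebra_simps)
              then show "(v a + t * (if a \<in> T then v a else 0)) ^ l = (v b + t * (if b \<in> T then v b else 0)) ^ l"
                using Teq[OF ab] ab by (simp only: power_mult_distrib)
            qed
          qed
          then show ?thesis using True by blast
        next
          case False
          then have gt: "k < card T" using card_mono[OF finT ST] S(2) by simp
          \<comment> \<open>Without coordinate j there are still k in \<open>T\<close>, so j can be
            scaled alone.\<close>
          have "E j = 0" if j: "j \<in> T" for j
          proof (rule single)
            show "j \<in> {1..n}" using j Tn by blast
            have "k \<le> card (T - {j})" using gt j finT by simp
            then obtain R where R: "R \<subseteq> T - {j}" "card R = k" by (meson obtain_subset_with_card_n)
            show "on_arr (\<lambda>s. v s + t * (if s \<in> {j} then v s else 0))" for t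
            proof (rule keep)
              show "R \<subseteq> {1..n}" "card R = k" using R Tn by auto
              fix a b assume "a \<in> R" "b \<in> R"
              then have "a \<in> T" "b \<in> T" "a \<noteq> j" "b \<noteq> j" using R(1) by auto
              then show "(v a + t * (if a \<in> {j} then v a else 0)) ^ l = (v b + t * (if b \<in> {j} then v b else 0)) ^ l"
                using Teq[of a b] by simp
            qed
          qed
          then show ?thesis by blast
        qed
      qed
    qed
    then show ?thesis
    proof
      assume "\<forall>j\<in>T. E j = 0"
      then show ?thesis using z iT by simp
    next
      assume "card T = k \<and> (\<Sum>j\<in>T. E j) = 0"
      then show ?thesis using z k2 by simp
    qed
  qed
  then show ?thesis using f i dunkl_z_poly_ring[OF i, of f] by (simp add: ideal_def)
qed

end

section \<open>Leading exponents of the ideal\<close>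

lemma digit_sum_less:
  fixes a :: "nat \<Rightarrow> nat"
  assumes "B > 0" "\<And>t. t \<in> {1..n} \<Longrightarrow> a t < B"
  shows "(\<Sum>t\<in>{1..n}. a t * B ^ t) < B * B ^ n"
  using assms
proof (induction n)
  case 0
  then show ?case by simp
next
  case (Suc n)
  have "(\<Sum>t\<in>{1..n}. a t * B ^ t) < B * B ^ n" using Suc by simp
  moreover have "(a (Suc n) + 1) * B ^ Suc n \<le> B * B ^ Suc n"
    using Suc.prems(2)[of "Suc n"] by (intro mult_right_mono) auto
  ultimately show ?case by simp
qed

lemma digits_unique:
  fixes a b :: "nat \<Rightarrow> nat"
  assumes "\<And>t. t \<in> {1..n} \<Longrightarrow> a t < B" "\<And>t. t \<in> {1..n} \<Longrightarrow> b t < B"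
    and "(\<Sum>t\<in>{1..n}. a t * B ^ t) = (\<Sum>t\<in>{1..n}. b t * B ^ t)" and "t \<in> {1..n}"
  shows "a t = b t"
  using assms
proof (induction n)
  case (Suc n)
  let ?A = "\<Sum>t\<in>{1..n}. a t * B ^ t" and ?B = "\<Sum>t\<in>{1..n}. b t * B ^ t"
  have "B > 0" using Suc.prems(1)[of "Suc n"] by simp
  then have less: "?A < B ^ Suc n" "?B < B ^ Suc n"
    using digit_sum_less[of B n a] digit_sum_less[of B n b] Suc.prems(1,2) by simp_all
  have eq: "?A + B ^ Suc n * a (Suc n) = ?B + B ^ Suc n * b (Suc n)"
    using Suc.prems(3) by (simp add: mult.commute)
  have "(x + C * c) div C = c" if "x < C" for x c C :: nat using that by simp
  then have top: "a (Suc n) = b (Suc n)" using eq less by metis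
  then have "?A = ?B" using eq by simp
  then have "t \<in> {1..n} \<Longrightarrow> a t = b t" using Suc.IH Suc.prems(1,2) by simp
  then show ?case using top Suc.prems(4) by (cases "t = Suc n") auto
qed simp

text \<open>
  Kronecker substitution \<open>w t = T\<^bsup>B ^ t\<^esup>\<close> reduces this to polynomials in one variable.
\<close>

lemma kronecker:
  fixes f :: "complex mpoly"
  assumes f: "f \<in> poly_ring n" and h: "\<And>i. i \<in> {1..n} \<Longrightarrow> h i \<in> {1..n}"
    and vanish: "\<And>w. eval (\<lambda>i. c i * w (h i)) f = 0"
    and \<alpha>: "\<alpha> \<in> keys f"
  shows "(\<Sum>\<nu>\<in>{\<nu> \<in> keys f. \<forall>t\<in>{1..n}. (\<Sum>i\<in>{i \<in> {1..n}. h i = t}. lookup \<nu> i) =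
      (\<Sum>i\<in>{i \<in> {1..n}. h i = t}. lookup \<alpha> i)}.
    lookup f \<nu> * (\<Prod>i\<in>{1..n}. c i ^ lookup \<nu> i)) = 0"
proof -
  \<comment> \<open>\<open>B\<close> exceeds the total degree of every monomial of f, so the sums of
    exponents over the fibres of \<open>h\<close> are digits in base \<open>B\<close> and can be
    read off from \<open>N\<close>.\<close>
  define B where "B = Suc (\<Sum>\<nu>\<in>keys f. \<Sum>i\<in>{1..n}. lookup \<nu> i)"
  have B: "(\<Sum>i\<in>{1..n}. lookup \<nu> i) < B" if "\<nu> \<in> keys f" for \<nu>
    unfolding B_def less_Suc_eq_le
    by (rule member_le_sum[OF that, of "\<lambda>\<nu>. \<Sum>i\<in>{1..n}. lookup \<nu> i"]) auto
  define a where "a \<nu> t = (\<Sum>i\<in>{i \<in> {1..n}. h i = t}. lookup \<nu> i)" for \<nu> :: "nat \<Rightarrow>\<^sub>0 nat" and t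
  define N where "N \<nu> = (\<Sum>i\<in>{1..n}. B ^ h i * lookup \<nu> i)" for \<nu>
  define C where "C \<nu> = (\<Prod>i\<in>{1..n}. c i ^ lookup \<nu> i)" for \<nu>
  have N: "N \<nu> = (\<Sum>t\<in>{1..n}. a \<nu> t * B ^ t)" for \<nu>
  proof -
    have "N \<nu> = (\<Sum>t\<in>{1..n}. \<Sum>i\<in>{i \<in> {1..n}. h i = t}. B ^ h i * lookup \<nu> i)"
      unfolding N_def by (rule sum.group[symmetric]) (use h in auto)
    also have "\<dots> = (\<Sum>t\<in>{1..n}. a \<nu> t * B ^ t)"
    proof (rule sum.cong[OF refl])
      fix t
      show "(\<Sum>i\<in>{i \<in> {1..n}. h i = t}. B ^ h i * lookup \<nu> i) = a \<nu> t * B ^ t"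
        unfolding a_def sum_distrib_right by (rule sum.cong) auto
    qed
    finally show ?thesis .
  qed
  have aB: "a \<nu> t < B" if "\<nu> \<in> keys f" for \<nu> t
  proof -
    have "a \<nu> t \<le> (\<Sum>i\<in>{1..n}. lookup \<nu> i)" unfolding a_def by (rule sum_mono2) auto
    then show ?thesis using B[OF that] by simp
  qed
  define p where "p = (\<Sum>\<nu>\<in>keys f. monom (lookup f \<nu> * C \<nu>) (N \<nu>))"
  have "poly p T = 0" for T
  proof -
    have "poly p T = (\<Sum>\<nu>\<in>keys f. lookup f \<nu> * monom_val (\<lambda>i. c i * T ^ (B ^ h i)) \<nu>)"
      unfolding p_def poly_sum poly_monom
    proof (rule sum.cong[OF refl])
      fix \<nu> assume "\<nu> \<in> keys f"
      then have "keys \<nu> \<subseteq> {1..n}" using f by (auto simp: poly_ring_def compositions_def)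
      then have "monom_val (\<lambda>i. c i * T ^ (B ^ h i)) \<nu> = (\<Prod>i\<in>{1..n}. (c i * T ^ (B ^ h i)) ^ lookup \<nu> i)"
        by (intro monom_val_superset) auto
      also have "\<dots> = C \<nu> * T ^ N \<nu>"
        unfolding power_mult_distrib prod.distrib C_def N_def power_sum power_mult ..
      finally show "lookup f \<nu> * C \<nu> * T ^ N \<nu> = lookup f \<nu> * monom_val (\<lambda>i. c i * T ^ (B ^ h i)) \<nu>"
        by (simp only: mult.assoc)
    qed
    then show ?thesis using vanish[of "\<lambda>t. T ^ (B ^ t)"] by (simp add: eval_eq)
  qed
  then have "p = 0" using poly_all_0_iff_0 by blast
  then have "0 = poly.coeff p (N \<alpha>)" by simp
  also have "\<dots> = (\<Sum>\<nu>\<in>keys f. if N \<nu> = N \<alpha> then lookup f \<nu> * C \<nu> else 0)"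
    unfolding p_def coeff_sum by (rule sum.cong[OF refl]) (rule coeff_monom)
  also have "\<dots> = (\<Sum>\<nu>\<in>{\<nu> \<in> keys f. N \<nu> = N \<alpha>}. lookup f \<nu> * C \<nu>)"
    by (rule sum.inter_filter[symmetric]) simp
  also have "{\<nu> \<in> keys f. N \<nu> = N \<alpha>} = {\<nu> \<in> keys f. \<forall>t\<in>{1..n}. a \<nu> t = a \<alpha> t}"
  proof (rule Collect_cong, rule conj_cong[OF refl], rule iffI)
    fix \<nu> assume "\<nu> \<in> keys f" "N \<nu> = N \<alpha>"
    then show "\<forall>t\<in>{1..n}. a \<nu> t = a \<alpha> t"
      using digits_unique[of n "a \<nu>" B "a \<alpha>"] aB[of \<nu>] aB[OF \<alpha>] unfolding N by blast
  next
    fix \<nu> assume "\<forall>t\<in>{1..n}. a \<nu> t = a \<alpha> t"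
    then show "N \<nu> = N \<alpha>" unfolding N by (intro sum.cong) auto
  qed
  finally show ?thesis unfolding a_def C_def by simp
qed

text \<open>Keys in a half-open window of length (n + 1) l are as close together as shifts by
  multiples of that length allow: their sum of squares is minimal for the given total, and every
  nonzero shift with total 0 raises it.\<close>

lemma psi_window:
  fixes s :: "nat \<Rightarrow> int"
  assumes S: "S \<subseteq> {1..n}" and window: "\<And>i. i \<in> S \<Longrightarrow> b \<le> kap n \<alpha> i \<and> kap n \<alpha> i < b + int (Suc n) * int l"
    and off: "\<And>i. i \<in> {1..n} - S \<Longrightarrow> lookup \<nu> i = lookup \<alpha> i"
    and on: "\<And>i. i \<in> S \<Longrightarrow> int (lookup \<nu> i) = int (lookup \<alpha> i) + int l * s i"
    and sum0: "(\<Sum>i\<in>S. s i) = 0" and ne: "\<exists>i\<in>S. s i \<noteq> 0"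
  shows "psi n \<alpha> < psi n \<nu>"
proof -
  define M where "M = int (Suc n) * int l"
  have fin: "finite S" using S finite_subset by blast
  have M: "M > 0"
  proof -
    obtain i where "i \<in> S" using ne by blast
    then show ?thesis using window[of i] unfolding M_def by linarith
  qed
  have split: "psi n \<beta> = (\<Sum>t\<in>{1..n} - S. (kap n \<beta> t)\<^sup>2) + (\<Sum>t\<in>S. (kap n \<beta> t)\<^sup>2)" for \<beta>
    unfolding psi_def by (rule sum.subset_diff) (use S in auto)
  have same: "(\<Sum>t\<in>{1..n} - S. (kap n \<nu> t)\<^sup>2) = (\<Sum>t\<in>{1..n} - S. (kap n \<alpha> t)\<^sup>2)"
    by (rule sum.cong[OF refl]) (simp add: kap_def off)
  have kap: "kap n \<nu> i = kap n \<alpha> i + M * s i" if "i \<in> S" for i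
    using on[OF that] by (simp add: kap_def M_def algebra_simps)
  \<comment> \<open>M e_i is the change of the i-th square up to a multiple of s_i that cancels in
    the sum; this correction makes every e_i nonnegative, and positive for a negative shift.\<close>
  define e where "e i = 2 * s i * (kap n \<alpha> i - b) + M * (s i)\<^sup>2 - M * s i" for i
  have e: "e i \<ge> 0 \<and> (s i < 0 \<longrightarrow> e i > 0)" if i: "i \<in> S" for i
  proof -
    define x where "x = kap n \<alpha> i - b"
    have x: "0 \<le> x" "x \<le> M - 1" using window[OF i] by (auto simp: x_def M_def)
    have ee: "e i = s i * (2 * x + M * s i - M)"
      by (simp add: e_def x_def power2_eq_square algebra_simps)
    show ?thesis
    proof (cases "s i" "0 :: int" rule: linorder_cases)
      case less
      then have "M * s i \<le> M * (-1)" using M by (intro mult_left_mono) auto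
      then have "2 * x + M * s i - M < 0" using x by linarith
      then show ?thesis unfolding ee using less mult_neg_neg by (metis less_imp_le)
    next
      case equal
      then show ?thesis unfolding ee by simp
    next
      case greater
      then have "M * 1 \<le> M * s i" using M by (intro mult_left_mono) auto
      then have "2 * x + M * s i - M \<ge> 0" using x by linarith
      then show ?thesis unfolding ee using greater by simp
    qed
  qed
  have "\<exists>i\<in>S. s i < 0"
  proof (rule ccontr)
    assume "\<not> ?thesis"
    then have "\<forall>i\<in>S. 0 \<le> s i" by auto
    then have "\<forall>i\<in>S. s i = 0" using sum0 sum_nonneg_eq_0_iff[OF fin, of s] by blast
    then show False using ne by blast
  qed
  then obtain i where "i \<in> S" "e i > 0" using e by blast
  then have pos: "(\<Sum>i\<in>S. e i) > 0" using e fin by (intro sum_pos2[of S i]) auto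
  have "(\<Sum>t\<in>S. (kap n \<nu> t)\<^sup>2) = (\<Sum>t\<in>S. (kap n \<alpha> t)\<^sup>2 + M * e t + M * (2 * b + M) * s t)"
    by (rule sum.cong[OF refl]) (simp add: kap e_def power2_eq_square algebra_simps)
  also have "\<dots> = (\<Sum>t\<in>S. (kap n \<alpha> t)\<^sup>2) + M * (\<Sum>t\<in>S. e t)"
    using sum0 by (simp add: sum.distrib flip: sum_distrib_left)
  finally show ?thesis unfolding split[of \<nu>] split[of \<alpha>] same using M pos by simp
qed

context arrangement
begin

definition M :: "(nat \<Rightarrow>\<^sub>0 nat) set" where
  "M = {\<mu> \<in> compositions n. nondec n \<mu> (m + 1) \<ge> 1 \<and> admissible n l k \<mu>}"

text \<open>f vanishes on the subspace where the coordinates in the zero set of \<alpha> are 0,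
  while the monomial x^\<alpha> survives restriction to it.\<close>

lemma lead_zeros:
  assumes f: "f \<in> ideal" and \<alpha>: "\<alpha> \<in> keys f"
  shows "nondec n \<alpha> (m + 1) \<ge> 1"
proof (rule ccontr)
  assume "\<not> ?thesis"
  then have zero: "lookup \<alpha> (pos n \<alpha> m) = 0"
    using nondec_pos[of "m + 1" n \<alpha>] mk kn k2 by simp
  have fr: "f \<in> poly_ring n" using f by (simp add: ideal_def)
  define Z where "Z = {i \<in> {1..n}. lookup \<alpha> i = 0}"
  have "pos n \<alpha> ` {..m} \<subseteq> Z"
  proof
    fix i assume "i \<in> pos n \<alpha> ` {..m}"
    then obtain r where r: "r \<le> m" "i = pos n \<alpha> r" by auto
    have "r < n" "m < n" using r(1) mk kn k2 by auto
    then show "i \<in> Z"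
      using r zero lookup_pos_le[OF r(1), of n \<alpha>] pos_in[of r n \<alpha>] by (simp add: Z_def)
  qed
  moreover have "card (pos n \<alpha> ` {..m}) = m + 1"
  proof -
    have "inj_on (pos n \<alpha>) {..m}"
      by (rule inj_on_subset[of _ "{..<n}"]) (use pos_bij[of n \<alpha>] mk kn k2 in \<open>auto simp: bij_betw_def\<close>)
    then show ?thesis by (simp add: card_image)
  qed
  ultimately have cardZ: "m + 1 \<le> card Z"
    using card_mono[of Z "pos n \<alpha> ` {..m}"] by (simp add: Z_def)
  define c where "c i = (if i \<in> Z then 0 else 1 :: complex)" for i
  have eq1: "(\<Sum>\<nu>\<in>{\<nu> \<in> keys f. \<forall>t\<in>{1..n}. (\<Sum>i\<in>{i \<in> {1..n}. i = t}. lookup \<nu> i) =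
      (\<Sum>i\<in>{i \<in> {1..n}. i = t}. lookup \<alpha> i)}.
    lookup f \<nu> * (\<Prod>i\<in>{1..n}. c i ^ lookup \<nu> i)) = 0"
  proof (rule kronecker[OF fr])
    show "eval (\<lambda>i. c i * w i) f = 0" for w
    proof -
      have "card Z \<le> card {i \<in> {1..n}. c i * w i = 0}"
        by (rule card_mono) (auto simp: c_def Z_def)
      then have "on_arr (\<lambda>i. c i * w i)" unfolding on_arr_def using cardZ by linarith
      then show ?thesis using f by (simp add: ideal_def)
    qed
  qed (use \<alpha> in auto)
  have "{\<nu> \<in> keys f. \<forall>t\<in>{1..n}. (\<Sum>i\<in>{i \<in> {1..n}. i = t}. lookup \<nu> i) =
      (\<Sum>i\<in>{i \<in> {1..n}. i = t}. lookup \<alpha> i)} = {\<alpha>}"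
  proof (intro equalityI subsetI)
    fix \<nu> assume \<nu>: "\<nu> \<in> {\<nu> \<in> keys f. \<forall>t\<in>{1..n}. (\<Sum>i\<in>{i \<in> {1..n}. i = t}. lookup \<nu> i) =
      (\<Sum>i\<in>{i \<in> {1..n}. i = t}. lookup \<alpha> i)}"
    have "lookup \<nu> t = lookup \<alpha> t" if t: "t \<in> {1..n}" for t
    proof -
      have "(\<Sum>i\<in>{i \<in> {1..n}. i = t}. lookup \<nu> i) = (\<Sum>i\<in>{i \<in> {1..n}. i = t}. lookup \<alpha> i)"
        using \<nu> t by blast
      moreover have "{i \<in> {1..n}. i = t} = {t}" using t by auto
      ultimately show ?thesis by simp
    qed
    moreover have "\<nu> \<in> compositions n" "\<alpha> \<in> compositions n"
      using \<nu> \<alpha> fr by (auto simp: poly_ring_def)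
    ultimately show "\<nu> \<in> {\<alpha>}" using composition_eqI[of \<nu> n \<alpha>] by simp
  qed (use \<alpha> in simp)
  then have "lookup f \<alpha> * (\<Prod>i\<in>{1..n}. c i ^ lookup \<alpha> i) = 0" using eq1 by simp
  \<comment> \<open>On \<open>Z\<close> both c_i and \<alpha>_i are 0, and 0^0 = 1.\<close>
  moreover have "(\<Prod>i\<in>{1..n}. c i ^ lookup \<alpha> i) = 1"
    by (rule prod.neutral) (simp add: c_def Z_def)
  ultimately have "lookup f \<alpha> = 0" by (simp only: mult_1_right)
  then show False using \<alpha> by (simp add: in_keys_iff)
qed

text \<open>If the gap fails at rank r, the k keys from rank r on lie in a window of length (n + 1)
  l. On the components of X where these k coordinates agree up to powers of \<zeta>, averaging
  against characters isolates the exponents obtained from \<alpha> by shifts in multiples of l with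
  total 0. By \<open>psi_window\<close> only \<alpha> itself can occur among them, so its
  coefficient vanishes.\<close>

lemma lead_admissible:
  assumes f: "f \<in> ideal" and \<alpha>: "\<alpha> \<in> keys f" and lead: "\<And>\<nu>. \<nu> \<in> keys f \<Longrightarrow> psi n \<nu> \<le> psi n \<alpha>"
  shows "admissible n l k \<alpha>"
proof (rule ccontr)
  assume "\<not> ?thesis"
  then obtain r where r: "r + (k - 1) < n"
    and le: "\<not> kap n \<alpha> (pos n \<alpha> r) + int (Suc n) * int l < kap n \<alpha> (pos n \<alpha> (r + (k - 1)))"
    unfolding admissible_kap[OF k2 kn] by blast
  have fr: "f \<in> poly_ring n" using f by (simp add: ideal_def)
  define s0 where "s0 = pos n \<alpha> r"
  define S where "S = pos n \<alpha> ` {r..r + (k - 1)}"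
  define b where "b = kap n \<alpha> s0"
  have rn: "r < n" using r by simp
  have inj: "inj_on (pos n \<alpha>) {r..r + (k - 1)}"
    by (rule inj_on_subset[of _ "{..<n}"]) (use pos_bij[of n \<alpha>] r in \<open>auto simp: bij_betw_def\<close>)
  have cardS: "card S = k" unfolding S_def using card_image[OF inj] k2 by simp
  have Sn: "S \<subseteq> {1..n}"
  proof
    fix i assume "i \<in> S"
    then obtain t where "t \<le> r + (k - 1)" "i = pos n \<alpha> t" by (auto simp: S_def)
    then show "i \<in> {1..n}" using pos_in[of t n \<alpha>] r by simp
  qed
  have finS: "finite S" by (simp add: S_def)
  have s0: "s0 \<in> S" by (simp add: S_def s0_def)
  have s0n: "s0 \<in> {1..n}" using s0 Sn by blast
  have "pos n \<alpha> (r + (k - 1)) \<noteq> s0"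
  proof
    assume "pos n \<alpha> (r + (k - 1)) = s0"
    then have "r + (k - 1) = r" unfolding s0_def by (rule inj_onD[OF inj]) simp_all
    then show False using k2 by simp
  qed
  \<comment> \<open>Keys at distinct positions never differ by exactly (n + 1) l, so the failed
    inequality puts the last key strictly inside the window.\<close>
  then have top: "kap n \<alpha> (pos n \<alpha> (r + (k - 1))) < b + int (Suc n) * int l"
    using le kap_gap_ne[OF pos_in[OF r, of \<alpha>] s0n, of \<alpha> l] unfolding b_def s0_def by linarith
  have window: "b \<le> kap n \<alpha> i \<and> kap n \<alpha> i < b + int (Suc n) * int l" if iS: "i \<in> S" for i
  proof -
    obtain t where t: "r \<le> t" "t \<le> r + (k - 1)" "i = pos n \<alpha> t" using iS unfolding S_def by auto
    have "t < n" using t(2) r by simp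
    then show ?thesis
      using kap_pos_le[OF t(1), of n \<alpha>] kap_pos_le[OF t(2) r, of \<alpha>] top
      unfolding b_def s0_def t(3) by linarith
  qed
  define h where "h i = (if i \<in> S then s0 else i)" for i
  define C where "C = {\<nu> \<in> keys f. \<forall>t\<in>{1..n}. (\<Sum>i\<in>{i \<in> {1..n}. h i = t}. lookup \<nu> i) =
      (\<Sum>i\<in>{i \<in> {1..n}. h i = t}. lookup \<alpha> i)}"
  have finC: "finite C" by (simp add: C_def)
  have fibre0: "{i \<in> {1..n}. h i = s0} = S" using s0 Sn by (auto simp: h_def)
  have fibre: "{i \<in> {1..n}. h i = t} = {t}" if "t \<in> {1..n} - S" for t
    using that s0 by (auto simp: h_def)
  have C_off: "lookup \<nu> t = lookup \<alpha> t" if "\<nu> \<in> C" "t \<in> {1..n} - S" for \<nu> t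
  proof -
    have "(\<Sum>i\<in>{i \<in> {1..n}. h i = t}. lookup \<nu> i) = (\<Sum>i\<in>{i \<in> {1..n}. h i = t}. lookup \<alpha> i)"
      using that by (simp add: C_def)
    then show ?thesis unfolding fibre[OF that(2)] by simp
  qed
  have C_on: "(\<Sum>i\<in>S. lookup \<nu> i) = (\<Sum>i\<in>S. lookup \<alpha> i)" if "\<nu> \<in> C" for \<nu>
  proof -
    have "(\<Sum>i\<in>{i \<in> {1..n}. h i = s0}. lookup \<nu> i) = (\<Sum>i\<in>{i \<in> {1..n}. h i = s0}. lookup \<alpha> i)"
      using that s0n by (simp add: C_def)
    then show ?thesis unfolding fibre0 .
  qed
  have main: "(\<Sum>\<nu>\<in>C. lookup f \<nu> * (\<Prod>i\<in>S. (\<zeta> ^ \<rho> i) ^ lookup \<nu> i)) = 0" for \<rho>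
  proof -
    define c where "c i = (if i \<in> S then \<zeta> ^ \<rho> i else 1)" for i
    have "(\<Sum>\<nu>\<in>C. lookup f \<nu> * (\<Prod>i\<in>{1..n}. c i ^ lookup \<nu> i)) = 0"
      unfolding C_def
    proof (rule kronecker[OF fr])
      show "h i \<in> {1..n}" if "i \<in> {1..n}" for i using that s0n by (simp add: h_def)
      show "eval (\<lambda>i. c i * w (h i)) f = 0" for w
      proof -
        have "(c i * w (h i)) ^ l = w s0 ^ l" if "i \<in> S" for i
          using that by (simp add: c_def h_def power_mult_distrib zeta_l)
        then have "\<forall>i\<in>S. \<forall>j\<in>S. (c i * w (h i)) ^ l = (c j * w (h j)) ^ l" by simp
        then have "on_arr (\<lambda>i. c i * w (h i))"
          unfolding on_arr_def by (intro disjI1 exI[of _ S] conjI Sn cardS)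
        then show ?thesis using f by (simp add: ideal_def)
      qed
    qed (rule \<alpha>)
    moreover have "(\<Prod>i\<in>{1..n}. c i ^ lookup \<nu> i) = (\<Prod>i\<in>S. (\<zeta> ^ \<rho> i) ^ lookup \<nu> i)" for \<nu>
      by (rule prod.mono_neutral_cong_right) (use Sn in \<open>auto simp: c_def\<close>)
    ultimately show ?thesis by simp
  qed
  \<comment> \<open>Summing over all choices of the powers of \<zeta>, weighted by the inverse
    character of \<alpha>, keeps only the exponents congruent to \<alpha> on
    \<open>S\<close>.\<close>
  let ?P = "PiE S (\<lambda>_. {..<l})"
  have "0 = (\<Sum>\<rho>\<in>?P. (\<Sum>\<nu>\<in>C. lookup f \<nu> * (\<Prod>i\<in>S. (\<zeta> ^ \<rho> i) ^ lookup \<nu> i)) *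
      (\<Prod>i\<in>S. inverse (\<zeta> ^ \<rho> i) ^ lookup \<alpha> i))"
    unfolding main by simp
  also have "\<dots> = (\<Sum>\<rho>\<in>?P. \<Sum>\<nu>\<in>C. lookup f \<nu> *
      (\<Prod>i\<in>S. (\<zeta> ^ \<rho> i) ^ lookup \<nu> i * inverse (\<zeta> ^ \<rho> i) ^ lookup \<alpha> i))"
    by (simp only: sum_distrib_right prod.distrib mult.assoc)
  also have "\<dots> = (\<Sum>\<nu>\<in>C. lookup f \<nu> * (\<Sum>\<rho>\<in>?P.
      \<Prod>i\<in>S. (\<zeta> ^ \<rho> i) ^ lookup \<nu> i * inverse (\<zeta> ^ \<rho> i) ^ lookup \<alpha> i))"
    by (subst sum.swap) (simp only: sum_distrib_left)
  also have "\<dots> = (\<Sum>\<nu>\<in>C. if \<nu> = \<alpha> then lookup f \<alpha> * of_nat l ^ k else 0)"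
  proof (rule sum.cong[OF refl])
    fix \<nu> assume \<nu>: "\<nu> \<in> C"
    have "(\<Sum>\<rho>\<in>?P. \<Prod>i\<in>S. (\<zeta> ^ \<rho> i) ^ lookup \<nu> i * inverse (\<zeta> ^ \<rho> i) ^ lookup \<alpha> i) =
        (\<Prod>i\<in>S. \<Sum>x<l. (\<zeta> ^ x) ^ lookup \<nu> i * inverse (\<zeta> ^ x) ^ lookup \<alpha> i)"
      by (rule prod_sum_PiE[symmetric]) (use finS in auto)
    also have "\<dots> = (\<Prod>i\<in>S. if lookup \<nu> i mod l = lookup \<alpha> i mod l then of_nat l else 0)"
      unfolding root_sum ..
    finally have e: "(\<Sum>\<rho>\<in>?P. \<Prod>i\<in>S. (\<zeta> ^ \<rho> i) ^ lookup \<nu> i * inverse (\<zeta> ^ \<rho> i) ^ lookup \<alpha> i) =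
        (\<Prod>i\<in>S. if lookup \<nu> i mod l = lookup \<alpha> i mod l then of_nat l else (0::complex))" .
    show "lookup f \<nu> * (\<Sum>\<rho>\<in>?P. \<Prod>i\<in>S. (\<zeta> ^ \<rho> i) ^ lookup \<nu> i * inverse (\<zeta> ^ \<rho> i) ^ lookup \<alpha> i) =
        (if \<nu> = \<alpha> then lookup f \<alpha> * of_nat l ^ k else 0)"
    proof (cases "\<nu> = \<alpha>")
      case True
      then show ?thesis unfolding e by (simp add: cardS)
    next
      case False
      have "\<exists>i\<in>S. lookup \<nu> i mod l \<noteq> lookup \<alpha> i mod l"
      proof (rule ccontr)
        assume "\<not> ?thesis"
        then have cong: "lookup \<nu> i mod l = lookup \<alpha> i mod l" if "i \<in> S" for i using that by blast
        define s where "s i = (int (lookup \<nu> i) - int (lookup \<alpha> i)) div int l" for i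
        have s: "int (lookup \<nu> i) = int (lookup \<alpha> i) + int l * s i" if "i \<in> S" for i
        proof -
          have "int (lookup \<nu> i) mod int l = int (lookup \<alpha> i) mod int l"
            using cong[OF that] by (metis of_nat_mod)
          then have "int l dvd int (lookup \<nu> i) - int (lookup \<alpha> i)" by (simp add: mod_eq_dvd_iff)
          then show ?thesis by (simp add: s_def)
        qed
        have "(\<Sum>i\<in>S. int (lookup \<nu> i)) = (\<Sum>i\<in>S. int (lookup \<alpha> i))"
          using C_on[OF \<nu>] by (metis of_nat_sum)
        moreover have "(\<Sum>i\<in>S. int (lookup \<nu> i)) = (\<Sum>i\<in>S. int (lookup \<alpha> i)) + int l * (\<Sum>i\<in>S. s i)"
          using s by (simp add: sum.distrib sum_distrib_left)
        ultimately have sum0: "(\<Sum>i\<in>S. s i) = 0" using l_pos by simp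
        have comp: "\<nu> \<in> compositions n" "\<alpha> \<in> compositions n"
          using \<nu> \<alpha> fr by (auto simp: C_def poly_ring_def)
        have "\<exists>i\<in>S. s i \<noteq> 0"
        proof (rule ccontr)
          assume n0: "\<not> ?thesis"
          have "\<nu> = \<alpha>"
          proof (rule composition_eqI[OF comp])
            fix i assume i: "i \<in> {1..n}"
            show "lookup \<nu> i = lookup \<alpha> i"
            proof (cases "i \<in> S")
              case True
              then have "s i = 0" using n0 by blast
              then show ?thesis using s[OF True] by simp
            next
              case False
              then show ?thesis using C_off[OF \<nu>, of i] i by simp
            qed
          qed
          then show False using False by simp
        qed
        then have "psi n \<alpha> < psi n \<nu>"
          using psi_window[OF Sn window C_off[OF \<nu>] s sum0] by simp
        moreover have "psi n \<nu> \<le> psi n \<alpha>" using lead \<nu> by (simp add: C_def)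
        ultimately show False by simp
      qed
      then have "(\<Prod>i\<in>S. if lookup \<nu> i mod l = lookup \<alpha> i mod l then of_nat l else (0::complex)) = 0"
        using finS by (auto simp: prod_zero_iff)
      then show ?thesis unfolding e using False by simp
    qed
  qed
  also have "\<dots> = lookup f \<alpha> * of_nat l ^ k"
    using finC \<alpha> by (simp add: C_def)
  finally show False using \<alpha> l_pos by (simp add: in_keys_iff)
qed

lemma lead_in_M:
  assumes "f \<in> ideal" "\<alpha> \<in> keys f" "\<And>\<nu>. \<nu> \<in> keys f \<Longrightarrow> psi n \<nu> \<le> psi n \<alpha>"
  shows "\<alpha> \<in> M"
  using lead_zeros[OF assms(1,2)] lead_admissible[OF assms] assms(1,2)
  by (auto simp: M_def ideal_def poly_ring_def)

end

section \<open>Elements of the ideal with prescribed leading exponent\<close>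

text \<open>Expanding the product of the Vandermonde determinants over the classes of
  \<open>c\<close> gives one signed monomial for each of these permutations.\<close>

definition class_perms :: "nat \<Rightarrow> (nat \<Rightarrow> nat) \<Rightarrow> (nat \<Rightarrow> nat) set" where
  "class_perms n c = {\<sigma>. \<sigma> permutes {..<n} \<and> (\<forall>j<n. c (\<sigma> j) = c j)}"

lemma finite_class_perms: "finite (class_perms n c)"
  by (rule finite_subset[OF _ finite_permutations[of "{..<n}"]]) (auto simp: class_perms_def)

lemma class_perms_swap:
  assumes "\<sigma> \<in> class_perms n c" "x < n" "y < n" "c x = c y"
  shows "\<sigma> \<circ> transpose x y \<in> class_perms n c"
proof -
  have "\<sigma> \<circ> transpose x y permutes {..<n}"
    by (rule permutes_compose[OF permutes_swap_id]) (use assms in \<open>auto simp: class_perms_def\<close>)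
  moreover have "c ((\<sigma> \<circ> transpose x y) j) = c j" if "j < n" for j
    using assms that by (auto simp: class_perms_def transpose_def)
  ultimately show ?thesis by (simp add: class_perms_def)
qed

text \<open>Let x be the least moved point and y its preimage: everything below x is fixed, so x < y
  and \<sigma> y = x < \<sigma> x.\<close>

lemma class_perms_descent:
  assumes \<sigma>: "\<sigma> \<in> class_perms n c" and ne: "\<sigma> \<noteq> id"
  obtains x y where "x < y" "y < n" "c x = c y" "\<sigma> y < \<sigma> x"
proof -
  have p: "\<sigma> permutes {..<n}" using \<sigma> by (simp add: class_perms_def)
  have inj: "\<sigma> a = \<sigma> b \<longleftrightarrow> a = b" for a b using permutes_inj[OF p] by (auto simp: inj_def)
  obtain j0 where "\<sigma> j0 \<noteq> j0" using ne by (metis eq_id_iff)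
  define x where "x = (LEAST j. \<sigma> j \<noteq> j)"
  have x: "\<sigma> x \<noteq> x" unfolding x_def using LeastI[of "\<lambda>j. \<sigma> j \<noteq> j" j0] \<open>\<sigma> j0 \<noteq> j0\<close> by simp
  have min: "\<sigma> j = j" if "j < x" for j using not_less_Least[of j "\<lambda>j. \<sigma> j \<noteq> j"] that by (simp add: x_def)
  have "\<not> \<sigma> x < x" using min[of "\<sigma> x"] inj[of "\<sigma> x" x] x by auto
  then have gt: "x < \<sigma> x" using x by simp
  define y where "y = inv \<sigma> x"
  have y: "\<sigma> y = x" using permutes_inverses(1)[OF p] by (simp add: y_def)
  have "y \<noteq> x" using x y by auto
  moreover have "\<not> y < x" using min[of y] y by auto
  ultimately have "x < y" by simp
  moreover have yn: "y < n" using permutes_not_in[OF p, of y] y \<open>y \<noteq> x\<close> by auto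
  moreover have "c x = c y" using \<sigma> yn y by (auto simp: class_perms_def)
  moreover have "\<sigma> y < \<sigma> x" using gt y by simp
  ultimately show ?thesis by (rule that)
qed

text \<open>The rearrangement inequality within classes: exchanging the values at a descent
  increases the sum strictly, so the identity is the only maximizer.\<close>

lemma rearrangement_strict:
  fixes a b :: "nat \<Rightarrow> int"
  assumes a: "\<And>x y. x < y \<Longrightarrow> y < n \<Longrightarrow> c x = c y \<Longrightarrow> a x < a y"
    and b: "\<And>x y. x < y \<Longrightarrow> y < n \<Longrightarrow> c x = c y \<Longrightarrow> b x < b y"
    and \<tau>: "\<tau> \<in> class_perms n c" "\<tau> \<noteq> id"
  shows "(\<Sum>j<n. a j * b (\<tau> j)) < (\<Sum>j<n. a j * b j)"
proof -
  let ?R = "\<lambda>\<sigma>. \<Sum>j<n. a j * b (\<sigma> j)"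
  have improve: "\<exists>\<sigma>'\<in>class_perms n c. ?R \<sigma> < ?R \<sigma>'" if \<sigma>: "\<sigma> \<in> class_perms n c" "\<sigma> \<noteq> id" for \<sigma>
  proof -
    obtain x y where xy: "x < y" "y < n" "c x = c y" "\<sigma> y < \<sigma> x"
      by (rule class_perms_descent[OF \<sigma>])
    let ?s = "\<sigma> \<circ> transpose x y"
    have p: "\<sigma> permutes {..<n}" using \<sigma>(1) by (simp add: class_perms_def)
    have s: "?s \<in> class_perms n c" by (rule class_perms_swap[OF \<sigma>(1)]) (use xy in auto)
    have "\<sigma> x < n" using permutes_in_image[OF p, of x] xy by simp
    moreover have "c (\<sigma> y) = c (\<sigma> x)" using \<sigma>(1) xy by (auto simp: class_perms_def)
    ultimately have bb: "b (\<sigma> y) < b (\<sigma> x)" using b[OF xy(4)] by simp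
    have aa: "a x < a y" using a[OF xy(1-3)] .
    have "?R ?s - ?R \<sigma> = (\<Sum>j<n. a j * (b (?s j) - b (\<sigma> j)))"
      by (simp add: sum_subtractf right_diff_distrib)
    also have "\<dots> = (\<Sum>j\<in>{x, y}. a j * (b (?s j) - b (\<sigma> j)))"
      by (rule sum.mono_neutral_right) (use xy in \<open>auto simp: transpose_def\<close>)
    also have "\<dots> = (a y - a x) * (b (\<sigma> x) - b (\<sigma> y))"
      using xy(1) by (simp add: algebra_simps)
    also have "\<dots> > 0" using aa bb by simp
    finally show ?thesis using s by (intro bexI[of _ ?s]) simp_all
  qed
  have "class_perms n c \<noteq> {}" using \<tau>(1) by blast
  then obtain \<sigma> where \<sigma>: "\<sigma> \<in> class_perms n c" "\<And>\<sigma>'. \<sigma>' \<in> class_perms n c \<Longrightarrow> ?R \<sigma>' \<le> ?R \<sigma>"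
    using finite_arg_max_exists[OF finite_class_perms, of n c ?R] by blast
  have "\<sigma> = id"
  proof (rule ccontr)
    assume "\<sigma> \<noteq> id"
    then obtain \<sigma>' where "\<sigma>' \<in> class_perms n c" "?R \<sigma> < ?R \<sigma>'" using improve[OF \<sigma>(1)] by blast
    then show False using \<sigma>(2)[of \<sigma>'] by simp
  qed
  obtain \<tau>' where "\<tau>' \<in> class_perms n c" "?R \<tau> < ?R \<tau>'" using improve[OF \<tau>] by blast
  then show ?thesis using \<sigma>(2)[of \<tau>'] unfolding \<open>\<sigma> = id\<close> by simp
qed

text \<open>A determinant with two equal columns: composing with the transposition of x and y pairs
  terms of opposite sign.\<close>

lemma alternating_sum_zero:
  fixes w :: "nat \<Rightarrow> complex"
  assumes xy: "x < n" "y < n" "x \<noteq> y" "c x = c y" "w x = w y"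
  shows "(\<Sum>\<sigma>\<in>class_perms n c. of_int (sign \<sigma>) * (\<Prod>j<n. w j ^ t (\<sigma> j))) = 0"
proof -
  let ?s = "transpose x y"
  let ?h = "\<lambda>\<sigma>. of_int (sign \<sigma>) * (\<Prod>j<n. w j ^ t (\<sigma> j))"
  have sp: "?s permutes {..<n}" by (rule permutes_swap_id) (use xy in auto)
  have "(\<Sum>\<sigma>\<in>class_perms n c. ?h \<sigma>) = (\<Sum>\<sigma>\<in>class_perms n c. ?h (\<sigma> \<circ> ?s))"
  proof (rule sum.reindex_bij_witness[of _ "\<lambda>\<sigma>. \<sigma> \<circ> ?s" "\<lambda>\<sigma>. \<sigma> \<circ> ?s"])
    fix \<sigma> assume "\<sigma> \<in> class_perms n c"
    then show "\<sigma> \<circ> ?s \<in> class_perms n c" by (rule class_perms_swap) (use xy in auto)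
    then show "\<sigma> \<circ> ?s \<in> class_perms n c" .
  qed (simp_all add: comp_assoc)
  also have "\<dots> = (\<Sum>\<sigma>\<in>class_perms n c. - ?h \<sigma>)"
  proof (rule sum.cong[OF refl])
    fix \<sigma> assume "\<sigma> \<in> class_perms n c"
    then have p: "\<sigma> permutes {..<n}" by (simp add: class_perms_def)
    have "sign (\<sigma> \<circ> ?s) = sign \<sigma> * sign ?s"
      by (rule sign_compose) (use p sp in \<open>auto intro: permutes_imp_permutation[of "{..<n}"]\<close>)
    then have sg: "sign (\<sigma> \<circ> ?s) = - sign \<sigma>" using xy(3) by (simp add: sign_swap_id)
    have "(\<Prod>j<n. w j ^ t (\<sigma> j)) = (\<Prod>j<n. w (?s j) ^ t (\<sigma> (?s j)))"
      using prod.permute[OF sp, of "\<lambda>j. w j ^ t (\<sigma> j)"] by (simp add: comp_def)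
    also have "\<dots> = (\<Prod>j<n. w j ^ t ((\<sigma> \<circ> ?s) j))"
      by (rule prod.cong[OF refl]) (use xy(5) in \<open>auto simp: transpose_def\<close>)
    finally show "?h (\<sigma> \<circ> ?s) = - ?h \<sigma>" unfolding sg by simp
  qed
  finally have "(\<Sum>\<sigma>\<in>class_perms n c. ?h \<sigma>) = - (\<Sum>\<sigma>\<in>class_perms n c. ?h \<sigma>)"
    by (simp only: sum_negf)
  then show ?thesis by simp
qed

context arrangement
begin

text \<open>
  The sorted positions \<open>0, \<dots>, n - 1\<close> are split into residue classes modulo \<open>k - 1\<close>. The
  element is a monomial times the product of the Vandermonde determinants in the \<open>x\<^sub>i\<^sup>l\<close> over the
  classes: among \<open>k\<close> positions two lie in the same class.
\<close>

lemma alternant_exists: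
  assumes \<mu>: "\<mu> \<in> M"
  shows "\<exists>g\<in>ideal. lookup g \<mu> = 1 \<and> (\<forall>\<nu>\<in>keys g. \<nu> \<noteq> \<mu> \<longrightarrow> psi n \<nu> < psi n \<mu>) \<and>
    keys g \<subseteq> resid n \<mu>"
proof -
  have comp: "\<mu> \<in> compositions n" and adm: "admissible n l k \<mu>" and nd: "nondec n \<mu> (m + 1) \<ge> 1"
    using \<mu> by (auto simp: M_def)
  \<comment> \<open>A rank j is written as (j div d) d + j mod d: the residue names the class, and j
    div d is the exponent of the l-th power in the diagonal term.\<close>
  define d where "d = k - 1"
  have d: "d > 0" "d < n" using k2 kn by (auto simp: d_def)
  define u where "u = pos n \<mu>"
  define L where "L = int (Suc n) * int l"
  have L: "L > 0" using l_pos by (simp add: L_def)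
  have u_in: "u j \<in> {1..n}" if "j < n" for j unfolding u_def by (rule pos_in[OF that])
  have u_bij: "bij_betw u {..<n} {1..n}" unfolding u_def by (rule pos_bij)
  have u_rk: "u (rk n \<mu> i) = i" if "i \<in> {1..n}" for i unfolding u_def by (rule pos_rk[OF that])
  have split: "y = x + (y div d - x div d) * d" if "x \<le> y" "x mod d = y mod d" for x y
  proof -
    have "x div d \<le> y div d" by (rule div_le_mono[OF that(1)])
    have "(y div d - x div d) * d = y div d * d - x div d * d" by (rule diff_mult_distrib)
    moreover have "x = x div d * d + x mod d" "y = y div d * d + y mod d" by simp_all
    moreover have "x div d * d \<le> y div d * d" using \<open>x div d \<le> y div d\<close> by simp
    ultimately show ?thesis using that(2) by linarith
  qed
  have div_less: "x div d < y div d" if "x < y" "x mod d = y mod d" for x y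
  proof (rule ccontr)
    assume "\<not> ?thesis"
    then show False using split[of x y] that by simp
  qed
  have kstep: "kap n \<mu> (u x) + int (y div d - x div d) * L < kap n \<mu> (u y)"
    if "x < y" "y < n" "x mod d = y mod d" for x y
  proof -
    let ?t = "y div d - x div d"
    have y: "y = x + ?t * (k - 1)" using split[of x y] that unfolding d_def by simp
    have "x + ?t * (k - 1) < n" using y that(2) by (simp only:)
    from admissible_steps[OF k2 kn adm this] div_less[OF that(1,3)]
    have "kap n \<mu> (u x) + int ?t * L < kap n \<mu> (u (x + ?t * (k - 1)))"
      by (simp add: u_def L_def)
    then show ?thesis unfolding y[symmetric] .
  qed
  have lstep: "lookup \<mu> (u x) + l * (y div d - x div d) \<le> lookup \<mu> (u y)"
    if "x \<le> y" "y < n" "x mod d = y mod d" for x y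
  proof (cases "x = y")
    case False
    then have xy: "x < y" using that(1) by simp
    have "kap n \<mu> (u x) + int (Suc n) * int (l * (y div d - x div d)) < kap n \<mu> (u y)"
      using kstep[OF xy that(2,3)] by (simp only: L_def of_nat_mult ac_simps)
    then show ?thesis using kap_gap[OF u_in[OF that(2)] u_in, of x \<mu> "l * (y div d - x div d)"] xy that(2) by auto
  qed simp
  have low: "lookup \<mu> (u (j mod d)) + l * (j div d) \<le> lookup \<mu> (u j)" if "j < n" for j
    using lstep[of "j mod d" j] that d by simp
  \<comment> \<open>What remains of \<mu> after removing the diagonal term of the determinants. By
    \<open>low\<close> the subtraction is not truncated, and the result is at least the smallest
    entry of the class.\<close>
  define e where "e j = lookup \<mu> (u j) - l * (j div d)" for j
  have e: "e j + l * (j div d) = lookup \<mu> (u j)" if "j < n" for j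
    using low[OF that] by (simp add: e_def)
  define P where "P = class_perms n (\<lambda>j. j mod d)"
  define E where "E \<sigma> = (\<Sum>j<n. single (u j) (e j + l * (\<sigma> j div d)))" for \<sigma> :: "nat \<Rightarrow> nat"
  have E_u: "lookup (E \<sigma>) (u j) = e j + l * (\<sigma> j div d)" if "j < n" for \<sigma> j
  proof -
    have "lookup (E \<sigma>) (u j) = (\<Sum>x<n. if x = j then e x + l * (\<sigma> x div d) else 0)"
      unfolding E_def lookup_sum
      by (rule sum.cong[OF refl])
        (use inj_on_eq_iff[OF bij_betw_imp_inj_on[OF u_bij], of _ j] that in \<open>auto simp: lookup_single when_def\<close>)
    then show ?thesis using that by simp
  qed
  have E_comp: "E \<sigma> \<in> compositions n" for \<sigma>
    unfolding compositions_def
  proof clarify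
    fix i assume "i \<in> keys (E \<sigma>)"
    then have "(\<Sum>x<n. lookup (single (u x) (e x + l * (\<sigma> x div d))) i) \<noteq> 0"
      by (simp add: E_def in_keys_iff lookup_sum)
    then obtain x where "x < n" "lookup (single (u x) (e x + l * (\<sigma> x div d))) i \<noteq> 0"
      by (meson lessThan_iff sum.neutral)
    then show "i \<in> {1..n}" using u_in[of x] by (auto simp: lookup_single when_def split: if_splits)
  qed
  have E_id: "E id = \<mu>"
  proof (rule composition_eqI[OF E_comp comp])
    fix i assume i: "i \<in> {1..n}"
    show "lookup (E id) i = lookup \<mu> i"
      using E_u[OF rk_less[OF i, of \<mu>], of id] e[OF rk_less[OF i, of \<mu>]] u_rk[OF i] by simp
  qed
  have E_resid: "E \<sigma> \<in> resid n \<mu>" for \<sigma>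
    unfolding resid_def
  proof (intro CollectI conjI E_comp ballI)
    fix i assume i: "i \<in> {1..n}"
    let ?j = "rk n \<mu> i"
    have j: "?j < n" by (rule rk_less[OF i])
    have "lookup (E \<sigma>) i = e ?j + l * (\<sigma> ?j div d)" "lookup \<mu> i = e ?j + l * (?j div d)"
      using E_u[OF j, of \<sigma>] e[OF j] u_rk[OF i] by simp_all
    then show "lookup (E \<sigma>) i mod l = lookup \<mu> i mod l" by simp
  qed
  define a where "a j = kap n \<mu> (u j) - L * int (j div d)" for j
  have kapE: "kap n (E \<sigma>) (u j) = a j + L * int (\<sigma> j div d)" if "j < n" for \<sigma> j
    unfolding a_def kap_def E_u[OF that] e[OF that, symmetric] L_def by (simp add: algebra_simps)
  \<comment> \<open>The squares are only permuted, so \<open>psi\<close> depends on \<sigma> through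
    the mixed sum alone, to which the rearrangement inequality applies.\<close>
  have psiE: "psi n (E \<sigma>) = (\<Sum>j<n. (a j)\<^sup>2) + L\<^sup>2 * (\<Sum>j<n. (int (j div d))\<^sup>2) +
      2 * L * (\<Sum>j<n. a j * int (\<sigma> j div d))" if "\<sigma> \<in> P" for \<sigma>
  proof -
    have p: "\<sigma> permutes {..<n}" using that by (simp add: P_def class_perms_def)
    have "psi n (E \<sigma>) = (\<Sum>j<n. (kap n (E \<sigma>) (u j))\<^sup>2)"
      unfolding psi_def by (rule sum.reindex_bij_betw[OF u_bij, symmetric])
    also have "\<dots> = (\<Sum>j<n. (a j)\<^sup>2 + L\<^sup>2 * (int (\<sigma> j div d))\<^sup>2 + 2 * L * (a j * int (\<sigma> j div d)))"
      by (rule sum.cong[OF refl]) (simp add: kapE power2_eq_square algebra_simps)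
    also have "\<dots> = (\<Sum>j<n. (a j)\<^sup>2) + L\<^sup>2 * (\<Sum>j<n. (int (\<sigma> j div d))\<^sup>2) +
        2 * L * (\<Sum>j<n. a j * int (\<sigma> j div d))"
      by (simp only: sum.distrib sum_distrib_left)
    also have "(\<Sum>j<n. (int (\<sigma> j div d))\<^sup>2) = (\<Sum>j<n. (int (j div d))\<^sup>2)"
      using sum.permute[OF p, of "\<lambda>j. (int (j div d))\<^sup>2"] by (simp add: comp_def)
    finally show ?thesis .
  qed
  have id_P: "id \<in> P" by (simp add: P_def class_perms_def permutes_id)
  have lead: "psi n (E \<sigma>) < psi n \<mu>" if \<sigma>: "\<sigma> \<in> P" "\<sigma> \<noteq> id" for \<sigma>
  proof -
    have "(\<Sum>j<n. a j * int (\<sigma> j div d)) < (\<Sum>j<n. a j * int (j div d))"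
    proof (rule rearrangement_strict[where c = "\<lambda>j. j mod d" and b = "\<lambda>j. int (j div d)"])
      fix x y assume xy: "x < y" "y < n" "x mod d = y mod d"
      show "int (x div d) < int (y div d)" using div_less[OF xy(1,3)] by simp
      have "int (y div d - x div d) = int (y div d) - int (x div d)"
        using div_less[OF xy(1,3)] by simp
      then show "a x < a y" using kstep[OF xy] unfolding a_def by (simp add: algebra_simps)
    qed (use \<sigma> in \<open>auto simp: P_def\<close>)
    then have "psi n (E \<sigma>) < psi n (E id)" unfolding psiE[OF \<sigma>(1)] psiE[OF id_P] using L by simp
    then show ?thesis unfolding E_id .
  qed
  have finP: "finite P" unfolding P_def by (rule finite_class_perms)
  define g :: "complex mpoly" where "g = (\<Sum>\<sigma>\<in>P. single (E \<sigma>) (of_int (sign \<sigma>)))"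
  have keys_g: "\<exists>\<sigma>\<in>P. \<nu> = E \<sigma>" if "\<nu> \<in> keys g" for \<nu>
  proof -
    have "(\<Sum>\<sigma>\<in>P. lookup (single (E \<sigma>) (of_int (sign \<sigma>) :: complex)) \<nu>) \<noteq> 0"
      using that by (simp add: g_def in_keys_iff lookup_sum)
    then obtain \<sigma> where "\<sigma> \<in> P" "lookup (single (E \<sigma>) (of_int (sign \<sigma>) :: complex)) \<nu> \<noteq> 0"
      by (meson sum.neutral)
    then show ?thesis by (auto simp: lookup_single when_def split: if_splits)
  qed
  have "lookup g \<mu> = (\<Sum>\<sigma>\<in>P. if \<sigma> = id then 1 else 0)"
    unfolding g_def lookup_sum
  proof (rule sum.cong[OF refl])
    fix \<sigma> assume s: "\<sigma> \<in> P"
    show "lookup (single (E \<sigma>) (of_int (sign \<sigma>) :: complex)) \<mu> = (if \<sigma> = id then 1 else 0)"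
    proof (cases "\<sigma> = id")
      case True
      then show ?thesis by (simp only: E_id lookup_single_eq sign_id) simp
    next
      case False
      then have "E \<sigma> \<noteq> \<mu>" using lead[OF s] by auto
      then show ?thesis using False by (simp add: lookup_single)
    qed
  qed
  then have g1: "lookup g \<mu> = 1" using finP id_P by simp
  have g2: "psi n \<nu> < psi n \<mu>" if \<nu>: "\<nu> \<in> keys g" "\<nu> \<noteq> \<mu>" for \<nu>
  proof -
    obtain \<sigma> where s: "\<sigma> \<in> P" "\<nu> = E \<sigma>" using keys_g[OF \<nu>(1)] by blast
    have "\<sigma> \<noteq> id" using s(2) \<nu>(2) E_id by auto
    then show ?thesis unfolding s(2) by (rule lead[OF s(1)])
  qed
  have g3: "keys g \<subseteq> resid n \<mu>" using keys_g E_resid by blast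
  then have gr: "g \<in> poly_ring n" by (auto simp: poly_ring_def resid_def)
  have eval_g: "eval v g = (\<Prod>j<n. v (u j) ^ e j) *
      (\<Sum>\<sigma>\<in>P. of_int (sign \<sigma>) * (\<Prod>j<n. (v (u j) ^ l) ^ (\<sigma> j div d)))" for v
  proof -
    have "monom_val v (E \<sigma>) = (\<Prod>j<n. v (u j) ^ e j) * (\<Prod>j<n. (v (u j) ^ l) ^ (\<sigma> j div d))" for \<sigma>
    proof -
      have "monom_val v (E \<sigma>) = (\<Prod>i\<in>{1..n}. v i ^ lookup (E \<sigma>) i)"
        by (rule monom_val_superset) (use E_comp[of \<sigma>] in \<open>simp_all add: compositions_def\<close>)
      also have "\<dots> = (\<Prod>j<n. v (u j) ^ lookup (E \<sigma>) (u j))"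
        by (rule prod.reindex_bij_betw[OF u_bij, symmetric])
      also have "\<dots> = (\<Prod>j<n. v (u j) ^ e j * (v (u j) ^ l) ^ (\<sigma> j div d))"
        by (rule prod.cong[OF refl]) (simp add: E_u power_add power_mult)
      finally show ?thesis by (simp only: prod.distrib)
    qed
    then show ?thesis
      unfolding g_def eval_sum eval_single sum_distrib_left by (simp only: mult.left_commute)
  qed
  have coincide: "eval v g = 0"
    if "x < n" "y < n" "x \<noteq> y" "x mod d = y mod d" "v (u x) ^ l = v (u y) ^ l" for v x y
    unfolding eval_g P_def
    using alternating_sum_zero[where c = "\<lambda>j. j mod d" and w = "\<lambda>j. v (u j) ^ l" and t = "\<lambda>j. j div d", OF that]
    by simp
  have "eval v g = 0" if v: "on_arr v" for v
    using v unfolding on_arr_def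
  proof (elim disjE exE conjE)
    fix S assume S: "S \<subseteq> {1..n}" "card S = k" "\<forall>i\<in>S. \<forall>j\<in>S. v i ^ l = v j ^ l"
    let ?J = "rk n \<mu> ` S"
    have "card ?J = k" using card_image[OF inj_on_subset[OF rk_inj S(1)], of \<mu>] S(2) by simp
    moreover have "card ((\<lambda>j. j mod d) ` ?J) \<le> card {..<d}"
      by (rule card_mono) (use d in auto)
    ultimately have "\<not> inj_on (\<lambda>j. j mod d) ?J" using k2 by (intro pigeonhole) (simp add: d_def)
    then obtain i i' where i: "i \<in> S" "i' \<in> S" "rk n \<mu> i mod d = rk n \<mu> i' mod d" "rk n \<mu> i \<noteq> rk n \<mu> i'"
      unfolding inj_on_def by blast
    have n: "i \<in> {1..n}" "i' \<in> {1..n}" using i S(1) by auto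
    show ?thesis
    proof (rule coincide[OF rk_less[OF n(1)] rk_less[OF n(2)] i(4,3)])
      show "v (u (rk n \<mu> i)) ^ l = v (u (rk n \<mu> i')) ^ l"
        unfolding u_rk[OF n(1)] u_rk[OF n(2)] by (rule S(3)[rule_format, OF i(1,2)])
    qed
  next
    assume c: "m + 1 \<le> card {i \<in> {1..n}. v i = 0}"
    let ?Z = "{i \<in> {1..n}. v i = 0}"
    let ?J = "rk n \<mu> ` ?Z"
    have Zn: "?Z \<subseteq> {1..n}" by auto
    show ?thesis
    proof (cases "inj_on (\<lambda>j. j mod d) ?J")
      case False
      then obtain i i' where i: "i \<in> ?Z" "i' \<in> ?Z" "rk n \<mu> i mod d = rk n \<mu> i' mod d" "rk n \<mu> i \<noteq> rk n \<mu> i'"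
        unfolding inj_on_def by blast
      have n: "i \<in> {1..n}" "i' \<in> {1..n}" using i(1,2) by auto
      show ?thesis
      proof (rule coincide[OF rk_less[OF n(1)] rk_less[OF n(2)] i(4,3)])
        show "v (u (rk n \<mu> i)) ^ l = v (u (rk n \<mu> i')) ^ l"
          unfolding u_rk[OF n(1)] u_rk[OF n(2)] using i(1,2) by simp
      qed
    next
      case True
      \<comment> \<open>More than m zeros in different classes include one whose residue is at least
        m. The smallest entry of its class is at least \<open>nondec n \<mu> (m + 1)\<close>, hence
        positive, so its variable divides the monomial factor.\<close>
      have "\<exists>i\<in>?Z. m \<le> rk n \<mu> i mod d"
      proof (rule ccontr)
        assume "\<not> ?thesis"
        then have "(\<lambda>j. j mod d) ` ?J \<subseteq> {..<m}" by auto
        then have "card ((\<lambda>j. j mod d) ` ?J) \<le> card {..<m}" by (intro card_mono) simp_all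
        moreover have "card ((\<lambda>j. j mod d) ` ?J) = card ?Z"
          using card_image[OF True] card_image[OF inj_on_subset[OF rk_inj Zn], of \<mu>] by simp
        ultimately show False using c by simp
      qed
      then obtain i where i: "i \<in> {1..n}" "v i = 0" "m \<le> rk n \<mu> i mod d" by auto
      let ?j = "rk n \<mu> i"
      have j: "?j < n" by (rule rk_less[OF i(1)])
      have "?j mod d < n" using d by (meson less_trans mod_less_divisor)
      then have "lookup \<mu> (u m) \<le> lookup \<mu> (u (?j mod d))"
        unfolding u_def by (rule lookup_pos_le[OF i(3)])
      moreover have "lookup \<mu> (u m) \<ge> 1"
        using nd nondec_pos[of "m + 1" n \<mu>] mk kn k2 by (simp add: u_def)
      ultimately have "e ?j > 0" using low[OF j] e[OF j] by linarith
      then have "v (u ?j) ^ e ?j = 0" using u_rk[OF i(1)] i(2) by simp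
      then have "(\<Prod>j<n. v (u j) ^ e j) = 0" using j by (intro prod_zero) auto
      then show ?thesis unfolding eval_g by simp
    qed
  qed
  then have "g \<in> ideal" using gr by (simp add: ideal_def)
  then show ?thesis using g1 g2 g3 by blast
qed

section \<open>The basis\<close>

lemma reduce_linear:
  fixes W :: "complex mpoly set"
  assumes W: "0 \<in> W" "\<And>f g. f \<in> W \<Longrightarrow> g \<in> W \<Longrightarrow> f + g \<in> W" "\<And>c f. f \<in> W \<Longrightarrow> const c * f \<in> W"
    and "finite A" "\<And>\<nu>. \<nu> \<in> A \<Longrightarrow> \<exists>g\<in>W. keys (single \<nu> 1 - g) \<subseteq> Q"
  shows "\<exists>g\<in>W. keys ((\<Sum>\<nu>\<in>A. single \<nu> (c \<nu>)) - g) \<subseteq> Q"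
  using assms(4,5)
proof induction
  case empty
  show ?case by (rule bexI[of _ 0]) (simp_all add: W(1))
next
  case (insert \<nu> A)
  then obtain g where g: "g \<in> W" "keys ((\<Sum>\<nu>\<in>A. single \<nu> (c \<nu>)) - g) \<subseteq> Q" by blast
  obtain h where h: "h \<in> W" "keys (single \<nu> 1 - h) \<subseteq> Q" using insert.prems[of \<nu>] by blast
  have eq: "(\<Sum>\<nu>\<in>insert \<nu> A. single \<nu> (c \<nu>)) - (const (c \<nu>) * h + g) =
      const (c \<nu>) * (single \<nu> 1 - h) + ((\<Sum>\<nu>\<in>A. single \<nu> (c \<nu>)) - g)"
    using insert.hyps by (simp add: single_eq_const_mult[of \<nu> "c \<nu>"] right_diff_distrib)
  have "keys (const (c \<nu>) * (single \<nu> 1 - h)) \<subseteq> Q"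
    using h(2) by (auto simp: in_keys_iff)
  then have "keys ((\<Sum>\<nu>\<in>insert \<nu> A. single \<nu> (c \<nu>)) - (const (c \<nu>) * h + g)) \<subseteq> Q"
    unfolding eq using g(2) keys_add[of "const (c \<nu>) * (single \<nu> 1 - h)"
        "(\<Sum>\<nu>\<in>A. single \<nu> (c \<nu>)) - g"] by blast
  then show ?case using W g(1) h(1) by (intro bexI[of _ "const (c \<nu>) * h + g"]) auto
qed

text \<open>Division with remainder, by recursion on \<open>psi\<close>: an exponent in
  \<open>M\<close> is cancelled by an element of \<open>W\<close> leading there. The set
  \<open>P\<close> of permitted exponents is a residue class when \<open>W\<close> is the ideal and
  all compositions when \<open>W\<close> is the span.\<close>

lemma reduce:
  fixes W :: "complex mpoly set"
  assumes W: "0 \<in> W" "\<And>f g. f \<in> W \<Longrightarrow> g \<in> W \<Longrightarrow> f + g \<in> W" "\<And>c f. f \<in> W \<Longrightarrow> const c * f \<in> W"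
    and lead: "\<And>\<nu>. \<nu> \<in> M \<inter> P \<Longrightarrow> \<exists>h\<in>W. lookup h \<nu> = 1 \<and>
      (\<forall>\<alpha>\<in>keys h. \<alpha> \<noteq> \<nu> \<longrightarrow> psi n \<alpha> < psi n \<nu>) \<and> keys h \<subseteq> P"
    and f: "keys f \<subseteq> P"
  shows "\<exists>g\<in>W. keys (f - g) \<subseteq> P - M"
proof -
  have mono: "\<exists>g\<in>W. keys (single \<nu> 1 - g) \<subseteq> P - M" if "\<nu> \<in> P" for \<nu>
    using that
  proof (induction "nat (psi n \<nu>)" arbitrary: \<nu> rule: less_induct)
    case less
    show ?case
    proof (cases "\<nu> \<in> M")
      case False
      then show ?thesis using W(1) less.prems by (intro bexI[of _ 0]) auto
    next
      case True
      then obtain h where h: "h \<in> W" "lookup h \<nu> = 1"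
        "\<And>\<alpha>. \<alpha> \<in> keys h \<Longrightarrow> \<alpha> \<noteq> \<nu> \<Longrightarrow> psi n \<alpha> < psi n \<nu>" "keys h \<subseteq> P"
        using lead[of \<nu>] less.prems by blast
      let ?A = "keys h - {\<nu>}"
      have "\<exists>g\<in>W. keys ((\<Sum>\<alpha>\<in>?A. single \<alpha> (- lookup h \<alpha>)) - g) \<subseteq> P - M"
      proof (rule reduce_linear[OF W])
        fix \<alpha> assume \<alpha>: "\<alpha> \<in> ?A"
        then have "psi n \<alpha> < psi n \<nu>" "\<alpha> \<in> P" using h(3,4) by auto
        moreover have "nat (psi n \<alpha>) < nat (psi n \<nu>)"
          using calculation(1) psi_nonneg[of n \<alpha>] by simp
        ultimately show "\<exists>g\<in>W. keys (single \<alpha> 1 - g) \<subseteq> P - M" using less.hyps by blast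
      qed simp_all
      then obtain g where g: "g \<in> W" "keys ((\<Sum>\<alpha>\<in>?A. single \<alpha> (- lookup h \<alpha>)) - g) \<subseteq> P - M" by blast
      have "h = single \<nu> 1 + (\<Sum>\<alpha>\<in>?A. single \<alpha> (lookup h \<alpha>))"
        using sum_single_keys[of h] sum.remove[of "keys h" \<nu> "\<lambda>\<alpha>. single \<alpha> (lookup h \<alpha>)"] h(2)
        by (simp add: in_keys_iff)
      then have "single \<nu> 1 - (h + g) = (\<Sum>\<alpha>\<in>?A. single \<alpha> (- lookup h \<alpha>)) - g"
        by (simp add: single_uminus sum_negf algebra_simps)
      then have "keys (single \<nu> 1 - (h + g)) \<subseteq> P - M" using g(2) by (simp only:)
      then show ?thesis using W(2)[OF h(1) g(1)] by blast
    qed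
  qed
  have "\<exists>g\<in>W. keys ((\<Sum>\<alpha>\<in>keys f. single \<alpha> (lookup f \<alpha>)) - g) \<subseteq> P - M"
    by (rule reduce_linear[OF W]) (use mono f in auto)
  then show ?thesis unfolding sum_single_keys .
qed

lemma ideal_0: "0 \<in> ideal" and ideal_add: "f \<in> ideal \<Longrightarrow> g \<in> ideal \<Longrightarrow> f + g \<in> ideal"
  and ideal_const: "f \<in> ideal \<Longrightarrow> const c * f \<in> ideal"
  by (simp_all add: ideal_def poly_ring_add poly_ring_const_mult)

lemma ideal_diff: "f \<in> ideal \<Longrightarrow> g \<in> ideal \<Longrightarrow> f - g \<in> ideal"
  by (simp add: ideal_def poly_ring_diff)

section \<open>The specialized Jack polynomials\<close>

abbreviation jk :: "(nat \<Rightarrow>\<^sub>0 nat) \<Rightarrow> complex mpoly" where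
  "jk \<equiv> jack n l \<zeta> (1 / of_nat k)"

lemma jk_eigenvec:
  assumes "\<mu> \<in> M"
  shows "eigenvec n (1 / of_nat k) \<mu> (jk \<mu>)" "lookup (jk \<mu>) \<mu> = 1"
  using jack_eigenvec[OF root_of_unity_axioms, of \<mu> n "1 / of_nat k"]
    admissible_simple[OF k2 kn root_of_unity_axioms] assms
  by (auto simp: M_def)

lemma jk_simple:
  assumes "\<mu> \<in> M" "\<nu> \<in> resid n \<mu>"
    "\<And>i. i \<in> {1..n} \<Longrightarrow> wt n l (1 / of_nat k :: complex) \<nu> i = wt n l (1 / of_nat k) \<mu> i"
  shows "\<nu> = \<mu>"
  by (rule admissible_simple[OF k2 kn root_of_unity_axioms _ _ assms(2,3)])
    (use assms(1) in \<open>auto simp: M_def\<close>)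

text \<open>By simplicity \<mu> is the only maximizer of \<open>psi\<close> on the support; an
  exponent not below \<mu> would be a second one.\<close>

lemma jk_lead:
  assumes \<mu>: "\<mu> \<in> M" and \<nu>: "\<nu> \<in> keys (jk \<mu>)" "\<nu> \<noteq> \<mu>"
  shows "psi n \<nu> < psi n \<mu>"
proof -
  have top: "\<alpha> = \<mu>" if "\<alpha> \<in> keys (jk \<mu>)" "\<And>\<nu>. \<nu> \<in> keys (jk \<mu>) \<Longrightarrow> psi n \<nu> \<le> psi n \<alpha>" for \<alpha>
  proof (rule jk_simple[OF \<mu>])
    show "\<alpha> \<in> resid n \<mu>" using jk_eigenvec(1)[OF \<mu>] that(1) by (auto simp: eigenvec_def)
  qed (rule eigenvec_lead[OF jk_eigenvec(1)[OF \<mu>] that])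
  have "jk \<mu> \<noteq> 0" using \<nu>(1) by auto
  then obtain \<alpha> where \<alpha>: "\<alpha> \<in> keys (jk \<mu>)" "\<And>\<nu>. \<nu> \<in> keys (jk \<mu>) \<Longrightarrow> psi n \<nu> \<le> psi n \<alpha>"
    using leading_exponent by blast
  have a: "\<alpha> = \<mu>" by (rule top[OF \<alpha>])
  show ?thesis
  proof (rule ccontr)
    assume "\<not> ?thesis"
    then have "psi n \<beta> \<le> psi n \<nu>" if "\<beta> \<in> keys (jk \<mu>)" for \<beta> using \<alpha>(2)[OF that] a by simp
    then have "\<nu> = \<mu>" by (rule top[OF \<nu>(1)])
    then show False using \<nu>(2) by simp
  qed
qed

lemma jk_in_ideal:
  assumes \<mu>: "\<mu> \<in> M"
  shows "jk \<mu> \<in> ideal"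
proof -
  let ?c = "1 / of_nat k :: complex"
  have eig: "keys (jk \<mu>) \<subseteq> resid n \<mu>"
    "\<And>i. i \<in> {1..n} \<Longrightarrow> dunkl_z n l \<zeta> ?c i (jk \<mu>) = const (wt n l ?c \<mu> i) * jk \<mu>"
    using jk_eigenvec(1)[OF \<mu>] by (auto simp: eigenvec_def)
  \<comment> \<open>The reduction stays inside the residue class of \<mu>, where the eigenvalue is
    simple.\<close>
  have "\<exists>g\<in>ideal. keys (jk \<mu> - g) \<subseteq> resid n \<mu> - M"
  proof (rule reduce[OF ideal_0 ideal_add ideal_const])
    fix \<nu> assume \<nu>: "\<nu> \<in> M \<inter> resid n \<mu>"
    then have "resid n \<nu> = resid n \<mu>" by (auto simp: resid_def)
    then show "\<exists>h\<in>ideal. lookup h \<nu> = 1 \<and> (\<forall>\<alpha>\<in>keys h. \<alpha> \<noteq> \<nu> \<longrightarrow> psi n \<alpha> < psi n \<nu>) \<and> keys h \<subseteq> resid n \<mu>"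
      using alternant_exists[of \<nu>] \<nu> by auto
  qed (simp_all add: eig(1))
  then obtain g where g: "g \<in> ideal" "keys (jk \<mu> - g) \<subseteq> resid n \<mu> - M" by blast
  define f where "f = jk \<mu> - g"
  have "f = 0"
  proof (rule ccontr)
    assume "f \<noteq> 0"
    then obtain \<alpha> where \<alpha>: "\<alpha> \<in> keys f" "\<And>\<nu>. \<nu> \<in> keys f \<Longrightarrow> psi n \<nu> \<le> psi n \<alpha>"
      using leading_exponent by blast
    have aM: "\<alpha> \<notin> M" "\<alpha> \<in> resid n \<mu>" using g(2) \<alpha>(1) by (auto simp: f_def)
    have fr: "f \<in> poly_ring n" using g(2) by (auto simp: f_def poly_ring_def resid_def)
    have "wt n l ?c \<alpha> i = wt n l ?c \<mu> i" if i: "i \<in> {1..n}" for i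
    proof (rule ccontr)
      assume ne: "wt n l ?c \<alpha> i \<noteq> wt n l ?c \<mu> i"
      \<comment> \<open>As f + g is an eigenvector, this element of the ideal equals z_i f minus the
        eigenvalue times f. If the weights of \<alpha> and \<mu> differ at i, it leads at \<alpha>,
        which lies outside \<open>M\<close>.\<close>
      define h where "h = const (wt n l ?c \<mu> i) * g - dunkl_z n l \<zeta> ?c i g"
      have hI: "h \<in> ideal" unfolding h_def by (intro ideal_diff ideal_const ideal_z g(1) i)
      have "jk \<mu> = f + g" by (simp add: f_def)
      then have "dunkl_z n l \<zeta> ?c i f + dunkl_z n l \<zeta> ?c i g = const (wt n l ?c \<mu> i) * (f + g)"
        using eig(2)[OF i] dunkl_z_add[OF i, of ?c f g] by simp
      then have h: "h = dunkl_z n l \<zeta> ?c i f - const (wt n l ?c \<mu> i) * f"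
        unfolding h_def by (simp add: algebra_simps)
      have "lookup h \<alpha> = (wt n l ?c \<alpha> i - wt n l ?c \<mu> i) * lookup f \<alpha>"
        unfolding h lookup_minus lookup_const_mult
        by (subst dunkl_z_lead[OF i fr \<alpha>(2)]) (simp_all add: left_diff_distrib)
      then have "\<alpha> \<in> keys h" using ne \<alpha>(1) by (simp add: in_keys_iff)
      moreover have "psi n \<beta> \<le> psi n \<alpha>" if b: "\<beta> \<in> keys h" for \<beta>
      proof (cases "\<beta> \<in> keys f")
        case True
        then show ?thesis by (rule \<alpha>(2))
      next
        case False
        then have "\<beta> \<in> keys (dunkl_z n l \<zeta> ?c i f)"
          using b unfolding h by (simp add: in_keys_iff lookup_minus)
        then obtain \<nu> where "\<nu> \<in> keys f" "psi n \<beta> \<le> psi n \<nu>"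
          using dunkl_z_keys[OF i fr] by blast
        then show ?thesis using \<alpha>(2)[of \<nu>] by simp
      qed
      ultimately have "\<alpha> \<in> M" by (rule lead_in_M[OF hI])
      then show False using aM(1) by simp
    qed
    then have "\<alpha> = \<mu>" by (rule jk_simple[OF \<mu> aM(2)])
    then show False using \<mu> aM(1) by simp
  qed
  then show ?thesis using g(1) by (simp add: f_def)
qed

lemma jk_inj: "inj_on jk M"
proof (rule inj_onI, rule ccontr)
  fix \<mu> \<nu> assume h: "\<mu> \<in> M" "\<nu> \<in> M" "jk \<mu> = jk \<nu>" "\<mu> \<noteq> \<nu>"
  have "\<nu> \<in> keys (jk \<mu>)" "\<mu> \<in> keys (jk \<nu>)"
    using jk_eigenvec(2)[OF h(1)] jk_eigenvec(2)[OF h(2)] h(3) by (simp_all add: in_keys_iff)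
  then show False using jk_lead[OF h(1), of \<nu>] jk_lead[OF h(2), of \<mu>] h(4) by simp
qed

text \<open>Among the indices with nonzero coefficient, one that is maximal for \<open>psi\<close>
  is an exponent of no other polynomial involved, so its term cannot cancel.\<close>

lemma jk_independent: "mpoly.independent (jk ` M)"
proof
  assume "mpoly.dependent (jk ` M)"
  then obtain t u where t: "finite t" "t \<subseteq> jk ` M" "(\<Sum>v\<in>t. const (u v) * v) = 0" "\<exists>v\<in>t. u v \<noteq> 0"
    unfolding mpoly.dependent_explicit by blast
  define A where "A = {\<mu> \<in> M. jk \<mu> \<in> t \<and> u (jk \<mu>) \<noteq> 0}"
  have "finite A"
  proof (rule finite_imageD)
    show "finite (jk ` A)" by (rule finite_subset[OF _ t(1)]) (auto simp: A_def)
    show "inj_on jk A" by (rule inj_on_subset[OF jk_inj]) (auto simp: A_def)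
  qed
  moreover have "A \<noteq> {}" using t(2,4) by (auto simp: A_def)
  ultimately obtain \<mu> where \<mu>: "\<mu> \<in> A" "\<And>\<nu>. \<nu> \<in> A \<Longrightarrow> psi n \<nu> \<le> psi n \<mu>"
    using finite_arg_max_exists[of A "psi n"] by blast
  have \<mu>M: "\<mu> \<in> M" "jk \<mu> \<in> t" "u (jk \<mu>) \<noteq> 0" using \<mu>(1) by (auto simp: A_def)
  have "lookup (\<Sum>v\<in>t. const (u v) * v) \<mu> = (\<Sum>v\<in>t. if v = jk \<mu> then u (jk \<mu>) else 0)"
    unfolding lookup_sum
  proof (rule sum.cong[OF refl])
    fix v assume v: "v \<in> t"
    then obtain \<nu> where \<nu>: "\<nu> \<in> M" "v = jk \<nu>" using t(2) by blast
    show "lookup (const (u v) * v) \<mu> = (if v = jk \<mu> then u (jk \<mu>) else 0)"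
    proof (cases "v = jk \<mu>")
      case True
      then show ?thesis using jk_eigenvec(2)[OF \<mu>M(1)] by simp
    next
      case False
      then have ne: "\<mu> \<noteq> \<nu>" using \<nu>(2) by auto
      have "u v = 0 \<or> lookup v \<mu> = 0"
      proof (rule ccontr)
        assume "\<not> ?thesis"
        then have "\<nu> \<in> A" "\<mu> \<in> keys (jk \<nu>)" using \<nu> v by (auto simp: A_def in_keys_iff)
        then show False using \<mu>(2)[of \<nu>] jk_lead[OF \<nu>(1), of \<mu>] ne by simp
      qed
      then show ?thesis using False by auto
    qed
  qed
  then show False using t(1,3) \<mu>M by simp
qed

text \<open>An element of the ideal is reduced modulo the span to a remainder without exponents in
  \<open>M\<close>. The remainder lies in the ideal, where leading exponents belong to
  \<open>M\<close>, so it is 0.\<close>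

lemma jk_span: "mpoly.span (jk ` M) = ideal"
proof (intro equalityI subsetI)
  fix f assume "f \<in> mpoly.span (jk ` M)"
  moreover have "mpoly.span (jk ` M) \<subseteq> ideal"
    by (rule mpoly.span_minimal)
      (auto simp: mpoly.subspace_def jk_in_ideal ideal_0 ideal_add ideal_const)
  ultimately show "f \<in> ideal" by blast
next
  fix f assume f: "f \<in> ideal"
  have fr: "keys f \<subseteq> compositions n" using f by (auto simp: ideal_def poly_ring_def)
  have "\<exists>g\<in>mpoly.span (jk ` M). keys (f - g) \<subseteq> compositions n - M"
  proof (rule reduce[OF mpoly.span_zero mpoly.span_add mpoly.span_scale _ fr])
    fix \<nu> assume "\<nu> \<in> M \<inter> compositions n"
    then have \<nu>: "\<nu> \<in> M" by simp
    have "keys (jk \<nu>) \<subseteq> compositions n"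
      using eigenvec_poly_ring[OF jk_eigenvec(1)[OF \<nu>]] by (simp add: poly_ring_def)
    then show "\<exists>h\<in>mpoly.span (jk ` M). lookup h \<nu> = 1 \<and>
        (\<forall>\<alpha>\<in>keys h. \<alpha> \<noteq> \<nu> \<longrightarrow> psi n \<alpha> < psi n \<nu>) \<and> keys h \<subseteq> compositions n"
      using jk_eigenvec(2)[OF \<nu>] jk_lead[OF \<nu>] mpoly.span_base[of "jk \<nu>" "jk ` M"] \<nu> by blast
  qed
  then obtain g where g: "g \<in> mpoly.span (jk ` M)" "keys (f - g) \<subseteq> compositions n - M" by blast
  have "mpoly.span (jk ` M) \<subseteq> ideal"
    by (rule mpoly.span_minimal)
      (auto simp: mpoly.subspace_def jk_in_ideal ideal_0 ideal_add ideal_const)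
  then have d: "f - g \<in> ideal" using f g(1) by (intro ideal_diff) auto
  have "f - g = 0"
  proof (rule ccontr)
    assume "f - g \<noteq> 0"
    then obtain \<alpha> where \<alpha>: "\<alpha> \<in> keys (f - g)" "\<And>\<nu>. \<nu> \<in> keys (f - g) \<Longrightarrow> psi n \<nu> \<le> psi n \<alpha>"
      using leading_exponent by blast
    have "\<alpha> \<in> M" by (rule lead_in_M[OF d \<alpha>])
    then show False using g(2) \<alpha>(1) by blast
  qed
  then show "f \<in> mpoly.span (jk ` M)" using g(1) by simp
qed

end

text \<open>Injectivity is part of the claim because independence of the image set alone does not
  exclude that two indices give the same polynomial.\<close>

theorem theorem1p2:
  fixes k l m n :: nat and \<zeta> :: complex
  assumes "l \<ge> 1" and "n \<ge> 1" and "2 \<le> k" and "k \<le> n" and "m \<le> k - 1"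
    and "primitive_root_unity l \<zeta>"
  defines "I \<equiv> vanishing_ideal n (X_var k l n \<union> Y_var (m + 1) n)"
    and "f \<equiv> jack n l \<zeta> (1 / of_nat k)"
    and "M \<equiv> {\<mu> \<in> compositions n. nondec n \<mu> (m + 1) \<ge> 1 \<and> admissible n l k \<mu>}"
  shows "inj_on f M \<and> mpoly.independent (f ` M) \<and> mpoly.span (f ` M) = I"
proof -
  interpret A: arrangement l \<zeta> k m n
    by unfold_locales (use assms in \<open>auto simp: primitive_root_unity_def\<close>)
  have "M = A.M" by (simp add: M_def A.M_def)
  then show ?thesis
    unfolding f_def I_def A.ideal_eq using A.jk_inj A.jk_independent A.jk_span by simp
qed

end
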